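(* Let $x_1,x_2,\dots$ be i.i.d. random vectors in $\mathbb{R}^p$ with distribution $N(0,\Sigma)$, $\Sigma$ positive definite, and let $\tau>0$. For each $n$, run the Gaussian blurring mean-shift on the first $n$ samples: $x_{i,n}^{(0)}=x_i$ and $x_{i,n}^{(t+1)}=\frac{\sum_{j=1}^n f(x_{i,n}^{(t)}-x_{j,n}^{(t)})x_{j,n}^{(t)}}{\sum_{j=1}^n f(x_{i,n}^{(t)}-x_{j,n}^{(t)})}$ for $i=1,\dots,n$, with $f(u)=\exp(-u^\top u/(2\tau^2))$ (so all weights equal $1$). For each $n$, all $x_{i,n}^{(t)}$ ($i=1,\dots,n$) converge as $t\to\infty$ to a common limit $c_n\in\mathbb{R}^p$. Then, for each fixed $i$, $\lim_{n\to\infty}\lim_{t\to\infty}x_{i,n}^{(t)}=0$ almost surely, i.e. $c_n\to 0$ almost surely. *)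

theory Defs
  imports "HOL-Probability.Probability"
begin

definition gauss_kernel :: "real \<Rightarrow> real^'p \<Rightarrow> real" where
  "gauss_kernel \<tau> u = exp (- (u \<bullet> u) / (2 * \<tau>\<^sup>2))"

text \<open>Gaussian blurring mean-shift on the n points x 0, ..., x (n-1):
  bms tau n x t i is x_{i,n}^{(t)} (indices shifted to start at 0).\<close>
fun bms :: "real \<Rightarrow> nat \<Rightarrow> (nat \<Rightarrow> real^'p) \<Rightarrow> nat \<Rightarrow> nat \<Rightarrow> real^'p" where
  "bms \<tau> n x 0 = x"
| "bms \<tau> n x (Suc t) =
     (let y = bms \<tau> n x t in
      (\<lambda>i. (1 / (\<Sum>j<n. gauss_kernel \<tau> (y i - y j))) *\<^sub>R
            (\<Sum>j<n. gauss_kernel \<tau> (y i - y j) *\<^sub>R y j)))"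

definition pos_def_matrix :: "real^'p^'p \<Rightarrow> bool" where
  "pos_def_matrix S \<longleftrightarrow> transpose S = S \<and> (\<forall>v. v \<noteq> 0 \<longrightarrow> v \<bullet> (S *v v) > 0)"

definition mvn_density :: "real^'p^'p \<Rightarrow> real^'p \<Rightarrow> real" where
  "mvn_density S x =
     exp (- (x \<bullet> (matrix_inv S *v x)) / 2) / sqrt ((2 * pi) ^ CARD('p) * det S)"

definition mvn :: "real^'p^'p \<Rightarrow> (real^'p) measure" where
  "mvn S = density lborel (\<lambda>x. ennreal (mvn_density S x))"

end

theory Submission
  imports Defs "HOL-Real_Asymp.Real_Asymp"
begin

text \<open>
  For fixed $n$ each step replaces every point by a convex combination with weights bounded below,
  so in every coordinate the range shrinks geometrically and all points converge to a common limit.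

  For $n \to \infty$ write $S = \Sigma^{-1}$. A population distributed as the linear image $B X$ of
  $X \sim N(0, \Sigma)$ is sent to $B A X$, where $A u$ is the mean of the Gaussian with density proportional
  to $f(B u - B v) e^{-v^\top S v / 2}$ in $v$. Iterating from $B = I$ gives maps $B_t \to 0$. The key claim is that
  almost surely, for each fixed $t$ and $\eta > 0$, eventually
  $|x_{i,n}^{(t)} - B_t x_i| \le \eta (1 + |x_i|)$ for all $i < n$. For bounded $x_i$ this is a uniform law
  of large numbers. For large $x_i$ it follows from two bounds with deviations on the scale of $|x_i|$:
  completing the square turns the single moment bound $\sum_j e^{(1-\delta) x_j^\top S x_j / 2} \le C n$ into an upper
  bound for the weight of the points away from $A x_i$, and a Chernoff bound shows that there are enough
  points near $A x_i$, because $(A x_i)^\top S (A x_i)$ stays below $2 \ln n$.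

  After a large fixed number of steps all points satisfy $|x_{i,n}^{(t)}| \le \epsilon (1 + |x_i|)$. From there on a
  deterministic induction shows that every further step halves the coefficient of $|x_i|$, while the
  points drift by at most $O(\epsilon)$ in total; hence $|c_n| = O(\epsilon)$.
\<close>

section \<open>Almost sure bounds for i.i.d. samples\<close>

text \<open>For fixed n the contraction rate of the averaging depends on the size of the sample,
  which grows with n, so the two limits cannot be exchanged through that rate; hence the cut at a
  fixed number of steps. The tolerance is relative because an error eta |x_i| costs only factors
  exp(kappa |x_i|^2) with kappa small, whereas points at distance rho = e |x_i| / 2 from A x_i are
  suppressed by exp(-a0 rho^2 / 8): both exponents are quadratic in |x_i|, so the gain wins for
  small kappa. The weight around x_i is governed by the least value m over y of q(y) + |B x_i - B
  y|^2 / tau^2, where q(y) = y . S y. It satisfies m \<le> l q(x_i) with one l < 1 for all steps.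
  This inequality yields the decay of B_t, and it also keeps A x_i inside the region where sample
  points are plentiful. All maps act on the initial positions, so laws of large numbers are used
  only for the original independent sample, never for the dependent moved points.\<close>

text \<open>Turns the summability needed for Borel-Cantelli into an order estimate that
  \<open>real_asymp\<close> can decide.\<close>

lemma summable_bigo_inverse_square:
  fixes f :: "nat \<Rightarrow> real"
  assumes "f \<in> O(\<lambda>k. 1 / real k ^ 2)"
  shows "summable f"
proof -
  obtain B where "\<forall>\<^sub>F k in sequentially. norm (f k) \<le> B * norm (1 / real k ^ 2)"
    using assms landau_o.bigE by blast
  then have "\<forall>\<^sub>F k in sequentially. norm (f k) \<le> B * (1 / real k ^ 2)" by simp
  moreover have "summable (\<lambda>k. B * (1 / real k ^ 2))"
    using inverse_power_summable[of 2, where 'a=real] by (intro summable_mult) (simp add: field_simps)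
  ultimately show ?thesis by (rule summable_comparison_test_ev)
qed

locale iid_sample = prob_space M for M :: "'a measure" +
  fixes X :: "nat \<Rightarrow> 'a \<Rightarrow> 'b::euclidean_space" and N :: "'b measure"
  assumes indep: "indep_vars (\<lambda>_. borel) X UNIV"
    and distr_X: "distr M borel (X i) = N"
begin

lemma measurable_X [measurable]: "X i \<in> borel_measurable M"
  using indep unfolding indep_vars_def by auto

lemma sets_N [measurable_cong, simp]: "sets N = sets borel"
  using distr_X[of 0] by auto

lemma space_N [simp]: "space N = UNIV"
  using distr_X[of 0] by auto

lemma prob_space_N: "prob_space N"
  using prob_space_distr[OF measurable_X[of 0]] by (simp add: distr_X)

lemma nn_integral_X:
  assumes [measurable]: "g \<in> borel_measurable borel"
  shows "(\<integral>\<^sup>+\<omega>. g (X i \<omega>) \<partial>M) = (\<integral>\<^sup>+x. g x \<partial>N)"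
  by (subst distr_X[of i, symmetric], subst nn_integral_distr) auto

lemma emeasure_X:
  assumes "A \<in> sets borel"
  shows "emeasure M {\<omega>\<in>space M. X i \<omega> \<in> A} = emeasure N A"
  using assms by (subst distr_X[of i, symmetric], subst emeasure_distr)
    (auto intro!: arg_cong[where f="emeasure M"])

text \<open>Markov's inequality for the exponential of the sum, which factorises by independence.
  The integral lives in \<open>ennreal\<close>, so no integrability of \<open>exp (h x)\<close> has
  to be shown beforehand.\<close>

lemma chernoff_bound:
  assumes [measurable]: "h \<in> borel_measurable borel"
  shows "emeasure M {\<omega>\<in>space M. a \<le> (\<Sum>j<n. h (X j \<omega>))}
           \<le> ennreal (exp (- a)) * (\<integral>\<^sup>+x. ennreal (exp (h x)) \<partial>N) ^ n"
proof -
  have "emeasure M {\<omega>\<in>space M. 1 \<le> ennreal (exp (- a)) * ennreal (exp (\<Sum>j<n. h (X j \<omega>)))}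
      \<le> ennreal (exp (- a)) * (\<integral>\<^sup>+\<omega>. ennreal (exp (\<Sum>j<n. h (X j \<omega>))) * indicator (space M) \<omega> \<partial>M)"
    by (rule nn_integral_Markov_inequality) measurable
  also have "(\<integral>\<^sup>+\<omega>. ennreal (exp (\<Sum>j<n. h (X j \<omega>))) * indicator (space M) \<omega> \<partial>M)
      = (\<integral>\<^sup>+\<omega>. (\<Prod>j<n. ennreal (exp (h (X j \<omega>)))) \<partial>M)"
    by (intro nn_integral_cong) (simp add: exp_sum prod_ennreal)
  also have "\<dots> = (\<Prod>j<n. \<integral>\<^sup>+\<omega>. ennreal (exp (h (X j \<omega>))) \<partial>M)"
    by (intro indep_vars_nn_integral indep_vars_compose2[OF indep_vars_subset[OF indep]]) auto
  also have "\<dots> = (\<integral>\<^sup>+x. ennreal (exp (h x)) \<partial>N) ^ n"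
    by (subst nn_integral_X[of "\<lambda>x. ennreal (exp (h x))"]) auto
  also have "{\<omega>\<in>space M. 1 \<le> ennreal (exp (- a)) * ennreal (exp (\<Sum>j<n. h (X j \<omega>)))}
      = {\<omega>\<in>space M. a \<le> (\<Sum>j<n. h (X j \<omega>))}"
    by (simp add: ennreal_mult'[symmetric] exp_add[symmetric] flip: ennreal_1)
  finally show ?thesis .
qed

text \<open>The summands are nonnegative and only a linear upper bound is wanted, so it suffices to
  control the partial sums at \<open>n = 2 ^ k\<close>. There the summands are truncated: the moment
  of order \<open>1 + \<gamma>\<close> makes an exceedance unlikely, and a Chernoff bound handles
  the truncated sum.\<close>

lemma AE_sum_le_linear:
  assumes Y [measurable]: "Y \<in> borel_measurable borel" and nn: "\<And>x. Y x \<ge> 0"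
    and \<gamma>: "\<gamma> > 0" and int: "integrable N Y" and int': "integrable N (\<lambda>x. Y x powr (1 + \<gamma>))"
  shows "AE \<omega> in M. \<exists>C. \<forall>n. (\<Sum>j<n. Y (X j \<omega>)) \<le> C * real n"
proof -
  interpret N: prob_space N by (rule prob_space_N)
  have [simp]: "measure N UNIV = 1" using N.prob_space by simp
  define m where "m = (\<integral>x. Y x \<partial>N)"
  define m' where "m' = (\<integral>x. Y x powr (1 + \<gamma>) \<partial>N)"
  \<comment> \<open>The level lies below \<open>2 ^ k\<close> by a factor of order \<open>k\<close>,
    so that the truncated sum fails with probability at most \<open>exp (- (k + 1))\<close>; it is
    still high enough for \<open>2 ^ k * (m' / c k powr (1 + \<gamma>))\<close> to be
    summable.\<close>
  define c where "c k = 2 ^ k / (real k + 1)" for k :: nat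
  \<comment> \<open>Twice the mean is the price of \<open>exp z \<le> 1 + 2 * z\<close> for
    \<open>z\<close> between 0 and 1; the extra 1 leaves the exponent
    \<open>- (k + 1)\<close>.\<close>
  define C0 where "C0 = 2 * m + 1"
  have m: "m \<ge> 0" "m' \<ge> 0" unfolding m_def m'_def using nn by auto
  have c: "c k > 0" for k unfolding c_def by simp
  define Z where "Z k x = Y x * indicator {x. Y x \<le> c k} x / c k" for k x
  have [measurable]: "Z k \<in> borel_measurable borel" for k unfolding Z_def by measurable
  have Z: "0 \<le> Z k x" "Z k x \<le> 1" "Z k x \<le> Y x / c k" for k x
    using nn[of x] c[of k] by (auto simp: Z_def indicator_def field_simps)
  define A1 where "A1 k = (\<Union>j<2^k. {\<omega>\<in>space M. X j \<omega> \<in> {x. Y x > c k}})" for k :: nat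
  define A2 where "A2 k = {\<omega>\<in>space M. (real k + 1) * C0 \<le> (\<Sum>j<2^k. Z k (X j \<omega>))}" for k :: nat
  have [measurable]: "A1 k \<in> sets M" "A2 k \<in> sets M" for k unfolding A1_def A2_def by measurable
  have 1: "measure M (A1 k) \<le> 2 ^ k * (m' / c k powr (1 + \<gamma>))" for k
  proof -
    have "measure N {x. Y x > c k} \<le> measure N {x\<in>space N. Y x powr (1 + \<gamma>) \<ge> c k powr (1 + \<gamma>)}"
      using c[of k] \<gamma> by (intro N.finite_measure_mono) (auto intro!: powr_mono2)
    also have "\<dots> \<le> m' / c k powr (1 + \<gamma>)"
      unfolding m'_def using c[of k] int'
      by (intro integral_Markov_inequality_measure[where A="{}"]) auto
    finally have *: "measure N {x. Y x > c k} \<le> m' / c k powr (1 + \<gamma>)" .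
    have "measure M (A1 k) \<le> (\<Sum>j<2^k. measure M {\<omega>\<in>space M. X j \<omega> \<in> {x. Y x > c k}})"
      unfolding A1_def by (intro finite_measure_subadditive_finite) auto
    also have "\<dots> = (\<Sum>j<(2::nat)^k. measure N {x. Y x > c k})"
      by (intro sum.cong refl) (simp add: measure_def emeasure_X del: mem_Collect_eq)
    also have "\<dots> \<le> (\<Sum>j<(2::nat)^k. m' / c k powr (1 + \<gamma>))" by (intro sum_mono *)
    finally show ?thesis by simp
  qed
  have 2: "measure M (A2 k) \<le> exp (- (real k + 1))" for k
  proof -
    have "(\<integral>\<^sup>+x. ennreal (exp (Z k x)) \<partial>N) \<le> (\<integral>\<^sup>+x. ennreal (1 + 2 * Y x / c k) \<partial>N)"
    proof (intro nn_integral_mono ennreal_leI)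
      fix x
      have "exp (Z k x) \<le> 1 + Z k x + (Z k x)\<^sup>2" using Z by (intro exp_bound) auto
      also have "(Z k x)\<^sup>2 \<le> Z k x"
        using Z[of k x] by (simp add: power2_eq_square mult_left_le)
      finally show "exp (Z k x) \<le> 1 + 2 * Y x / c k" using Z(3)[of k x] by simp
    qed
    also have "\<dots> = ennreal (\<integral>x. 1 + 2 * Y x / c k \<partial>N)"
      using int nn c[of k] by (intro nn_integral_eq_integral) (auto intro!: add_nonneg_nonneg divide_nonneg_pos)
    also have "(\<integral>x. 1 + 2 * Y x / c k \<partial>N) = 1 + 2 * m / c k"
      unfolding m_def using int by (subst Bochner_Integration.integral_add) (auto simp: N.prob_space)
    also have "ennreal (1 + 2 * m / c k) \<le> ennreal (exp (2 * m / c k))"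
      by (intro ennreal_leI exp_ge_add_one_self)
    finally have *: "(\<integral>\<^sup>+x. ennreal (exp (Z k x)) \<partial>N) \<le> ennreal (exp (2 * m / c k))" .
    have "emeasure M (A2 k) \<le> ennreal (exp (- ((real k + 1) * C0))) * (\<integral>\<^sup>+x. ennreal (exp (Z k x)) \<partial>N) ^ (2^k)"
      unfolding A2_def by (rule chernoff_bound) measurable
    also have "\<dots> \<le> ennreal (exp (- ((real k + 1) * C0))) * ennreal (exp (2 * m / c k)) ^ (2^k)"
      by (intro mult_left_mono power_mono *) auto
    also have "\<dots> = ennreal (exp (- ((real k + 1) * C0) + 2^k * (2 * m / c k)))"
      by (simp add: ennreal_power ennreal_mult'[symmetric] exp_of_nat_mult[symmetric] mult_exp_exp)
    also have "- ((real k + 1) * C0) + 2^k * (2 * m / c k) = - (real k + 1)"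
      unfolding c_def C0_def by (simp add: field_simps)
    finally show ?thesis
      by (simp add: emeasure_eq_measure)
  qed
  have s1: "summable (\<lambda>k. 2 ^ k * (m' / c k powr (1 + \<gamma>)))"
  proof -
    have "(\<lambda>k. 2 ^ k * (m' / c k powr (1 + \<gamma>))) \<in> O(\<lambda>k. 1 / real k ^ 2)"
      unfolding c_def using \<gamma> m by real_asymp
    then show ?thesis by (rule summable_bigo_inverse_square)
  qed
  have s2: "summable (\<lambda>k. exp (- (real k + 1)))"
  proof -
    have "(\<lambda>k. exp (- (real k + 1))) = (\<lambda>k. exp (-1) * exp (-1) ^ k)"
      by (auto simp: exp_of_nat_mult[symmetric] exp_add[symmetric] algebra_simps)
    then show ?thesis by (auto intro!: summable_mult summable_geometric)
  qed
  have "summable (\<lambda>k. measure M (A1 k \<union> A2 k))"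
  proof (rule summable_comparison_test'[OF summable_add[OF s1 s2], of 0])
    fix k
    have "measure M (A1 k \<union> A2 k) \<le> measure M (A1 k) + measure M (A2 k)"
      by (intro measure_subadditive) auto
    then show "norm (measure M (A1 k \<union> A2 k)) \<le> 2 ^ k * (m' / c k powr (1 + \<gamma>)) + exp (- (real k + 1))"
      using 1[of k] 2[of k] by simp
  qed
  then have "AE \<omega> in M. \<forall>\<^sub>F k in sequentially. \<omega> \<in> space M - (A1 k \<union> A2 k)"
    by (intro borel_cantelli_AE1) (auto simp: emeasure_eq_measure)
  then show ?thesis
  proof eventually_elim
    case (elim \<omega>)
    then obtain k0 where k0: "\<And>k. k \<ge> k0 \<Longrightarrow> \<omega> \<in> space M - (A1 k \<union> A2 k)"
      unfolding eventually_sequentially by auto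
    define S where "S n = (\<Sum>j<n. Y (X j \<omega>))" for n
    have mono: "S a \<le> S b" if "a \<le> b" for a b
      unfolding S_def using that nn by (intro sum_mono2) auto
    have S: "S (2^k) \<le> 2^k * C0" if "k \<ge> k0" for k
    proof -
      have le: "Y (X j \<omega>) \<le> c k" if "j < 2^k" for j
        using k0[OF \<open>k \<ge> k0\<close>] that unfolding A1_def by (auto simp: not_less)
      have "S (2^k) = (\<Sum>j<2^k. c k * Z k (X j \<omega>))"
        unfolding S_def Z_def using le c[of k] by (intro sum.cong) auto
      also have "\<dots> = c k * (\<Sum>j<2^k. Z k (X j \<omega>))" by (simp add: sum_distrib_left)
      also have "(\<Sum>j<2^k. Z k (X j \<omega>)) \<le> (real k + 1) * C0"
        using k0[OF \<open>k \<ge> k0\<close>] unfolding A2_def by auto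
      finally have "S (2^k) \<le> c k * ((real k + 1) * C0)" using c[of k] by simp
      also have "\<dots> = 2^k * C0" unfolding c_def by simp
      finally show ?thesis .
    qed
    \<comment> \<open>The factor 2 pays for rounding \<open>n\<close> up to a power of two; the
      other term covers the \<open>n\<close> below \<open>2 ^ k0\<close>.\<close>
    define C where "C = max (2 * C0) (S (2^k0))"
    have "S n \<le> C * real n" for n
    proof (cases "n \<ge> 2^k0")
      case True
      then have "n > 0" using zero_less_power[of "2::nat" k0] by linarith
      then obtain k where k: "2 ^ k \<le> n" "n < 2 ^ (k + 1)"
        using ex_power_ivl1[of 2 n] by auto
      have "k + 1 \<ge> k0"
      proof -
        have "(2::nat) ^ k0 < 2 ^ (k+1)" using True k(2) by linarith
        then have "k0 < k + 1" by (subst (asm) power_strict_increasing_iff) auto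
        then show ?thesis by simp
      qed
      have "S n \<le> S (2^(k+1))" using k by (intro mono) auto
      also have "\<dots> \<le> 2^(k+1) * C0" by (rule S) fact
      also have "\<dots> = 2 * C0 * real (2^k)" by simp
      also have "\<dots> \<le> 2 * C0 * real n" using k(1) m unfolding C0_def by (intro mult_left_mono) (auto simp del: of_nat_power)
      also have "\<dots> \<le> C * real n" unfolding C_def by (intro mult_right_mono) auto
      finally show ?thesis .
    next
      case False
      show ?thesis
      proof (cases "n = 0")
        case False
        have "S n \<le> S (2^k0)" using \<open>\<not> n \<ge> 2^k0\<close> by (intro mono) auto
        also have "\<dots> \<le> C * 1" unfolding C_def by simp
        also have "\<dots> \<le> C * real n" using False m unfolding C_def C0_def by (intro mult_left_mono) auto
        finally show ?thesis .
      qed (simp add: S_def)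
    qed
    then show ?case unfolding S_def by auto
  qed
qed

text \<open>Hoeffding's inequality makes the deviation probabilities geometric in \<open>n\<close>;
  Borel-Cantelli is then applied to each tolerance \<open>1 / (k + 1)\<close>.\<close>

lemma AE_slln_bounded:
  fixes g :: "'b \<Rightarrow> real"
  assumes [measurable]: "g \<in> borel_measurable borel" and bd: "\<And>x. \<bar>g x\<bar> \<le> K"
  shows "AE \<omega> in M. (\<lambda>n. (\<Sum>j<n. g (X j \<omega>)) / real n) \<longlonglongrightarrow> (\<integral>x. g x \<partial>N)"
proof -
  define \<mu> where "\<mu> = (\<integral>x. g x \<partial>N)"
  \<comment> \<open>The added 1 keeps the interval from \<open>- L\<close> to \<open>L\<close>
    nondegenerate even for \<open>K = 0\<close>.\<close>
  define L where "L = \<bar>K\<bar> + 1"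
  have bd': "- L \<le> g x" "g x \<le> L" for x using bd[of x] unfolding L_def by auto
  have \<mu>: "expectation (\<lambda>\<omega>. g (X 0 \<omega>)) = \<mu>"
    unfolding \<mu>_def by (subst distr_X[of 0, symmetric], subst integral_distr) auto
  have dg: "distr M borel (\<lambda>\<omega>. g (X i \<omega>)) = distr N borel g" for i
    by (subst distr_X[of i, symmetric], subst distr_distr) (auto simp: comp_def)
  have *: "AE \<omega> in M. \<forall>\<^sub>F n in sequentially. \<bar>(\<Sum>j<n. g (X j \<omega>)) / real n - \<mu>\<bar> < \<epsilon>" if \<epsilon>: "\<epsilon> > 0" for \<epsilon>
  proof -
    define A where "A n = {\<omega>\<in>space M. \<bar>(\<Sum>j<n. g (X j \<omega>)) / real n - \<mu>\<bar> \<ge> \<epsilon>}" for n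
    have [measurable]: "A n \<in> sets M" for n unfolding A_def by measurable
    define b where "b = 2 * \<epsilon>\<^sup>2 / (2 * L)\<^sup>2"
    have b: "b > 0" using \<epsilon> unfolding b_def L_def by (intro divide_pos_pos) auto
    have "measure M (A n) \<le> 2 * exp (- b) ^ n" if "n \<ge> 1" for n
    proof -
      interpret H: Hoeffding_ineq_iid M "{..<n}" "\<lambda>j \<omega>. g (X j \<omega>)" "\<lambda>\<omega>. g (X 0 \<omega>)" "- L" L \<mu>
        by unfold_locales (auto simp: dg \<mu> bd' intro!: indep_vars_compose2[OF indep_vars_subset[OF indep]])
      have "measure M (A n) \<le> 2 * exp (- 2 * real (card {..<n}) * \<epsilon>\<^sup>2 / (L - - L)\<^sup>2)"
        using H.Hoeffding_ineq_abs_ge'[of \<epsilon>] that \<epsilon> unfolding A_def L_def by (auto simp: lessThan_empty_iff)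
      also have "- 2 * real (card {..<n}) * \<epsilon>\<^sup>2 / (L - - L)\<^sup>2 = real n * (- b)"
        unfolding b_def by (simp add: field_simps)
      finally show ?thesis by (simp add: exp_of_nat_mult[symmetric])
    qed
    moreover have "summable (\<lambda>n. 2 * exp (- b) ^ n)"
      using b by (intro summable_mult summable_geometric) auto
    ultimately have "summable (\<lambda>n. measure M (A n))"
      by (metis summable_comparison_test' measure_nonneg real_norm_def abs_of_nonneg)
    then have "AE \<omega> in M. \<forall>\<^sub>F n in sequentially. \<omega> \<in> space M - A n"
      by (intro borel_cantelli_AE1) (auto simp: emeasure_eq_measure)
    then show ?thesis
      by eventually_elim (auto elim!: eventually_mono simp: A_def)
  qed
  have "AE \<omega> in M. \<forall>k::nat. \<forall>\<^sub>F n in sequentially. \<bar>(\<Sum>j<n. g (X j \<omega>)) / real n - \<mu>\<bar> < inverse (real (Suc k))"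
    using * by (subst AE_all_countable) auto
  then show ?thesis
  proof eventually_elim
    case (elim \<omega>)
    show ?case unfolding \<mu>_def[symmetric]
    proof (rule tendstoI)
      fix e :: real assume "e > 0"
      then obtain k where "inverse (real (Suc k)) < e" using reals_Archimedean by blast
      with elim show "\<forall>\<^sub>F n in sequentially. dist ((\<Sum>j<n. g (X j \<omega>)) / real n) \<mu> < e"
        by (auto simp: dist_real_def elim!: eventually_mono[OF spec[of _ k]])
    qed
  qed
qed

text \<open>\<open>g\<close> is cut off where \<open>G\<close> exceeds a level \<open>R\<close>.
  Beyond that level \<open>g\<close> is at most \<open>e * G\<close>, and the linear bound for the
  sums of \<open>G\<close> keeps the discarded part of order \<open>e * n\<close>, so the bounded
  case suffices.\<close>

lemma AE_slln_dominated:
  fixes g G :: "'b \<Rightarrow> real"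
  assumes [measurable]: "g \<in> borel_measurable borel" "G \<in> borel_measurable borel"
    and intG: "integrable N G"
    and bd: "\<And>R. R > 0 \<Longrightarrow> \<exists>K. \<forall>x. G x \<le> R \<longrightarrow> \<bar>g x\<bar> \<le> K"
    and small: "\<And>e. e > 0 \<Longrightarrow> \<exists>R>0. \<forall>x. G x > R \<longrightarrow> \<bar>g x\<bar> \<le> e * G x"
    and nn: "\<And>x. G x \<ge> 0"
    and G: "AE \<omega> in M. \<exists>C. \<forall>n. (\<Sum>j<n. G (X j \<omega>)) \<le> C * real n"
  shows "AE \<omega> in M. (\<lambda>n. (\<Sum>j<n. g (X j \<omega>)) / real n) \<longlonglongrightarrow> (\<integral>x. g x \<partial>N)"
proof -
  interpret N: prob_space N by (rule prob_space_N)
  have [simp]: "measure N UNIV = 1" using N.prob_space by simp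
  define h where "h R x = (if G x \<le> R then g x else 0)" for R x
  have [measurable]: "h R \<in> borel_measurable borel" for R unfolding h_def by measurable
  have intg: "integrable N g"
  proof -
    obtain R where R: "R > 0" "\<And>x. G x > R \<Longrightarrow> \<bar>g x\<bar> \<le> 1 * G x" using small[of 1] by auto
    obtain K where K: "\<And>x. G x \<le> R \<Longrightarrow> \<bar>g x\<bar> \<le> K" using bd[OF R(1)] by auto
    have "\<bar>g x\<bar> \<le> \<bar>K\<bar> + G x" for x
      using R(2)[of x] K[of x] nn[of x] by (cases "G x \<le> R") auto
    then show ?thesis
      using intG nn
      by (intro Bochner_Integration.integrable_bound[OF _ _ AE_I2, of N "\<lambda>x. \<bar>K\<bar> + G x" g])
        (simp_all add: add_nonneg_nonneg)
  qed
  \<comment> \<open>Cutoffs are taken at natural numbers, so that a single null set serves all of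
    them.\<close>
  have "AE \<omega> in M. (\<lambda>n. (\<Sum>j<n. h (real R) (X j \<omega>)) / real n) \<longlonglongrightarrow> (\<integral>x. h (real R) x \<partial>N)" for R :: nat
  proof -
    obtain K where K: "\<And>x. G x \<le> real R + 1 \<Longrightarrow> \<bar>g x\<bar> \<le> K" using bd[of "real R + 1"] by auto
    have "\<bar>h (real R) x\<bar> \<le> \<bar>K\<bar>" for x using K[of x] unfolding h_def by auto
    then show ?thesis by (intro AE_slln_bounded[of _ "\<bar>K\<bar>"]) auto
  qed
  then have "AE \<omega> in M. \<forall>R::nat. (\<lambda>n. (\<Sum>j<n. h (real R) (X j \<omega>)) / real n) \<longlonglongrightarrow> (\<integral>x. h (real R) x \<partial>N)"
    by (subst AE_all_countable) auto
  with G show ?thesis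
  proof eventually_elim
    case (elim \<omega>)
    then obtain C where C: "\<And>n. (\<Sum>j<n. G (X j \<omega>)) \<le> C * real n" by auto
    \<comment> \<open>\<open>D\<close> dominates both \<open>C\<close> and the integral of
      \<open>G\<close>, so one \<open>e'\<close> bounds the cutoff error by \<open>e / 3\<close> in
      the sample mean and in the expectation.\<close>
    define D where "D = \<bar>C\<bar> + (\<integral>x. G x \<partial>N) + 1"
    have intG0: "(\<integral>x. G x \<partial>N) \<ge> 0" using nn by auto
    have D: "D > 0" unfolding D_def using intG0 by linarith
    show ?case
    proof (rule tendstoI)
      fix e :: real assume e: "e > 0"
      define e' where "e' = e / (3 * D)"
      have e': "e' > 0" unfolding e'_def using e D by simp
      obtain R0 where R0: "R0 > 0" "\<And>x. G x > R0 \<Longrightarrow> \<bar>g x\<bar> \<le> e' * G x" using small[OF e'] by auto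
      obtain R :: nat where R: "real R \<ge> R0" using real_arch_simple by blast
      have dif: "\<bar>g x - h (real R) x\<bar> \<le> e' * G x" for x
        using R0(2)[of x] R nn[of x] e' unfolding h_def by (auto simp: not_le)
      have i2: "\<bar>(\<integral>x. g x \<partial>N) - (\<integral>x. h (real R) x \<partial>N)\<bar> \<le> e / 3"
      proof -
        have inth: "integrable N (h (real R))"
          using intg by (rule Bochner_Integration.integrable_bound) (auto simp: h_def)
        have "\<bar>(\<integral>x. g x \<partial>N) - (\<integral>x. h (real R) x \<partial>N)\<bar> = \<bar>\<integral>x. g x - h (real R) x \<partial>N\<bar>"
          using intg inth by (subst Bochner_Integration.integral_diff) auto
        also have "\<dots> \<le> (\<integral>x. \<bar>g x - h (real R) x\<bar> \<partial>N)" by (rule integral_abs_bound)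
        also have "\<dots> \<le> (\<integral>x. e' * G x \<partial>N)"
          using intg inth intG dif by (intro integral_mono) auto
        also have "\<dots> = e' * (\<integral>x. G x \<partial>N)" by simp
        also have "\<dots> \<le> e' * D" using e' unfolding D_def by (intro mult_left_mono) auto
        also have "\<dots> = e / 3" unfolding e'_def using D by simp
        finally show ?thesis .
      qed
      have "(\<lambda>n. (\<Sum>j<n. h (real R) (X j \<omega>)) / real n) \<longlonglongrightarrow> (\<integral>x. h (real R) x \<partial>N)" using elim by auto
      from tendstoD[OF this, of "e/3"] e
      have "\<forall>\<^sub>F n in sequentially. dist ((\<Sum>j<n. h (real R) (X j \<omega>)) / real n) (\<integral>x. h (real R) x \<partial>N) < e / 3"
        by simp
      then show "\<forall>\<^sub>F n in sequentially. dist ((\<Sum>j<n. g (X j \<omega>)) / real n) (\<integral>x. g x \<partial>N) < e"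
        using eventually_gt_at_top[of 0]
      proof eventually_elim
        case (elim n)
        have "\<bar>(\<Sum>j<n. g (X j \<omega>)) - (\<Sum>j<n. h (real R) (X j \<omega>))\<bar> \<le> (\<Sum>j<n. e' * G (X j \<omega>))"
          unfolding sum_subtractf[symmetric] by (rule order_trans[OF sum_abs]) (intro sum_mono dif)
        also have "\<dots> \<le> e' * (C * real n)" unfolding sum_distrib_left[symmetric] using C e' by (intro mult_left_mono) auto
        also have "\<dots> \<le> e' * (D * real n)" using e' intG0 unfolding D_def by (intro mult_left_mono mult_right_mono) auto
        also have "\<dots> = e / 3 * real n" unfolding e'_def using D by simp
        finally have "\<bar>(\<Sum>j<n. g (X j \<omega>)) / real n - (\<Sum>j<n. h (real R) (X j \<omega>)) / real n\<bar> \<le> e / 3"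
          using elim by (simp add: diff_divide_distrib[symmetric] abs_divide divide_le_eq)
        moreover have "\<bar>(\<Sum>j<n. h (real R) (X j \<omega>)) / real n - (\<integral>x. h (real R) x \<partial>N)\<bar> < e / 3"
          using elim by (simp add: dist_real_def)
        ultimately show ?case using i2 unfolding dist_real_def by linarith
      qed
    qed
  qed
qed

text \<open>Chernoff bound for the lower tail, with \<open>h\<close> the negated indicator. An
  expected count of at least \<open>n powr \<epsilon>\<close> makes each failure probability smaller
  than any power of \<open>n\<close>, so the union over \<open>n + 1\<close> sets stays summable. In
  \<open>AE_dense_fixed\<close> these sets are balls.\<close>

lemma AE_card_lower_bound:
  assumes A [measurable]: "\<And>k. A k \<in> sets borel" and \<epsilon>: "\<epsilon> > 0"
  shows "AE \<omega> in M. \<forall>\<^sub>F n in sequentially. \<forall>k\<le>n. real n * measure N (A k) \<ge> real n powr \<epsilon> \<longrightarrow>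
           real n * measure N (A k) / 2 < real (card {j. j < n \<and> X j \<omega> \<in> A k})"
proof -
  interpret N: prob_space N by (rule prob_space_N)
  have [simp]: "measure N UNIV = 1" using N.prob_space by simp
  define p where "p k = measure N (A k)" for k
  have p: "0 \<le> p k" "p k \<le> 1" for k unfolding p_def by auto
  define cnt where "cnt n k \<omega> = (\<Sum>j<n. indicator (A k) (X j \<omega>) :: real)" for n k \<omega>
  have [measurable]: "cnt n k \<in> borel_measurable M" for n k unfolding cnt_def by measurable
  define E where "E n k = {\<omega>\<in>space M. real n * p k \<ge> real n powr \<epsilon> \<and> cnt n k \<omega> \<le> real n * p k / 2}" for n k
  have [measurable]: "E n k \<in> sets M" for n k unfolding E_def by measurable
  have E: "measure M (E n k) \<le> exp (- (real n powr \<epsilon> / 10))" for n k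
  proof (cases "real n * p k \<ge> real n powr \<epsilon>")
    case True
    have "(\<integral>\<^sup>+x. ennreal (exp (- indicator (A k) x)) \<partial>N)
        = (\<integral>\<^sup>+x. ennreal (1 - (1 - exp (-1)) * indicator (A k) x) \<partial>N)"
      by (intro nn_integral_cong) (auto simp: indicator_def)
    also have "\<dots> = ennreal (\<integral>x. 1 - (1 - exp (-1)) * indicator (A k) x \<partial>N)"
    proof (intro nn_integral_eq_integral)
      show "integrable N (\<lambda>x. 1 - (1 - exp (-1)) * indicator (A k) x :: real)"
        by (rule N.integrable_const_bound[where B=1])
          (auto simp: indicator_def intro!: AE_I2)
    qed (auto simp: indicator_def)
    also have "(\<integral>x. 1 - (1 - exp (-1)) * indicator (A k) x \<partial>N) = 1 + (- ((1 - exp (-1)) * p k))"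
      unfolding p_def by (subst Bochner_Integration.integral_diff) (auto simp: N.prob_space N.emeasure_eq_measure)
    also have "ennreal (1 + (- ((1 - exp (-1)) * p k))) \<le> ennreal (exp (- ((1 - exp (-1)) * p k)))"
      by (intro ennreal_leI exp_ge_add_one_self)
    \<comment> \<open>The constant 6/10 exceeds the 1/2 of the threshold; the difference 1/10 is the
      rate in \<open>E\<close>.\<close>
    also have "\<dots> \<le> ennreal (exp (- (6/10 * p k)))"
    proof -
      have "exp (-1::real) \<le> 4/10"
      proof -
        have "exp (1::real) \<ge> 1 + 1 + 1\<^sup>2/2" by (rule exp_lower_Taylor_quadratic) auto
        then show ?thesis by (simp add: exp_minus field_simps)
      qed
      then have "6/10 * p k \<le> (1 - exp (-1)) * p k" using p by (intro mult_right_mono) auto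
      then show ?thesis by (intro ennreal_leI) auto
    qed
    finally have *: "(\<integral>\<^sup>+x. ennreal (exp (- indicator (A k) x)) \<partial>N) \<le> ennreal (exp (- (6/10 * p k)))" .
    have "E n k = {\<omega>\<in>space M. - (real n * p k / 2) \<le> (\<Sum>j<n. - indicator (A k) (X j \<omega>))}"
      using True unfolding E_def cnt_def by (auto simp: sum_negf)
    also have "emeasure M \<dots> \<le> ennreal (exp (- (- (real n * p k / 2)))) * (\<integral>\<^sup>+x. ennreal (exp (- indicator (A k) x)) \<partial>N) ^ n"
      by (rule chernoff_bound) measurable
    also have "\<dots> \<le> ennreal (exp (- (- (real n * p k / 2)))) * ennreal (exp (- (6/10 * p k))) ^ n"
      by (intro mult_left_mono power_mono *) auto
    also have "\<dots> = ennreal (exp (real n * p k / 2 + real n * (- (6/10 * p k))))"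
      by (simp add: ennreal_power ennreal_mult'[symmetric] exp_of_nat_mult[symmetric] mult_exp_exp)
    also have "\<dots> \<le> ennreal (exp (- (real n powr \<epsilon> / 10)))"
      using True by (intro ennreal_leI) auto
    finally show ?thesis by (simp add: emeasure_eq_measure)
  qed (simp add: E_def)
  define F where "F n = (\<Union>k\<le>n. E n k)" for n
  have [measurable]: "F n \<in> sets M" for n unfolding F_def by measurable
  have F: "measure M (F n) \<le> (real n + 1) * exp (- (real n powr \<epsilon> / 10))" for n
  proof -
    have "measure M (F n) \<le> (\<Sum>k\<le>n. measure M (E n k))"
      unfolding F_def by (intro finite_measure_subadditive_finite) auto
    also have "\<dots> \<le> (\<Sum>k\<le>n. exp (- (real n powr \<epsilon> / 10)))" by (intro sum_mono E)
    finally show ?thesis by (simp add: add.commute)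
  qed
  have "(\<lambda>n. (real n + 1) * exp (- (real n powr \<epsilon> / 10))) \<in> O(\<lambda>k. 1 / real k ^ 2)"
    using \<epsilon> by real_asymp
  then have "summable (\<lambda>n. (real n + 1) * exp (- (real n powr \<epsilon> / 10)))"
    by (rule summable_bigo_inverse_square)
  then have "summable (\<lambda>n. measure M (F n))"
    by (rule summable_comparison_test'[of _ 0]) (metis F measure_nonneg real_norm_def abs_of_nonneg)
  then have "AE \<omega> in M. \<forall>\<^sub>F n in sequentially. \<omega> \<in> space M - F n"
    by (intro borel_cantelli_AE1) (auto simp: emeasure_eq_measure)
  then show ?thesis
  proof eventually_elim
    case (elim \<omega>)
    then show ?case
    proof eventually_elim
      case (elim n)
      have "cnt n k \<omega> = real (card {j. j < n \<and> X j \<omega> \<in> A k})" for k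
      proof -
        have "cnt n k \<omega> = (\<Sum>j<n. if X j \<omega> \<in> A k then 1 else 0)"
          unfolding cnt_def by (intro sum.cong) (auto simp: indicator_def)
        also have "\<dots> = real (card ({..<n} \<inter> {j. X j \<omega> \<in> A k}))"
          by (simp add: sum.If_cases)
        also have "{..<n} \<inter> {j. X j \<omega> \<in> A k} = {j. j < n \<and> X j \<omega> \<in> A k}" by auto
        finally show ?thesis .
      qed
      with elim show ?case unfolding F_def E_def p_def
        by (auto simp: not_le) (metis atMost_iff not_less)
    qed
  qed
qed

end

section \<open>Convergence for a fixed number of points\<close>

lemma gauss_kernel_pos [simp]: "gauss_kernel \<tau> u > 0"
  by (simp add: gauss_kernel_def)

lemma gauss_kernel_nonneg [simp]: "gauss_kernel \<tau> u \<ge> 0"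
  by (simp add: gauss_kernel_def)

lemma gauss_kernel_le_1: "gauss_kernel \<tau> u \<le> 1"
  by (simp add: gauss_kernel_def divide_nonpos_nonneg)

lemma gauss_kernel_norm: "gauss_kernel \<tau> u = exp (- (norm u)\<^sup>2 / (2 * \<tau>\<^sup>2))"
  by (simp add: gauss_kernel_def power2_norm_eq_inner)

lemma gauss_kernel_ge:
  assumes "norm u \<le> r"
  shows "exp (- r\<^sup>2 / (2 * \<tau>\<^sup>2)) \<le> gauss_kernel \<tau> u"
  using assms by (auto simp: gauss_kernel_norm intro!: divide_right_mono power_mono)

text \<open>The averaged sequence \<open>g\<close> is separated from the points \<open>y\<close>
  that fix the weights, because errors, norms and initial positions will all be averaged with the
  current weights.\<close>

definition kmean :: "real \<Rightarrow> nat \<Rightarrow> (nat \<Rightarrow> real^'p) \<Rightarrow> nat \<Rightarrow> (nat \<Rightarrow> 'v::real_vector) \<Rightarrow> 'v" where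
  "kmean \<tau> n y i g = (1 / (\<Sum>j<n. gauss_kernel \<tau> (y i - y j))) *\<^sub>R (\<Sum>j<n. gauss_kernel \<tau> (y i - y j) *\<^sub>R g j)"

lemma bms_Suc_kmean: "bms \<tau> n x (Suc t) i = kmean \<tau> n (bms \<tau> n x t) i (bms \<tau> n x t)"
  by (simp add: Let_def kmean_def)

lemma kernel_sum_pos: "n > 0 \<Longrightarrow> (\<Sum>j<n. gauss_kernel \<tau> (y i - y j)) > 0" for n :: nat
  by (rule sum_pos) (auto simp: lessThan_empty_iff)

lemma kmean_const: "n > 0 \<Longrightarrow> kmean \<tau> n y i (\<lambda>_. c) = c"
  using kernel_sum_pos[of n \<tau> y i] by (simp add: kmean_def scaleR_sum_left[symmetric])

lemma kmean_add: "kmean \<tau> n y i (\<lambda>j. g j + h j) = kmean \<tau> n y i g + kmean \<tau> n y i h"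
  by (simp add: kmean_def scaleR_add_right sum.distrib)

lemma kmean_diff: "kmean \<tau> n y i (\<lambda>j. g j - h j) = kmean \<tau> n y i g - kmean \<tau> n y i h"
  by (simp add: kmean_def scaleR_diff_right sum_subtractf)

lemma kmean_linear: "linear F \<Longrightarrow> F (kmean \<tau> n y i g) = kmean \<tau> n y i (\<lambda>j. F (g j))"
  by (simp add: kmean_def linear_cmul linear_sum)

lemma kmean_cmult: "kmean \<tau> n y i (\<lambda>j. c * g j) = c * kmean \<tau> n y i g" for c :: real
  by (simp add: kmean_def sum_distrib_left algebra_simps)

lemma kmean_mono:
  fixes g h :: "nat \<Rightarrow> real"
  assumes "\<And>j. j < n \<Longrightarrow> g j \<le> h j"
  shows "kmean \<tau> n y i g \<le> kmean \<tau> n y i h"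
  unfolding kmean_def real_scaleR_def using assms
  by (intro mult_left_mono sum_mono divide_nonneg_nonneg sum_nonneg) auto

lemma norm_kmean_le: "norm (kmean \<tau> n y i g) \<le> kmean \<tau> n y i (\<lambda>j. norm (g j))"
proof -
  have "norm (kmean \<tau> n y i g)
      = (1 / (\<Sum>j<n. gauss_kernel \<tau> (y i - y j))) * norm (\<Sum>j<n. gauss_kernel \<tau> (y i - y j) *\<^sub>R g j)"
    unfolding kmean_def by (simp add: sum_nonneg)
  also have "\<dots> \<le> kmean \<tau> n y i (\<lambda>j. norm (g j))"
    unfolding kmean_def real_scaleR_def
    by (intro mult_left_mono order_trans[OF norm_sum]) (auto intro!: sum_mono sum_nonneg divide_nonneg_nonneg)
  finally show ?thesis .
qed

lemma kmean_le_iff: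
  fixes g :: "nat \<Rightarrow> real"
  assumes "n > 0"
  shows "kmean \<tau> n y i g \<le> c \<longleftrightarrow>
    (\<Sum>j<n. gauss_kernel \<tau> (y i - y j) * g j) \<le> c * (\<Sum>j<n. gauss_kernel \<tau> (y i - y j))"
  using kernel_sum_pos[OF assms, of \<tau> y i] by (simp add: kmean_def divide_le_eq)

text \<open>Averages stay in the ball. Uniformity in \<open>t\<close> is what bounds the kernel
  weights from below in \<open>bms_convergent\<close>.\<close>

lemma bms_norm_bound:
  assumes "n > 0" and "\<And>i. i < n \<Longrightarrow> norm (x i) \<le> R"
  shows "i < n \<Longrightarrow> norm (bms \<tau> n x t i) \<le> R"
proof (induction t arbitrary: i)
  case (Suc t)
  have "norm (bms \<tau> n x (Suc t) i) \<le> kmean \<tau> n (bms \<tau> n x t) i (\<lambda>j. norm (bms \<tau> n x t j))"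
    unfolding bms_Suc_kmean by (rule norm_kmean_le)
  also have "\<dots> \<le> kmean \<tau> n (bms \<tau> n x t) i (\<lambda>j. R)"
    using Suc.IH by (intro kmean_mono)
  finally show ?case using assms(1) by (simp add: kmean_const)
qed (use assms in simp)

text \<open>Every new value puts weight at least \<open>\<kappa>\<close> on a point where the old
  minimum is attained, so the maximum drops by at least \<open>\<kappa>\<close> times the range. The
  maximum converges, hence its decrements tend to 0, and with them the range.\<close>

lemma averaging_consensus:
  fixes u :: "nat \<Rightarrow> nat \<Rightarrow> real" and p :: "nat \<Rightarrow> nat \<Rightarrow> nat \<Rightarrow> real"
  assumes n: "n > 0" and \<kappa>: "\<kappa> > 0"
    and step: "\<And>t i. i < n \<Longrightarrow> u (Suc t) i = (\<Sum>j<n. p t i j * u t j)"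
    and stoch: "\<And>t i. i < n \<Longrightarrow> (\<Sum>j<n. p t i j) = 1"
    and lower: "\<And>t i j. i < n \<Longrightarrow> j < n \<Longrightarrow> p t i j \<ge> \<kappa>"
  shows "\<exists>c. \<forall>i<n. (\<lambda>t. u t i) \<longlonglongrightarrow> c"
proof -
  define a where "a t = Min (u t ` {..<n})" for t
  define b where "b t = Max (u t ` {..<n})" for t
  have ab: "a t \<le> u t i" "u t i \<le> b t" if "i < n" for t i
    using that unfolding a_def b_def by auto
  have ne: "u t ` {..<n} \<noteq> {}" for t using n by auto
  have p0: "p t i j \<ge> 0" if "i < n" "j < n" for t i j using lower[OF that, of t] \<kappa> by linarith
  have up: "u (Suc t) i \<le> b t - \<kappa> * (b t - a t)" if i: "i < n" for t i
  proof -
    have "a t \<in> u t ` {..<n}" unfolding a_def using ne by (intro Min_in) auto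
    then obtain k where k: "k < n" "u t k = a t" by auto
    have "b t - u (Suc t) i = (\<Sum>j<n. p t i j * (b t - u t j))"
      using stoch[OF i, of t] by (simp add: step[OF i] algebra_simps sum_subtractf sum_distrib_left[symmetric])
    also have "\<dots> \<ge> p t i k * (b t - u t k)"
      using k p0 ab i by (intro member_le_sum) auto
    also have "p t i k * (b t - u t k) \<ge> \<kappa> * (b t - a t)"
      using k lower[OF i k(1), of t] ab[OF k(1), of t] by (intro mult_mono) (auto simp: p0 i)
    finally show ?thesis by linarith
  qed
  have lo: "u (Suc t) i \<ge> a t" if i: "i < n" for t i
  proof -
    have "(\<Sum>j<n. p t i j * a t) \<le> u (Suc t) i"
      unfolding step[OF i] using p0 ab i by (intro sum_mono mult_left_mono) auto
    then show ?thesis using stoch[OF i, of t] by (simp add: sum_distrib_right[symmetric])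
  qed
  have a_le_b: "a t \<le> b t" for t using ab[of 0 t] n by auto
  have b_step: "b (Suc t) \<le> b t - \<kappa> * (b t - a t)" for t
    using up ne n unfolding b_def[of "Suc t"] by (subst Max_le_iff) auto
  have a_step: "a (Suc t) \<ge> a t" for t
    using lo ne n unfolding a_def[of "Suc t"] by (subst Min_ge_iff) auto
  have b_dec: "b (Suc t) \<le> b t" for t
    using b_step[of t] mult_nonneg_nonneg[of \<kappa> "b t - a t"] \<kappa> a_le_b[of t] by linarith
  have "incseq a" "decseq b" using a_step b_dec by (auto intro: incseq_SucI decseq_SucI)
  have "a 0 \<le> b t" for t using \<open>incseq a\<close> a_le_b[of t] by (meson incseqD le0 order_trans)
  then obtain l where l: "b \<longlonglongrightarrow> l" using decseq_convergent[OF \<open>decseq b\<close>] by metis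
  have "(\<lambda>t. (b t - b (Suc t)) / \<kappa>) \<longlonglongrightarrow> (l - l) / \<kappa>"
    using l \<kappa> by (intro tendsto_intros LIMSEQ_Suc) auto
  then have "(\<lambda>t. (b t - b (Suc t)) / \<kappa>) \<longlonglongrightarrow> 0" by simp
  moreover have "b t - a t \<le> (b t - b (Suc t)) / \<kappa>" for t
    using b_step[of t] \<kappa> by (simp add: field_simps)
  ultimately have "(\<lambda>t. b t - a t) \<longlonglongrightarrow> 0"
    using a_le_b by (intro tendsto_sandwich[of "\<lambda>_. 0" "\<lambda>t. b t - a t" _ "\<lambda>t. (b t - b (Suc t)) / \<kappa>"])
      (auto intro!: always_eventually)
  from tendsto_diff[OF l this] have "a \<longlonglongrightarrow> l" by simp
  then have "(\<lambda>t. u t i) \<longlonglongrightarrow> l" if "i < n" for i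
    using l ab[OF that] by (intro tendsto_sandwich[of a "\<lambda>t. u t i" _ b]) (auto intro!: always_eventually)
  then show ?thesis by blast
qed

text \<open>The same weights act on every coordinate, so the scalar consensus result applies to each
  coordinate. All distances stay below \<open>2 * R\<close>, which gives the lower bound
  \<open>\<kappa>\<close> for the normalised weights.\<close>

lemma bms_convergent:
  fixes x :: "nat \<Rightarrow> real^'p"
  assumes n: "n > 0"
  shows "\<exists>c. \<forall>i<n. (\<lambda>t. bms \<tau> n x t i) \<longlonglongrightarrow> c"
proof -
  define R where "R = (\<Sum>i<n. norm (x i))"
  have R: "norm (bms \<tau> n x t i) \<le> R" if "i < n" for t i
    using that n unfolding R_def by (intro bms_norm_bound) (auto intro!: member_le_sum)
  define w where "w t i j = gauss_kernel \<tau> (bms \<tau> n x t i - bms \<tau> n x t j)" for t i j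
  define p where "p t i j = w t i j / (\<Sum>j<n. w t i j)" for t i j
  define \<kappa> where "\<kappa> = exp (- (2 * R)\<^sup>2 / (2 * \<tau>\<^sup>2)) / real n"
  have pos: "(\<Sum>j<n. w t i j) > 0" for t i unfolding w_def by (rule kernel_sum_pos[OF n])
  have "\<exists>c. \<forall>i<n. (\<lambda>t. bms \<tau> n x t i $ k) \<longlonglongrightarrow> c" for k
  proof (rule averaging_consensus[OF n, of \<kappa> _ p])
    show "\<kappa> > 0" unfolding \<kappa>_def using n by simp
    show "bms \<tau> n x (Suc t) i $ k = (\<Sum>j<n. p t i j * bms \<tau> n x t j $ k)" for t i
      unfolding p_def w_def by (simp add: Let_def sum_component sum_distrib_left)
    show "(\<Sum>j<n. p t i j) = 1" for t i
      unfolding p_def sum_divide_distrib[symmetric] using pos[of t i] by simp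
    show "p t i j \<ge> \<kappa>" if ij: "i < n" "j < n" for t i j
      unfolding p_def \<kappa>_def
    proof (rule frac_le)
      show "exp (- (2 * R)\<^sup>2 / (2 * \<tau>\<^sup>2)) \<le> w t i j"
        unfolding w_def using R[OF ij(1), of t] R[OF ij(2), of t]
        by (intro gauss_kernel_ge) (metis norm_triangle_le_diff add_mono mult_2)
      have "(\<Sum>j<n. w t i j) \<le> (\<Sum>j<n. 1)" unfolding w_def by (intro sum_mono gauss_kernel_le_1)
      then show "(\<Sum>j<n. w t i j) \<le> real n" by simp
    qed (use pos in \<open>auto simp: w_def\<close>)
  qed
  then obtain c where "\<And>k i. i < n \<Longrightarrow> (\<lambda>t. bms \<tau> n x t i $ k) \<longlonglongrightarrow> c k" by metis
  then have "\<forall>i<n. (\<lambda>t. bms \<tau> n x t i) \<longlonglongrightarrow> (\<chi> k. c k)"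
    by (auto intro!: vec_tendstoI)
  then show ?thesis by blast
qed

section \<open>The population dynamics\<close>

text \<open>The normalisation \<open>K \<ge> 1\<close> lets later estimates replace 1 by
  \<open>K\<close> and \<open>K\<close> by \<open>K\<^sup>2\<close>.\<close>

lemma linear_norm_bound:
  fixes F :: "'b::euclidean_space \<Rightarrow> 'c::real_normed_vector"
  assumes "linear F"
  shows "\<exists>K\<ge>1. \<forall>u. norm (F u) \<le> K * norm u"
proof -
  obtain K where K: "\<And>u. norm (F u) \<le> K * norm u" using linear_bounded[OF assms] by blast
  have "norm (F u) \<le> max 1 K * norm u" for u
    by (rule order_trans[OF K[of u]]) (intro mult_right_mono, auto)
  then show ?thesis by (intro exI[of _ "max 1 K"]) simp
qed

lemma linear_common_norm_bound:
  fixes F :: "'b::euclidean_space \<Rightarrow> 'c::real_normed_vector" and G :: "'d::euclidean_space \<Rightarrow> 'e::real_normed_vector"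
  assumes "linear F" "linear G"
  shows "\<exists>K\<ge>1. (\<forall>u. norm (F u) \<le> K * norm u) \<and> (\<forall>u. norm (G u) \<le> K * norm u)"
proof -
  obtain K K' where K: "K \<ge> 1" "\<And>u. norm (F u) \<le> K * norm u" and K': "K' \<ge> 1" "\<And>u. norm (G u) \<le> K' * norm u"
    using linear_norm_bound[OF assms(1)] linear_norm_bound[OF assms(2)] by blast
  have "norm (F u) \<le> max K K' * norm u" for u
    by (rule order_trans[OF K(2)]) (auto intro!: mult_right_mono)
  moreover have "norm (G u) \<le> max K K' * norm u" for u
    by (rule order_trans[OF K'(2)]) (auto intro!: mult_right_mono)
  ultimately show ?thesis using K(1) by (intro exI[of _ "max K K'"]) simp
qed

text \<open>An operator with two spectral bounds \<open>a0\<close> and \<open>b0\<close> keeps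
  matrices and determinants out of the estimates.\<close>

locale gaussian_form =
  fixes S :: "real^'p \<Rightarrow> real^'p" and \<tau> a0 b0 :: real
  assumes tau: "\<tau> > 0" and a0: "a0 > 0"
    and linear_S: "linear S" and sym_S: "\<And>u v. u \<bullet> S v = v \<bullet> S u"
    and q_lower: "\<And>u. a0 * (norm u)\<^sup>2 \<le> u \<bullet> S u"
    and q_upper: "\<And>u. u \<bullet> S u \<le> b0 * (norm u)\<^sup>2"
begin

abbreviation q :: "real^'p \<Rightarrow> real" where "q u \<equiv> u \<bullet> S u"

lemma q_nonneg: "q u \<ge> 0"
  using q_lower[of u] a0 by (meson mult_nonneg_nonneg less_imp_le order_trans zero_le_power2)

lemma b0_nonneg: "b0 \<ge> 0"
proof -
  have "norm (axis undefined 1 :: real^'p) = 1" by simp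
  then show ?thesis using q_upper[of "axis undefined 1"] q_nonneg[of "axis undefined 1"] by simp
qed

text \<open>If $X \sim N(0, S^{-1})$ and weights $f(Bu - BX)$ are used, then $A u$ is the weighted mean of $X$.\<close>
definition conditional_mean :: "(real^'p \<Rightarrow> real^'p) \<Rightarrow> (real^'p \<Rightarrow> real^'p) \<Rightarrow> bool" where
  "conditional_mean B A \<longleftrightarrow> linear B \<and> linear A \<and>
     (\<forall>u y. q y + (norm (B (u - y)))\<^sup>2 / \<tau>\<^sup>2 = q (A u) + (norm (B (u - A u)))\<^sup>2 / \<tau>\<^sup>2
        + q (y - A u) + (norm (B (y - A u)))\<^sup>2 / \<tau>\<^sup>2)"

text \<open>If \<open>conditional_mean B A\<close>, this is the minimum over \<open>y\<close> of
  \<open>q y + (norm (B (u - y)))\<^sup>2 / \<tau>\<^sup>2\<close>, attained at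
  \<open>y = A u\<close>. Half of it is the exponent of the total weight seen by a point started at
  \<open>u\<close>.\<close>

definition min_energy :: "(real^'p \<Rightarrow> real^'p) \<Rightarrow> (real^'p \<Rightarrow> real^'p) \<Rightarrow> real^'p \<Rightarrow> real" where
  "min_energy B A u = q (A u) + (norm (B (u - A u)))\<^sup>2 / \<tau>\<^sup>2"

lemma min_energy_le:
  assumes "conditional_mean B A"
  shows "min_energy B A u + q (y - A u) \<le> q y + (norm (B (u - y)))\<^sup>2 / \<tau>\<^sup>2"
proof -
  have "q y + (norm (B (u - y)))\<^sup>2 / \<tau>\<^sup>2 = q (A u) + (norm (B (u - A u)))\<^sup>2 / \<tau>\<^sup>2
        + q (y - A u) + (norm (B (y - A u)))\<^sup>2 / \<tau>\<^sup>2"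
    using assms unfolding conditional_mean_def by blast
  moreover have "(norm (B (y - A u)))\<^sup>2 / \<tau>\<^sup>2 \<ge> 0" by simp
  ultimately show ?thesis unfolding min_energy_def by linarith
qed

text \<open>The operator \<open>H\<close>, which is \<open>S\<close> plus
  \<open>B' (B u) / \<tau>\<^sup>2\<close>, is positive definite because \<open>S\<close> is, hence
  invertible. Choosing \<open>A u\<close> as the solution of the stationarity equation
  \<open>H (A u) = B' (B u) / \<tau>\<^sup>2\<close> completes the square: the mixed term around
  \<open>A u\<close> vanishes.\<close>

lemma ex_conditional_mean:
  assumes B: "linear B"
  shows "\<exists>A. conditional_mean B A"
proof -
  define B' where "B' = adjoint B"
  have B': "u \<bullet> B' v = B u \<bullet> v" for u v unfolding B'_def by (rule adjoint_works[OF B])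
  have linB': "linear B'" unfolding B'_def by (rule adjoint_linear[OF B])
  define H where "H u = S u + (1 / \<tau>\<^sup>2) *\<^sub>R B' (B u)" for u
  have linH: "linear H" unfolding H_def
    using linear_compose_add[OF linear_S linear_compose_scale_right[OF linear_compose[OF B linB']]] by (simp add: comp_def)
  have Hpos: "a0 * (norm u)\<^sup>2 \<le> u \<bullet> H u" for u
  proof -
    have "u \<bullet> H u = q u + (norm (B u))\<^sup>2 / \<tau>\<^sup>2"
      unfolding H_def by (simp add: inner_add_right B' power2_norm_eq_inner)
    moreover have "(norm (B u))\<^sup>2 / \<tau>\<^sup>2 \<ge> 0" by simp
    ultimately show ?thesis using q_lower[of u] by linarith
  qed
  have "u = 0" if "H u = 0" for u
    using Hpos[of u] that a0 by (simp add: mult_le_0_iff)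
  then have "inj H" using linear_injective_0[OF linH] by blast
  then obtain H' where H': "linear H'" "\<And>u. H' (H u) = u" "\<And>u. H (H' u) = u"
    using linear_injective_isomorphism[OF linH] by blast
  define A where "A u = H' ((1 / \<tau>\<^sup>2) *\<^sub>R B' (B u))" for u
  have linA: "linear A" unfolding A_def
    using linear_compose[OF linear_compose_scale_right[OF linear_compose[OF B linB']] H'(1)] by (simp add: comp_def)
  have HA: "S (A u) + (1 / \<tau>\<^sup>2) *\<^sub>R B' (B (A u)) = (1 / \<tau>\<^sup>2) *\<^sub>R B' (B u)" for u
    using H'(3)[of "(1 / \<tau>\<^sup>2) *\<^sub>R B' (B u)"] unfolding A_def H_def .
  have "q y + (norm (B (u - y)))\<^sup>2 / \<tau>\<^sup>2 = q (A u) + (norm (B (u - A u)))\<^sup>2 / \<tau>\<^sup>2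
        + q (y - A u) + (norm (B (y - A u)))\<^sup>2 / \<tau>\<^sup>2" for u y
  proof -
    define d where "d = y - A u"
    define z where "z = A u"
    have y: "y = z + d" unfolding d_def z_def by simp
    have "d \<bullet> (S z + (1 / \<tau>\<^sup>2) *\<^sub>R B' (B z)) = d \<bullet> ((1 / \<tau>\<^sup>2) *\<^sub>R B' (B u))"
      unfolding z_def HA ..
    \<comment> \<open>The stationarity equation tested with \<open>d\<close>; it matches the terms
      linear in \<open>d\<close> of the expansion below.\<close>
    then have cross: "d \<bullet> S z + (B d \<bullet> B z) / \<tau>\<^sup>2 = (B d \<bullet> B u) / \<tau>\<^sup>2"
      by (simp add: inner_add_right B')
    have "q y = q z + 2 * (d \<bullet> S z) + q d"
      unfolding y by (simp add: linear_add[OF linear_S] inner_add_left inner_add_right sym_S[of z d])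
    moreover have "(norm (B (u - y)))\<^sup>2 = (norm (B (u - z)))\<^sup>2 - 2 * (B d \<bullet> B u - B d \<bullet> B z) + (norm (B d))\<^sup>2"
      unfolding y by (simp add: linear_add[OF B] linear_diff[OF B] power2_norm_eq_inner inner_add_left
          inner_add_right inner_diff_left inner_diff_right inner_commute)
    ultimately have "q y + (norm (B (u - y)))\<^sup>2 / \<tau>\<^sup>2 = q z + 2 * (d \<bullet> S z) + q d
       + ((norm (B (u - z)))\<^sup>2 - 2 * (B d \<bullet> B u - B d \<bullet> B z) + (norm (B d))\<^sup>2) / \<tau>\<^sup>2" by simp
    also have "\<dots> = q z + (norm (B (u - z)))\<^sup>2 / \<tau>\<^sup>2 + q d + (norm (B d))\<^sup>2 / \<tau>\<^sup>2
      + 2 * (d \<bullet> S z + (B d \<bullet> B z) / \<tau>\<^sup>2 - (B d \<bullet> B u) / \<tau>\<^sup>2)"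
      by (simp add: add_divide_distrib diff_divide_distrib)
    also have "\<dots> = q z + (norm (B (u - z)))\<^sup>2 / \<tau>\<^sup>2 + q d + (norm (B d))\<^sup>2 / \<tau>\<^sup>2"
      unfolding cross by simp
    finally show ?thesis unfolding z_def d_def .
  qed
  then show ?thesis using B linA unfolding conditional_mean_def by blast
qed

text \<open>The minimum is compared with the energy of the trial point \<open>l *\<^sub>R u\<close>
  on the segment from 0 to \<open>u\<close>, where \<open>B\<close> acts by scaling.\<close>

lemma min_energy_contraction:
  assumes cm: "conditional_mean B A" and \<mu>: "\<mu> \<ge> 0" and B: "(norm (B u))\<^sup>2 \<le> \<tau>\<^sup>2 * \<mu> * q u"
  shows "min_energy B A u \<le> \<mu> / (1 + \<mu>) * q u"
proof -
  \<comment> \<open>This \<open>l\<close> minimises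
    \<open>(1 - l)\<^sup>2 * \<mu> + l\<^sup>2\<close>, and the minimum is \<open>l\<close>
    again.\<close>
  define l where "l = \<mu> / (1 + \<mu>)"
  have l: "(1 - l)\<^sup>2 * \<mu> + l\<^sup>2 = l"
  proof -
    have "1 - l = 1 / (1 + \<mu>)" unfolding l_def using \<mu> by (simp add: field_simps)
    then have "(1 - l)\<^sup>2 * \<mu> + l\<^sup>2 = (\<mu> + \<mu>\<^sup>2) / (1 + \<mu>)\<^sup>2" unfolding l_def
      by (simp add: power_divide add_divide_distrib)
    also have "\<dots> = (\<mu> * (1 + \<mu>)) / ((1 + \<mu>) * (1 + \<mu>))" by (simp add: power2_eq_square algebra_simps)
    also have "\<dots> = l" unfolding l_def using \<mu> by simp
    finally show ?thesis .
  qed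
  have linB: "linear B" using cm unfolding conditional_mean_def by blast
  have "min_energy B A u + q (l *\<^sub>R u - A u) \<le> q (l *\<^sub>R u) + (norm (B (u - l *\<^sub>R u)))\<^sup>2 / \<tau>\<^sup>2"
    by (rule min_energy_le[OF cm])
  also have "q (l *\<^sub>R u) = l\<^sup>2 * q u" by (simp add: linear_cmul[OF linear_S] power2_eq_square)
  also have "(norm (B (u - l *\<^sub>R u)))\<^sup>2 = (1 - l)\<^sup>2 * (norm (B u))\<^sup>2"
  proof -
    have "B (u - l *\<^sub>R u) = (1 - l) *\<^sub>R B u"
      by (simp add: linear_diff[OF linB] linear_cmul[OF linB] scaleR_left_diff_distrib)
    then show ?thesis by (simp add: power_mult_distrib)
  qed
  also have "l\<^sup>2 * q u + (1 - l)\<^sup>2 * (norm (B u))\<^sup>2 / \<tau>\<^sup>2 \<le> l\<^sup>2 * q u + (1 - l)\<^sup>2 * (\<tau>\<^sup>2 * \<mu> * q u) / \<tau>\<^sup>2"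
    by (intro add_left_mono divide_right_mono mult_left_mono B) auto
  also have "\<dots> = ((1 - l)\<^sup>2 * \<mu> + l\<^sup>2) * q u" using tau by (simp add: algebra_simps)
  finally have "min_energy B A u + q (l *\<^sub>R u - A u) \<le> l * q u" unfolding l .
  then show ?thesis unfolding l_def[symmetric] using q_nonneg[of "l *\<^sub>R u - A u"] by linarith
qed

text \<open>The linear maps \<^term>\<open>B t\<close> describe the dynamics of the population: starting from $N(0, S^{-1})$, a point
  at $u$ is at \<^term>\<open>B t u\<close> after $t$ steps.\<close>
lemma ex_population_dynamics:
  "\<exists>B A l. B 0 = id \<and> (\<forall>t. B (Suc t) = B t \<circ> A t) \<and> (\<forall>t. conditional_mean (B t) (A t)) \<and>
    0 \<le> l \<and> l < 1 \<and> (\<forall>t u. min_energy (B t) (A t) u \<le> l * q u) \<and>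
    (\<forall>\<epsilon>>0. \<exists>T::nat. \<forall>u. norm (B T u) \<le> \<epsilon> * norm u)"
proof -
  define cmean where "cmean B = (SOME A. conditional_mean B A)" for B
  have cmean: "conditional_mean B (cmean B)" if "linear B" for B
    unfolding cmean_def using ex_conditional_mean[OF that] by (rule someI_ex)
  define B where "B t = ((\<lambda>B. B \<circ> cmean B) ^^ t) id" for t :: nat
  have B0: "B 0 = id" and BSuc: "B (Suc t) = B t \<circ> cmean (B t)" for t unfolding B_def by simp_all
  have linB: "linear (B t)" for t
  proof (induction t)
    case 0
    show ?case unfolding B0 by (rule linear_id)
  next
    case (Suc t)
    then have "linear (cmean (B t))" using cmean unfolding conditional_mean_def by blast
    then show ?case unfolding BSuc using Suc by (rule linear_compose)
  qed
  \<comment> \<open>With this value \<open>q_lower\<close> is the hypothesis of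
    \<open>min_energy_contraction\<close> for \<open>B 0 = id\<close>; the maps \<open>B t\<close>
    inherit it because \<open>l ^ t \<le> 1\<close>.\<close>
  define \<mu> where "\<mu> = 1 / (\<tau>\<^sup>2 * a0)"
  have \<mu>: "\<mu> > 0" unfolding \<mu>_def using tau a0 by simp
  define l where "l = \<mu> / (1 + \<mu>)"
  have l: "0 \<le> l" "l < 1" unfolding l_def using \<mu> by auto
  \<comment> \<open>Each step gains a factor \<open>l\<close>: the induction hypothesis is used at
    \<open>cmean (B t) u\<close>, whose \<open>q\<close> is at most its share of the minimal energy
    and so at most \<open>l * q u\<close>.\<close>
  have bound: "(norm (B t u))\<^sup>2 \<le> \<tau>\<^sup>2 * \<mu> * (l ^ t * q u)" for t u
  proof (induction t arbitrary: u)
    case 0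
    have "\<tau>\<^sup>2 * \<mu> * q u = q u / a0" unfolding \<mu>_def using tau by simp
    then show ?case using q_lower[of u] a0 unfolding B0 by (simp add: le_divide_eq mult.commute)
  next
    case (Suc t)
    have lt: "l ^ t \<le> 1" using l by (intro power_le_one) auto
    have "(norm (B t u))\<^sup>2 \<le> \<tau>\<^sup>2 * \<mu> * q u" for u
    proof -
      have "\<tau>\<^sup>2 * \<mu> * (l ^ t * q u) \<le> \<tau>\<^sup>2 * \<mu> * (1 * q u)"
        using \<mu> lt q_nonneg by (intro mult_left_mono mult_right_mono) auto
      then show ?thesis using Suc[of u] by simp
    qed
    then have "min_energy (B t) (cmean (B t)) u \<le> l * q u"
      unfolding l_def using \<mu> by (intro min_energy_contraction cmean linB) auto
    moreover have "(norm (B t (u - cmean (B t) u)))\<^sup>2 / \<tau>\<^sup>2 \<ge> 0" by simp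
    ultimately have "q (cmean (B t) u) \<le> l * q u" unfolding min_energy_def by linarith
    then have "\<tau>\<^sup>2 * \<mu> * (l ^ t * q (cmean (B t) u)) \<le> \<tau>\<^sup>2 * \<mu> * (l ^ t * (l * q u))"
      using \<mu> l by (intro mult_left_mono) auto
    then show ?case unfolding BSuc comp_apply using Suc[of "cmean (B t) u"] by (simp add: mult.assoc mult.left_commute)
  qed
  have "(norm (B t u))\<^sup>2 \<le> \<tau>\<^sup>2 * \<mu> * q u" for t u
  proof -
    have "l ^ t \<le> 1" using l by (intro power_le_one) auto
    then have "\<tau>\<^sup>2 * \<mu> * (l ^ t * q u) \<le> \<tau>\<^sup>2 * \<mu> * (1 * q u)"
      using \<mu> q_nonneg by (intro mult_left_mono mult_right_mono) auto
    then show ?thesis using bound[of t u] by simp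
  qed
  then have energy: "min_energy (B t) (cmean (B t)) u \<le> l * q u" for t u
    unfolding l_def using \<mu> by (intro min_energy_contraction cmean linB) auto
  have small: "\<exists>T. \<forall>u. norm (B T u) \<le> \<epsilon> * norm u" if \<epsilon>: "\<epsilon> > 0" for \<epsilon>
  proof -
    have "(\<lambda>t. \<tau>\<^sup>2 * \<mu> * (l ^ t * b0)) \<longlonglongrightarrow> \<tau>\<^sup>2 * \<mu> * (0 * b0)"
      using l by (intro tendsto_intros LIMSEQ_realpow_zero) auto
    then have "\<forall>\<^sub>F t in sequentially. \<tau>\<^sup>2 * \<mu> * (l ^ t * b0) < \<epsilon>\<^sup>2"
      using \<epsilon> by (intro order_tendstoD(2)) auto
    then obtain T where T: "\<tau>\<^sup>2 * \<mu> * (l ^ T * b0) < \<epsilon>\<^sup>2" using eventually_happens' by force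
    have "norm (B T u) \<le> \<epsilon> * norm u" for u
    proof (rule power2_le_imp_le)
      have "(norm (B T u))\<^sup>2 \<le> \<tau>\<^sup>2 * \<mu> * (l ^ T * (b0 * (norm u)\<^sup>2))"
        using \<mu> l by (intro order_trans[OF bound] mult_left_mono q_upper) auto
      also have "\<dots> = \<tau>\<^sup>2 * \<mu> * (l ^ T * b0) * (norm u)\<^sup>2" by simp
      also have "\<dots> \<le> \<epsilon>\<^sup>2 * (norm u)\<^sup>2" using T by (intro mult_right_mono) auto
      finally show "(norm (B T u))\<^sup>2 \<le> (\<epsilon> * norm u)\<^sup>2" by (simp add: power_mult_distrib)
    qed (use \<epsilon> in simp)
    then show ?thesis by blast
  qed
  show ?thesis
    by (intro exI[of _ B] exI[of _ "\<lambda>t. cmean (B t)"] exI[of _ l] conjI allI impI B0 BSuc cmean linB l energy small)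
qed

end

section \<open>Tracking the population dynamics\<close>

text \<open>Absorbs a factor such as a norm into a Gaussian exponent, at an arbitrarily small loss
  \<open>c\<close>.\<close>

lemma exp_square_dominates_linear:
  fixes c t :: real
  assumes "c > 0"
  shows "t \<le> (1 + 1 / c) * exp (c * t\<^sup>2)"
proof -
  have "t \<le> 1 + t\<^sup>2"
  proof (cases "t \<le> 1")
    case False
    then show ?thesis by (simp add: power2_eq_square mult_le_cancel_left1 add_increasing)
  qed (simp add: add_increasing2)
  also have "\<dots> \<le> (1 + 1 / c) * (1 + c * t\<^sup>2)"
    using assms by (simp add: field_simps)
  also have "\<dots> \<le> (1 + 1 / c) * exp (c * t\<^sup>2)"
    using assms by (intro mult_left_mono exp_ge_add_one_self) auto
  finally show ?thesis .
qed

text \<open>Jensen's inequality through the tangent \<open>exp (- L) * (1 + (L - a))\<close> of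
  \<open>exp (- a)\<close> at \<open>L\<close>. It converts an upper bound for the mean squared
  distance into a lower bound for the sum of the kernel weights.\<close>

lemma jensen_exp_neg:
  fixes a :: "nat \<Rightarrow> real"
  assumes "(\<Sum>j<n. a j) \<le> L * real n"
  shows "real n * exp (- L) \<le> (\<Sum>j<n. exp (- a j))"
proof -
  have "real n * exp (- L) \<le> exp (- L) * (real n + (L * real n - (\<Sum>j<n. a j)))"
    using assms by (simp add: algebra_simps)
  also have "\<dots> = (\<Sum>j<n. exp (- L) * (1 + (L - a j)))"
    by (simp add: sum_distrib_left sum.distrib sum_subtractf algebra_simps)
  also have "\<dots> \<le> (\<Sum>j<n. exp (- L) * exp (L - a j))"
    by (intro sum_mono mult_left_mono exp_ge_add_one_self) auto
  finally show ?thesis by (simp add: mult_exp_exp)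
qed

lemma abs_exp_neg_diff_le:
  fixes a b :: real
  assumes "a \<ge> 0" "b \<ge> 0"
  shows "\<bar>exp (- a) - exp (- b)\<bar> \<le> \<bar>a - b\<bar>"
proof -
  have *: "exp (- a) - exp (- b) \<le> b - a" if "0 \<le> a" "a \<le> b" for a b :: real
  proof -
    have "exp (- a) - exp (- b) = exp (- a) * (1 - exp (- (b - a)))"
      by (simp add: algebra_simps mult_exp_exp)
    also have "\<dots> \<le> 1 * (b - a)"
    proof (rule mult_mono)
      show "1 - exp (- (b - a)) \<le> b - a" using exp_ge_add_one_self[of "- (b - a)"] by linarith
    qed (use that in auto)
    finally show ?thesis by simp
  qed
  show ?thesis
  proof (cases "a \<le> b")
    case True
    then show ?thesis using *[OF assms(1) True] by simp
  next
    case False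
    then show ?thesis using *[of b a] assms by simp
  qed
qed

lemma bms_add: "bms \<tau> n x (T + k) = bms \<tau> n (bms \<tau> n x T) k"
  by (induction k) (simp_all add: Let_def)

text \<open>Expanding the square of the norm of \<open>\<delta> *\<^sub>R u + (v - u)\<close> trades
  a small fraction of the main term against an error amplified by \<open>1 / \<delta>\<close>. Used
  with \<open>u\<close> an exact image difference and \<open>v\<close> the actual one.\<close>

lemma power2_norm_perturb_lower:
  fixes u v :: "'b::real_inner"
  assumes "0 < \<delta>" "\<delta> \<le> 1"
  shows "(1 - \<delta>) * (norm u)\<^sup>2 - (norm (v - u))\<^sup>2 / \<delta> \<le> (norm v)\<^sup>2"
proof -
  have "0 \<le> (norm (\<delta> *\<^sub>R u + (v - u)))\<^sup>2 / \<delta> + (1 - \<delta>) * 0" using assms by simp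
  also have "(norm (\<delta> *\<^sub>R u + (v - u)))\<^sup>2 = \<delta>\<^sup>2 * (norm u)\<^sup>2 + 2 * \<delta> * (u \<bullet> (v - u)) + (norm (v - u))\<^sup>2"
    unfolding power2_norm_eq_inner
    by (simp add: inner_simps power2_eq_square algebra_simps inner_commute)
  also have "\<dots> / \<delta> + (1 - \<delta>) * 0 = \<delta> * (norm u)\<^sup>2 + 2 * (u \<bullet> (v - u)) + (norm (v - u))\<^sup>2 / \<delta>"
    using assms by (simp add: add_divide_distrib power2_eq_square)
  finally have "- (norm (v - u))\<^sup>2 / \<delta> \<le> \<delta> * (norm u)\<^sup>2 + 2 * (u \<bullet> (v - u))" by simp
  moreover have "(norm v)\<^sup>2 = (norm u)\<^sup>2 + 2 * (u \<bullet> (v - u)) + (norm (v - u))\<^sup>2"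
    by (simp add: power2_norm_eq_inner inner_simps inner_commute)
  ultimately have "(1 - \<delta>) * (norm u)\<^sup>2 - (norm (v - u))\<^sup>2 / \<delta> + (norm (v - u))\<^sup>2 \<le> (norm v)\<^sup>2"
    by (simp add: algebra_simps)
  moreover have "(norm (v - u))\<^sup>2 \<ge> 0" by simp
  ultimately show ?thesis by linarith
qed

lemma norm_kmean_eq:
  "norm (kmean \<tau> n y i g) = norm (\<Sum>j<n. gauss_kernel \<tau> (y i - y j) *\<^sub>R g j) / (\<Sum>j<n. gauss_kernel \<tau> (y i - y j))"
  unfolding kmean_def by (simp add: sum_nonneg)

lemma gauss_kernel_lipschitz:
  "\<bar>gauss_kernel \<tau> u - gauss_kernel \<tau> v\<bar> \<le> norm (u - v) * (norm u + norm v) / (2 * \<tau>\<^sup>2)"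
proof -
  have "\<bar>gauss_kernel \<tau> u - gauss_kernel \<tau> v\<bar> \<le> \<bar>(norm u)\<^sup>2 / (2 * \<tau>\<^sup>2) - (norm v)\<^sup>2 / (2 * \<tau>\<^sup>2)\<bar>"
    unfolding gauss_kernel_norm minus_divide_left[symmetric] by (rule abs_exp_neg_diff_le) auto
  also have "\<dots> = \<bar>norm u - norm v\<bar> * (norm u + norm v) / (2 * \<tau>\<^sup>2)"
    by (simp add: diff_divide_distrib[symmetric] abs_mult[symmetric] power2_eq_square square_diff_square_factored mult.commute abs_mult)
  also have "\<dots> \<le> norm (u - v) * (norm u + norm v) / (2 * \<tau>\<^sup>2)"
    by (intro divide_right_mono mult_right_mono norm_triangle_ineq3) auto
  finally show ?thesis .
qed

section \<open>Deterministic analysis of one realisation of the sample\<close>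

text \<open>The exponent in \<open>moment\<close> stays below \<open>q / 2\<close> because
  \<open>exp (q / 2)\<close> is not integrable against the density. In \<open>dense\<close> the
  range of \<open>z\<close> is where the expected count, roughly \<open>n * exp (- q z / 2)\<close>,
  is at least a positive power of \<open>n\<close>; the constant \<open>c\<close> does not depend on
  \<open>z\<close>.\<close>

locale blurring_sample = gaussian_form S \<tau> a0 b0
  for S :: "real^'p \<Rightarrow> real^'p" and \<tau> a0 b0 :: real +
  fixes x :: "nat \<Rightarrow> real^'p"
  assumes moment: "\<And>\<delta>. 0 < \<delta> \<Longrightarrow> \<delta> < 1 \<Longrightarrow>
      \<exists>C. \<forall>n. (\<Sum>j<n. exp ((1 - \<delta>) / 2 * q (x j))) \<le> C * real n"
    and dense: "\<And>\<epsilon>. \<epsilon> > 0 \<Longrightarrow> \<exists>c>0. \<forall>\<^sub>F n in sequentially. \<forall>z. q z \<le> (1 - \<epsilon>) * (2 * ln (real n)) \<longrightarrow>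
      c * real n * exp (- q z / 2 - \<epsilon> * (1 + (norm z)\<^sup>2))
        \<le> real (card {j. j < n \<and> norm (x j - z) \<le> \<epsilon> * (1 + norm z)})"
begin

lemma exp_moment:
  "\<exists>a C. a > 0 \<and> C > 0 \<and> (\<forall>n. (\<Sum>j<n. exp (a * (norm (x j))\<^sup>2)) \<le> C * real n)"
proof -
  obtain C where C: "\<And>n. (\<Sum>j<n. exp ((1 - 1/2) / 2 * q (x j))) \<le> C * real n"
    using moment[of "1/2"] by auto
  have "(\<Sum>j<n. exp (a0/4 * (norm (x j))\<^sup>2)) \<le> (\<bar>C\<bar> + 1) * real n" for n
  proof -
    have "(\<Sum>j<n. exp (a0/4 * (norm (x j))\<^sup>2)) \<le> (\<Sum>j<n. exp ((1 - 1/2) / 2 * q (x j)))"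
      using q_lower by (intro sum_mono) simp
    also have "\<dots> \<le> C * real n" by (rule C)
    also have "\<dots> \<le> (\<bar>C\<bar> + 1) * real n" by (intro mult_right_mono) auto
    finally show ?thesis .
  qed
  then show ?thesis using a0 by (intro exI[of _ "a0/4"] exI[of _ "\<bar>C\<bar> + 1"]) auto
qed

text \<open>The cube is the growth met in \<open>bulk_step\<close>: a displacement, a distance in
  the kernel and a distance to the centre, each at most linear in
  \<open>1 + norm (x j)\<close>.\<close>

lemma cubic_moment: "\<exists>C>0. \<forall>n. (\<Sum>j<n. (1 + norm (x j)) ^ 3) \<le> C * real n"
proof -
  obtain a C where a: "a > 0" "C > 0" "\<And>n. (\<Sum>j<n. exp (a * (norm (x j))\<^sup>2)) \<le> C * real n"
    using exp_moment by blast
  define K where "K = (2 + 3 / a) ^ 3"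
  have K: "K > 0" using a unfolding K_def by (intro zero_less_power add_pos_pos divide_pos_pos) auto
  have "(1 + norm u) ^ 3 \<le> K * exp (a * (norm u)\<^sup>2)" for u :: "real^'p"
  proof -
    have "1 + norm u \<le> 1 * exp (a / 3 * (norm u)\<^sup>2) + (1 + 1 / (a/3)) * exp (a / 3 * (norm u)\<^sup>2)"
      using a exp_square_dominates_linear[of "a/3" "norm u"] by (intro add_mono) auto
    also have "\<dots> = (2 + 3 / a) * exp (a / 3 * (norm u)\<^sup>2)" by (simp add: algebra_simps)
    finally have "(1 + norm u) ^ 3 \<le> ((2 + 3 / a) * exp (a / 3 * (norm u)\<^sup>2)) ^ 3"
      by (intro power_mono) auto
    also have "\<dots> = K * exp (a * (norm u)\<^sup>2)"
      unfolding K_def by (simp add: power_mult_distrib exp_of_nat_mult[symmetric])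
    finally show ?thesis .
  qed
  then have "(\<Sum>j<n. (1 + norm (x j)) ^ 3) \<le> (\<Sum>j<n. K * exp (a * (norm (x j))\<^sup>2))" for n
    by (intro sum_mono)
  also have "(\<Sum>j<n. K * exp (a * (norm (x j))\<^sup>2)) \<le> K * (C * real n)" for n
    unfolding sum_distrib_left[symmetric] using a K by (intro mult_left_mono) auto
  finally show ?thesis using a K by (intro exI[of _ "K * C"]) (auto simp: mult.assoc)
qed

text \<open>A single term of the moment sum is at most the whole sum, hence at most
  \<open>C' * n\<close>; taking logarithms bounds \<open>(1 - \<delta>) / 2 * q (x i)\<close>. Since
  \<open>c < 1 - \<delta>\<close>, the remaining gap absorbs \<open>ln C'\<close> for large
  \<open>n\<close>.\<close>

lemma max_q_bound:
  assumes c: "c < 1"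
  shows "\<forall>\<^sub>F n in sequentially. \<forall>i<n. c * q (x i) \<le> 2 * ln (real n)"
proof (cases "c \<le> 0")
  case True
  have "c * q u \<le> 2 * ln (real n)" if "n \<ge> 1" for u and n :: nat
    using that True q_nonneg[of u] mult_nonpos_nonneg[of c "q u"] by (auto intro: order_trans[of _ 0])
  then show ?thesis by (auto simp: eventually_sequentially)
next
  case False
  define \<delta> where "\<delta> = (1 - c) / 2"
  have \<delta>: "0 < \<delta>" "\<delta> < 1" "c < 1 - \<delta>" using c False unfolding \<delta>_def by (auto simp: field_simps)
  obtain C where C: "\<And>n. (\<Sum>j<n. exp ((1 - \<delta>) / 2 * q (x j))) \<le> C * real n"
    using moment[OF \<delta>(1,2)] by auto
  define C' where "C' = \<bar>C\<bar> + 1"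
  have C': "C' > 0" unfolding C'_def by simp
  have "\<forall>\<^sub>F n in sequentially. c / (1 - \<delta>) * (2 * (ln C' + ln (real n))) \<le> 2 * ln (real n)"
  proof -
    define \<theta> where "\<theta> = c / (1 - \<delta>)"
    have \<theta>: "\<theta> < 1" using \<delta> unfolding \<theta>_def by auto
    have "\<forall>\<^sub>F n in sequentially. \<theta> * ln C' / (1 - \<theta>) \<le> ln (real n)" by real_asymp
    then have "\<forall>\<^sub>F n in sequentially. \<theta> * (2 * (ln C' + ln (real n))) \<le> 2 * ln (real n)"
      by eventually_elim (use \<theta> in \<open>simp add: field_simps\<close>)
    then show ?thesis unfolding \<theta>_def .
  qed
  then show ?thesis using eventually_gt_at_top[of 0]
  proof eventually_elim
    case (elim n)
    show ?case
    proof safe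
      fix i assume i: "i < n"
      have "exp ((1 - \<delta>) / 2 * q (x i)) \<le> (\<Sum>j<n. exp ((1 - \<delta>) / 2 * q (x j)))"
        using i by (intro member_le_sum) auto
      also have "\<dots> \<le> C * real n" by (rule C)
      also have "\<dots> \<le> C' * real n" unfolding C'_def by (intro mult_right_mono) auto
      finally have "(1 - \<delta>) / 2 * q (x i) \<le> ln (C' * real n)"
        using C' elim by (subst ln_ge_iff) auto
      also have "\<dots> = ln C' + ln (real n)" using C' elim by (subst ln_mult) auto
      finally have "c / (1 - \<delta>) * ((1 - \<delta>) * q (x i)) \<le> c / (1 - \<delta>) * (2 * (ln C' + ln (real n)))"
        using \<delta> False by (intro mult_left_mono) auto
      then show "c * q (x i) \<le> 2 * ln (real n)" using elim(1) \<delta> by simp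
    qed
  qed
qed

text \<open>Once the points are within \<^term>\<open>\<epsilon>\<close> times their initial position, every further step halves the
  dependence on that position, and the accumulated displacement stays of order \<^term>\<open>\<epsilon>\<close>.\<close>
lemma bms_stays_near_0:
  "\<exists>K>0. \<exists>\<epsilon>0>0. \<forall>\<epsilon> n (y :: nat \<Rightarrow> real^'p) k i. 0 < \<epsilon> \<longrightarrow> \<epsilon> \<le> \<epsilon>0 \<longrightarrow> (\<forall>i<n. norm (y i) \<le> \<epsilon> * (1 + norm (x i))) \<longrightarrow> i < n \<longrightarrow>
     norm (bms \<tau> n y k i) \<le> K * \<epsilon> + \<epsilon> / 2 ^ k * norm (x i)"
proof -
  obtain a C where a: "a > 0" "C > 0" "\<And>n. (\<Sum>j<n. exp (a * (norm (x j))\<^sup>2)) \<le> C * real n"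
    using exp_moment by blast
  \<comment> \<open>\<open>1 + 2 / a\<close> comes from absorbing a norm into an exponential,
    \<open>C\<close> from the moment bound, and \<open>exp (1 + C)\<close> from the lower bound for
    the kernel sum \<open>D\<close>.\<close>
  define K1 where "K1 = (1 + 2 / a) * C * exp (1 + C)"
  have K1: "K1 > 0" unfolding K1_def using a by (intro mult_pos_pos add_pos_pos) auto
  define K where "K = 1 + 2 * K1"
  have K: "K > 0" unfolding K_def using K1 by simp
  \<comment> \<open>The two bounds give
    \<open>\<epsilon>\<^sup>2 \<le> \<tau>\<^sup>2 * (a / 12)\<close> and
    \<open>\<rho>\<^sup>2 \<le> \<tau>\<^sup>2 / 6\<close>; then the kernel exponent is at most
    \<open>1 + a/8 * s\<^sup>2 + a/8 * (norm (x j))\<^sup>2\<close>.\<close>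
  define \<epsilon>0 where "\<epsilon>0 = \<tau> * min (sqrt (a / 12)) (1 / (sqrt 6 * K))"
  have \<epsilon>0: "\<epsilon>0 > 0" unfolding \<epsilon>0_def using tau a K by auto
  \<comment> \<open>Step \<open>m\<close> adds a drift of \<open>\<epsilon> * K1 / 2 ^ m\<close>;
    the bracket holds the geometric sum of these over \<open>m < k\<close>.\<close>
  have "norm (bms \<tau> n y k i) \<le> \<epsilon> * (1 + 2 * K1 * (1 - 1 / 2 ^ k)) + \<epsilon> / 2 ^ k * norm (x i)"
    if \<epsilon>: "0 < \<epsilon>" "\<epsilon> \<le> \<epsilon>0" and y: "\<forall>i<n. norm (y i) \<le> \<epsilon> * (1 + norm (x i))" and i: "i < n" for \<epsilon> n k i and y :: "nat \<Rightarrow> real^'p"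
    using i
  proof (induction k arbitrary: i)
    case 0
    then show ?case using y by (simp add: algebra_simps)
  next
    case (Suc k)
    define z where "z = bms \<tau> n y k"
    define \<rho> where "\<rho> = \<epsilon> * (1 + 2 * K1 * (1 - 1 / 2 ^ k))"
    define D where "D = (\<Sum>j<n. gauss_kernel \<tau> (z i - z j))"
    define s where "s = norm (x i)"
    have n: "n > 0" using Suc.prems by simp
    have z: "norm (z j) \<le> \<rho> + \<epsilon> / 2 ^ k * norm (x j)" if "j < n" for j
      unfolding z_def \<rho>_def by (rule Suc.IH[OF that])
    have \<rho>0: "0 \<le> \<rho>" unfolding \<rho>_def using \<epsilon> K1 by (intro mult_nonneg_nonneg add_nonneg_nonneg) (auto simp: field_simps)
    have "\<rho> \<le> \<epsilon> * K"
      unfolding \<rho>_def K_def using \<epsilon> K1 by (intro mult_left_mono) (auto simp: field_simps)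
    also have "\<dots> \<le> \<epsilon>0 * K" using \<epsilon> K by (intro mult_right_mono) auto
    also have "\<dots> \<le> \<tau> * (1 / (sqrt 6 * K)) * K" unfolding \<epsilon>0_def using tau K by (intro mult_right_mono mult_left_mono) auto
    also have "\<dots> = \<tau> / sqrt 6" using K by simp
    finally have "\<rho>\<^sup>2 \<le> (\<tau> / sqrt 6)\<^sup>2" using \<rho>0 by (intro power_mono)
    then have \<rho>: "\<rho>\<^sup>2 \<le> \<tau>\<^sup>2 / 6" by (simp add: power_divide)
    have "\<epsilon>0 \<le> \<tau> * sqrt (a / 12)" unfolding \<epsilon>0_def using tau by (intro mult_left_mono) auto
    then have "\<epsilon> \<le> \<tau> * sqrt (a / 12)" using \<epsilon>(2) by simp
    then have "\<epsilon>\<^sup>2 \<le> (\<tau> * sqrt (a / 12))\<^sup>2" using \<epsilon> by (intro power_mono) auto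
    then have \<epsilon>2: "\<epsilon>\<^sup>2 \<le> \<tau>\<^sup>2 * (a / 12)" using a by (simp add: power_mult_distrib)
    have w: "exp (- 1 - a/8 * s\<^sup>2) * exp (- (a/8 * (norm (x j))\<^sup>2)) \<le> gauss_kernel \<tau> (z i - z j)" if j: "j < n" for j
    proof -
      have "norm (z i - z j) \<le> norm (z i) + norm (z j)" by (rule norm_triangle_ineq4)
      also have "\<dots> \<le> (\<rho> + \<epsilon> / 2 ^ k * s) + (\<rho> + \<epsilon> / 2 ^ k * norm (x j))"
        unfolding s_def using z[OF j] z[OF Suc.prems] by linarith
      also have "\<dots> \<le> 2 * \<rho> + \<epsilon> * s + \<epsilon> * norm (x j)"
      proof -
        have "\<epsilon> / 2 ^ k * t \<le> \<epsilon> * t" if "t \<ge> 0" for t :: real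
          using \<epsilon> that by (intro mult_right_mono) (auto simp: divide_le_eq)
        from this[of s] this[of "norm (x j)"] show ?thesis unfolding s_def by simp
      qed
      finally have "(norm (z i - z j))\<^sup>2 \<le> (2 * \<rho> + \<epsilon> * s + \<epsilon> * norm (x j))\<^sup>2"
        by (intro power_mono) auto
      also have "\<dots> \<le> 3 * ((2 * \<rho>)\<^sup>2 + (\<epsilon> * s)\<^sup>2 + (\<epsilon> * norm (x j))\<^sup>2)"
        using sum_squares_ge_zero[of "2*\<rho> - \<epsilon> * s" "2*\<rho> - \<epsilon> * norm (x j)"] zero_le_square[of "\<epsilon> * s - \<epsilon> * norm (x j)"]
        by (simp add: power2_eq_square algebra_simps)
      also have "\<dots> = 12 * \<rho>\<^sup>2 + 3 * \<epsilon>\<^sup>2 * (s\<^sup>2 + (norm (x j))\<^sup>2)"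
        by (simp add: power_mult_distrib algebra_simps)
      also have "\<dots> \<le> 12 * (\<tau>\<^sup>2 / 6) + 3 * (\<tau>\<^sup>2 * (a / 12)) * (s\<^sup>2 + (norm (x j))\<^sup>2)"
        using \<rho> \<epsilon>2 by (intro add_mono mult_left_mono mult_right_mono) auto
      also have "\<dots> = 2 * \<tau>\<^sup>2 * (1 + a/8 * s\<^sup>2 + a/8 * (norm (x j))\<^sup>2)" by (simp add: algebra_simps)
      finally have "(norm (z i - z j))\<^sup>2 / (2 * \<tau>\<^sup>2) \<le> 1 + a/8 * s\<^sup>2 + a/8 * (norm (x j))\<^sup>2"
        using tau by (simp add: divide_le_eq mult.commute)
      then show ?thesis by (simp add: gauss_kernel_norm mult_exp_exp)
    qed
    have D: "real n * exp (- 1 - C) * exp (- (a/8 * s\<^sup>2)) \<le> D"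
    proof -
      have "(\<Sum>j<n. a/8 * (norm (x j))\<^sup>2) \<le> (\<Sum>j<n. exp (a * (norm (x j))\<^sup>2))"
      proof (intro sum_mono)
        fix j
        have "a/8 * (norm (x j))\<^sup>2 \<le> 1 + a * (norm (x j))\<^sup>2" using a by (simp add: add_increasing)
        also have "\<dots> \<le> exp (a * (norm (x j))\<^sup>2)" by (rule exp_ge_add_one_self)
        finally show "a/8 * (norm (x j))\<^sup>2 \<le> exp (a * (norm (x j))\<^sup>2)" .
      qed
      also have "\<dots> \<le> C * real n" by (rule a(3))
      finally have "real n * exp (- C) \<le> (\<Sum>j<n. exp (- (a/8 * (norm (x j))\<^sup>2)))"
        by (rule jensen_exp_neg)
      then have "exp (- 1 - a/8 * s\<^sup>2) * (real n * exp (- C)) \<le>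
          exp (- 1 - a/8 * s\<^sup>2) * (\<Sum>j<n. exp (- (a/8 * (norm (x j))\<^sup>2)))"
        by (intro mult_left_mono) auto
      also have "\<dots> \<le> D" unfolding D_def sum_distrib_left using w by (intro sum_mono) auto
      finally have "real n * (exp (- 1 - a/8 * s\<^sup>2) * exp (- C)) \<le> D" by (simp add: ac_simps)
      also have "exp (- 1 - a/8 * s\<^sup>2) * exp (- C) = exp (- 1 - C) * exp (- (a/8 * s\<^sup>2))"
      proof -
        have "(- 1 - a/8 * s\<^sup>2) + (- C) = (- 1 - C) + (- (a/8 * s\<^sup>2))" by simp
        then show ?thesis by (simp only: mult_exp_exp)
      qed
      finally show ?thesis by (simp add: mult.assoc)
    qed
    \<comment> \<open>The cut at half of \<open>s\<close> produces the halving. A point with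
      \<open>norm (x j) > s / 2\<close> gains the factor \<open>exp (- (a/8 * s\<^sup>2))\<close>
      from the moment bound, exactly the factor lost in the lower bound for
      \<open>D\<close>.\<close>
    have "(\<Sum>j<n. gauss_kernel \<tau> (z i - z j) * norm (x j))
        \<le> (\<Sum>j<n. gauss_kernel \<tau> (z i - z j) * (s / 2) + (1 + 2 / a) * (exp (- (a/8 * s\<^sup>2)) * exp (a * (norm (x j))\<^sup>2)))"
    proof (intro sum_mono)
      fix j assume j: "j \<in> {..<n}"
      define t where "t = norm (x j)"
      show "gauss_kernel \<tau> (z i - z j) * norm (x j) \<le>
          gauss_kernel \<tau> (z i - z j) * (s / 2) + (1 + 2 / a) * (exp (- (a/8 * s\<^sup>2)) * exp (a * (norm (x j))\<^sup>2))"
      proof (cases "t \<le> s / 2")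
        case True
        then show ?thesis using a unfolding t_def by (intro add_increasing2 mult_left_mono) auto
      next
        case False
        have s0: "s \<ge> 0" unfolding s_def by simp
        have "gauss_kernel \<tau> (z i - z j) * t \<le> 1 * t"
          unfolding t_def by (intro mult_right_mono gauss_kernel_le_1) auto
        also have "\<dots> \<le> (1 + 2 / a) * exp (a/2 * t\<^sup>2)"
          using exp_square_dominates_linear[of "a/2" t] a by simp
        also have "\<dots> \<le> (1 + 2 / a) * (exp (- (a/8 * s\<^sup>2)) * exp (a * t\<^sup>2))"
        proof -
          have "(s/2)\<^sup>2 \<le> t\<^sup>2" using False s0 by (intro power_mono) auto
          then have "a/2 * (s/2)\<^sup>2 \<le> a/2 * t\<^sup>2" using a by (intro mult_left_mono) auto
          then have "a/2 * t\<^sup>2 \<le> - (a/8 * s\<^sup>2) + a * t\<^sup>2" by (simp add: power_divide)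
          then show ?thesis unfolding mult_exp_exp using a by (intro mult_left_mono) auto
        qed
        finally have "gauss_kernel \<tau> (z i - z j) * t \<le> (1 + 2 / a) * (exp (- (a/8 * s\<^sup>2)) * exp (a * t\<^sup>2))" .
        then show ?thesis unfolding t_def using s0 by (intro add_increasing) auto
      qed
    qed
    also have "\<dots> = s / 2 * D + (1 + 2 / a) * (exp (- (a/8 * s\<^sup>2)) * (\<Sum>j<n. exp (a * (norm (x j))\<^sup>2)))"
      unfolding D_def by (simp add: sum.distrib sum_distrib_left sum_distrib_right mult.commute)
    also have "\<dots> \<le> s / 2 * D + (1 + 2 / a) * (exp (- (a/8 * s\<^sup>2)) * (C * real n))"
      using a by (intro add_left_mono mult_left_mono) auto
    also have "(1 + 2 / a) * (exp (- (a/8 * s\<^sup>2)) * (C * real n)) = K1 * (real n * exp (- 1 - C) * exp (- (a/8 * s\<^sup>2)))"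
      unfolding K1_def by (simp add: mult_exp_exp)
    also have "s / 2 * D + \<dots> \<le> s / 2 * D + K1 * D" using D K1 by (intro add_left_mono mult_left_mono) auto
    finally have "kmean \<tau> n z i (\<lambda>j. norm (x j)) \<le> s / 2 + K1"
      unfolding kmean_le_iff[OF n] D_def by (simp add: algebra_simps)
    then have *: "\<epsilon> / 2 ^ k * kmean \<tau> n z i (\<lambda>j. norm (x j)) \<le> \<epsilon> / 2 ^ k * (s / 2 + K1)"
      using \<epsilon> by (intro mult_left_mono) auto
    have "norm (bms \<tau> n y (Suc k) i) \<le> kmean \<tau> n z i (\<lambda>j. norm (z j))"
      unfolding bms_Suc_kmean z_def by (rule norm_kmean_le)
    also have "\<dots> \<le> kmean \<tau> n z i (\<lambda>j. \<rho> + \<epsilon> / 2 ^ k * norm (x j))" by (intro kmean_mono z)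
    also have "\<dots> = \<rho> + \<epsilon> / 2 ^ k * kmean \<tau> n z i (\<lambda>j. norm (x j))"
      using n by (simp only: kmean_add kmean_cmult kmean_const)
    also have "\<dots> \<le> \<rho> + \<epsilon> / 2 ^ k * (s / 2 + K1)" using * by simp
    also have "\<dots> = \<epsilon> * (1 + 2 * K1 * (1 - 1 / 2 ^ Suc k)) + \<epsilon> / 2 ^ Suc k * norm (x i)"
      unfolding \<rho>_def s_def by (simp add: field_simps)
    finally show ?case .
  qed
  note bound = this
  have near: "norm (bms \<tau> n y k i) \<le> K * \<epsilon> + \<epsilon> / 2 ^ k * norm (x i)"
    if \<epsilon>: "0 < \<epsilon>" "\<epsilon> \<le> \<epsilon>0" and y: "\<forall>i<n. norm (y i) \<le> \<epsilon> * (1 + norm (x i))" and i: "i < n" for \<epsilon> n k i and y :: "nat \<Rightarrow> real^'p"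
  proof -
    have "1 + 2 * K1 * (1 - 1 / 2 ^ k) \<le> K" unfolding K_def using K1 by (simp add: algebra_simps)
    then have "\<epsilon> * (1 + 2 * K1 * (1 - 1 / 2 ^ k)) \<le> \<epsilon> * K" using \<epsilon> by (intro mult_left_mono) auto
    then show ?thesis unfolding mult.commute[of K] using bound[OF that, of k] by linarith
  qed
  show ?thesis
  proof (intro exI conjI allI impI)
    show "K > 0" "\<epsilon>0 > 0" by fact+
    fix \<epsilon> n k i and y :: "nat \<Rightarrow> real^'p"
    assume "0 < \<epsilon>" "\<epsilon> \<le> \<epsilon>0" "\<forall>i<n. norm (y i) \<le> \<epsilon> * (1 + norm (x i))" "i < n"
    then show "norm (bms \<tau> n y k i) \<le> K * \<epsilon> + \<epsilon> / 2 ^ k * norm (x i)" by (rule near)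
  qed
qed

definition tracks :: "(real^'p \<Rightarrow> real^'p) \<Rightarrow> (nat \<Rightarrow> nat \<Rightarrow> real^'p) \<Rightarrow> bool" where
  "tracks B y \<longleftrightarrow> (\<forall>\<eta>>0. \<forall>\<^sub>F n in sequentially. \<forall>i<n. norm (y n i - B (x i)) \<le> \<eta> * (1 + norm (x i)))"

section \<open>One step for distant points\<close>

text \<open>\<open>power2_norm_perturb_lower\<close> replaces \<open>yi - yj\<close> by
  \<open>B (xi - xj)\<close>, and \<open>min_energy_le\<close> bounds the latter through the minimal
  energy, \<open>q (xj - A xi)\<close> and \<open>q xj\<close>. The coefficient of
  \<open>q xj\<close> ends below 1/2, so that \<open>moment\<close> can sum it; the term in
  \<open>xj - A xi\<close> pays for the factor \<open>norm (xj - A xi)\<close> and still leaves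
  decay in \<open>\<rho>\<close>.\<close>

lemma tail_upper:
  assumes cm: "conditional_mean B A"
    and \<delta>: "0 < \<delta>" "\<delta> \<le> 1/2" and \<eta>: "\<eta> > 0"
    and \<kappa>: "15 * \<eta>\<^sup>2 / (2 * \<delta> * \<tau>\<^sup>2) \<le> \<kappa>" "\<kappa> \<le> a0 * \<delta> / 4"
    and y: "norm (yi - B xi) \<le> \<eta> * (1 + norm xi)" "norm (yj - B xj) \<le> \<eta> * (1 + norm xj)"
    and s: "norm xi \<ge> 1" and \<rho>: "\<rho> \<ge> 0" "norm (xj - A xi) > \<rho>"
    and b0': "min_energy B A xi \<le> b0'"
  shows "gauss_kernel \<tau> (yi - yj) * norm (xj - A xi) \<le>
    (1 + 8 / a0) * exp (\<delta> / 2 * b0' - (min_energy B A xi) / 2 - a0 * \<rho>\<^sup>2 / 8 + \<kappa> * (norm xi)\<^sup>2)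
     * exp ((1 - \<delta>/2) / 2 * q xj)"
proof -
  have linB: "linear B" using cm unfolding conditional_mean_def by blast
  define s where "s = norm xi"
  define t where "t = norm xj"
  define d where "d = norm (xj - A xi)"
  define u where "u = B (xi - xj)"
  define v where "v = yi - yj"
  define m where "m = min_energy B A xi"
  have "v - u = (yi - B xi) - (yj - B xj)"
    unfolding v_def u_def using linear_diff[OF linB] by (simp add: algebra_simps)
  then have "norm (v - u) = norm ((yi - B xi) - (yj - B xj))" by (rule arg_cong)
  then have "norm (v - u) \<le> \<eta> * (1 + s) + \<eta> * (1 + t)"
    unfolding s_def t_def using y norm_triangle_ineq4[of "yi - B xi" "yj - B xj"] by linarith
  also have "\<dots> = \<eta> * (2 + s + t)" by (simp add: algebra_simps)
  finally have "(norm (v - u))\<^sup>2 \<le> (\<eta> * (2 + s + t))\<^sup>2" by (intro power_mono) auto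
  also have "\<dots> = \<eta>\<^sup>2 * (2 + s + t)\<^sup>2" by (simp add: power_mult_distrib)
  \<comment> \<open>Since \<open>s \<ge> 1\<close>, the constant 12 is absorbed:
    \<open>12 + 3 * (s\<^sup>2 + t\<^sup>2)\<close> is at most
    \<open>15 * (s\<^sup>2 + t\<^sup>2)\<close>.\<close>
  also have "(2 + s + t)\<^sup>2 \<le> 15 * (s\<^sup>2 + t\<^sup>2)"
  proof -
    have "(2 + s + t)\<^sup>2 \<le> 3 * (4 + s\<^sup>2 + t\<^sup>2)"
      using zero_le_square[of "2 - s"] zero_le_square[of "2 - t"] zero_le_square[of "s - t"]
      by (simp add: power2_eq_square algebra_simps)
    also have "\<dots> \<le> 15 * (s\<^sup>2 + t\<^sup>2)"
    proof -
      have "1 \<le> s\<^sup>2" using s unfolding s_def by (rule one_le_power)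
      moreover have "t\<^sup>2 \<ge> 0" by simp
      ultimately have "1 + 0 \<le> s\<^sup>2 + t\<^sup>2" by (rule add_mono)
      then show ?thesis by (simp add: algebra_simps)
    qed
    finally show ?thesis .
  qed
  finally have vu: "(norm (v - u))\<^sup>2 \<le> \<eta>\<^sup>2 * (15 * (s\<^sup>2 + t\<^sup>2))" by (simp add: mult_left_mono)
  have "(norm (v - u))\<^sup>2 / \<delta> / (2 * \<tau>\<^sup>2) \<le> \<eta>\<^sup>2 * (15 * (s\<^sup>2 + t\<^sup>2)) / \<delta> / (2 * \<tau>\<^sup>2)"
    using vu \<delta> by (intro divide_right_mono) auto
  also have "\<dots> = (15 * \<eta>\<^sup>2 / (2 * \<delta> * \<tau>\<^sup>2)) * (s\<^sup>2 + t\<^sup>2)" by (simp add: field_simps)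
  also have "\<dots> \<le> \<kappa> * (s\<^sup>2 + t\<^sup>2)" using \<kappa> by (intro mult_right_mono) auto
  finally have e1: "(norm (v - u))\<^sup>2 / \<delta> / (2 * \<tau>\<^sup>2) \<le> \<kappa> * s\<^sup>2 + \<kappa> * t\<^sup>2" by (simp add: algebra_simps)
  define Q1 where "Q1 = q (xj - A xi)"
  define Q2 where "Q2 = q xj"
  \<comment> \<open>The coefficient of \<open>Q2\<close> is \<open>(1 - \<delta>) / 2\<close>, short
    of 1/2 by \<open>\<delta> / 2\<close>. Only half of this slack is spent on the
    perturbation.\<close>
  have "\<kappa> * t\<^sup>2 \<le> a0 * \<delta> / 4 * t\<^sup>2" using \<kappa> by (intro mult_right_mono) auto
  also have "\<dots> = \<delta> / 4 * (a0 * t\<^sup>2)" by simp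
  also have "\<dots> \<le> \<delta> / 4 * Q2" unfolding t_def Q2_def using \<delta> q_lower by (intro mult_left_mono) auto
  finally have e2: "\<kappa> * t\<^sup>2 \<le> \<delta> / 4 * Q2" .
  have "((1 - \<delta>) * (norm u)\<^sup>2 - (norm (v - u))\<^sup>2 / \<delta>) / (2 * \<tau>\<^sup>2) \<le> (norm v)\<^sup>2 / (2 * \<tau>\<^sup>2)"
    using \<delta> by (intro divide_right_mono power2_norm_perturb_lower) auto
  moreover have "((1 - \<delta>) * U - E) / (2 * T) = (1 - \<delta>) / 2 * (U / T) - E / (2 * T)" for U E T :: real
    by (subst diff_divide_distrib) simp
  ultimately have e3: "(1 - \<delta>) / 2 * ((norm u)\<^sup>2 / \<tau>\<^sup>2) - (norm (v - u))\<^sup>2 / \<delta> / (2 * \<tau>\<^sup>2) \<le> (norm v)\<^sup>2 / (2 * \<tau>\<^sup>2)"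
    by simp
  have "m + Q1 \<le> Q2 + (norm u)\<^sup>2 / \<tau>\<^sup>2"
    unfolding m_def u_def Q1_def Q2_def by (rule min_energy_le[OF cm])
  then have "(1 - \<delta>) / 2 * (m + Q1 - Q2) \<le> (1 - \<delta>) / 2 * ((norm u)\<^sup>2 / \<tau>\<^sup>2)"
    using \<delta> by (intro mult_left_mono) auto
  then have e3': "(1 - \<delta>) / 2 * m + (1 - \<delta>) / 2 * Q1 - (1 - \<delta>) / 2 * Q2 \<le> (1 - \<delta>) / 2 * ((norm u)\<^sup>2 / \<tau>\<^sup>2)"
    by (simp only: distrib_left right_diff_distrib)
  have e4: "- ((norm v)\<^sup>2 / (2 * \<tau>\<^sup>2)) \<le> - ((1 - \<delta>) / 2 * m) - (1 - \<delta>) / 2 * Q1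
     + ((1 - \<delta>) / 2 + \<delta> / 4) * Q2 + \<kappa> * s\<^sup>2"
    unfolding distrib_right using e1 e2 e3 e3' by linarith
  have i1: "(1 - \<delta>) / 2 * m = m / 2 - \<delta> / 2 * m" by (simp add: field_simps)
  have i2: "((1 - \<delta>) / 2 + \<delta> / 4) * Q2 = (1 - \<delta>/2) / 2 * Q2" by (simp add: field_simps)
  have "1/4 * (a0 * d\<^sup>2) \<le> (1 - \<delta>) / 2 * Q1"
    unfolding d_def Q1_def using \<delta> q_lower a0 by (intro mult_mono) auto
  moreover have "\<delta> / 2 * m \<le> \<delta> / 2 * b0'" using \<delta> b0' unfolding m_def by (intro mult_left_mono) auto
  ultimately have e5: "- ((norm v)\<^sup>2 / (2 * \<tau>\<^sup>2)) \<le> \<delta> / 2 * b0' - m / 2 - a0 * d\<^sup>2 / 4 + (1 - \<delta>/2) / 2 * Q2 + \<kappa> * s\<^sup>2"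
    using e4 i1 i2 by linarith
  \<comment> \<open>Half of the decay \<open>a0 * d\<^sup>2 / 4\<close> absorbs the factor
    \<open>d\<close>; the other half survives.\<close>
  have "gauss_kernel \<tau> v * d \<le> exp (\<delta> / 2 * b0' - m / 2 - a0 * d\<^sup>2 / 4 + (1 - \<delta>/2) / 2 * Q2 + \<kappa> * s\<^sup>2)
      * ((1 + 1 / (a0/8)) * exp (a0/8 * d\<^sup>2))"
    unfolding gauss_kernel_norm using e5 a0
    by (intro mult_mono exp_square_dominates_linear) (auto simp: d_def)
  also have "\<dots> = (1 + 8 / a0) * exp (\<delta> / 2 * b0' - m / 2 - a0 * d\<^sup>2 / 8 + (1 - \<delta>/2) / 2 * Q2 + \<kappa> * s\<^sup>2)"
  proof -
    have "(\<delta> / 2 * b0' - m / 2 - a0 * d\<^sup>2 / 4 + (1 - \<delta>/2) / 2 * Q2 + \<kappa> * s\<^sup>2) + a0/8 * d\<^sup>2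
        = \<delta> / 2 * b0' - m / 2 - a0 * d\<^sup>2 / 8 + (1 - \<delta>/2) / 2 * Q2 + \<kappa> * s\<^sup>2" by simp
    then have "exp (\<delta> / 2 * b0' - m / 2 - a0 * d\<^sup>2 / 4 + (1 - \<delta>/2) / 2 * Q2 + \<kappa> * s\<^sup>2) * exp (a0/8 * d\<^sup>2)
        = exp (\<delta> / 2 * b0' - m / 2 - a0 * d\<^sup>2 / 8 + (1 - \<delta>/2) / 2 * Q2 + \<kappa> * s\<^sup>2)"
      unfolding mult_exp_exp by (rule arg_cong)
    then show ?thesis by simp
  qed
  also have "\<dots> \<le> (1 + 8 / a0) * exp ((\<delta> / 2 * b0' - m / 2 - a0 * \<rho>\<^sup>2 / 8 + \<kappa> * s\<^sup>2) + (1 - \<delta>/2) / 2 * Q2)"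
  proof -
    have "a0 * \<rho>\<^sup>2 \<le> a0 * d\<^sup>2" using \<rho> a0 unfolding d_def by (intro mult_left_mono power_mono) auto
    then show ?thesis using a0 by (intro mult_left_mono) auto
  qed
  finally show ?thesis unfolding m_def d_def v_def s_def Q2_def exp_add by simp
qed

text \<open>Only the sample points close to \<open>A (x i)\<close> are kept. Their number
  contributes \<open>exp (- q (A (x i)) / 2)\<close> and their common kernel weight \<open>exp (-
  (norm (B (x i - A (x i))))\<^sup>2 / (2 * \<tau>\<^sup>2))\<close>; the product is the exponential
  of minus half the minimal energy, up to the relative errors in \<open>\<kappa>\<close>.\<close>

lemma tail_lower:
  assumes "linear B"
    and K: "K \<ge> 1" "\<And>u. norm (A u) \<le> K * norm u" "\<And>u. norm (B u) \<le> K * norm u"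
    and \<eta>: "0 < \<eta>" "\<eta> \<le> 1"
    and y: "\<And>j. j < n \<Longrightarrow> norm (y j - B (x j)) \<le> \<eta> * (1 + norm (x j))"
    and i: "i < n" and s: "norm (x i) \<ge> 1"
    and c0: "c0 \<ge> 0" and cnt: "c0 * real n * exp (- q (A (x i)) / 2 - \<eta> * (1 + (norm (A (x i)))\<^sup>2))
        \<le> real (card {j. j < n \<and> norm (x j - A (x i)) \<le> \<eta> * (1 + norm (A (x i)))})"
    and c: "c = 10 * K\<^sup>2 * \<eta>" and \<kappa>: "(4 * K\<^sup>2 * c + c\<^sup>2) / (2 * \<tau>\<^sup>2) + 2 * \<eta> * K\<^sup>2 \<le> \<kappa>"
  shows "c0 * real n * exp (- min_energy B A (x i) / 2 - \<kappa> * (norm (x i))\<^sup>2)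
    \<le> (\<Sum>j<n. gauss_kernel \<tau> (y i - y j))"
proof -
  define s where "s = norm (x i)"
  define z where "z = A (x i)"
  define b where "b = norm (B (x i - z))"
  define g where "g = (4 * K\<^sup>2 * c + c\<^sup>2) / (2 * \<tau>\<^sup>2)"
  define J where "J = {j. j < n \<and> norm (x j - z) \<le> \<eta> * (1 + norm z)}"
  have K2: "K \<le> K\<^sup>2" using K(1) by (simp add: power2_eq_square)
  have s1: "s \<ge> 1" using s unfolding s_def .
  have z: "norm z \<le> K * s" unfolding z_def s_def by (rule K)
  have Ks: "K * s \<ge> 1" using K(1) s1 mult_mono[of 1 K 1 s] by simp
  have z1: "1 + norm z \<le> 2 * K * s" using z Ks by simp
  have c_nonneg: "c \<ge> 0" unfolding c using \<eta> by simp
  have w: "exp (- b\<^sup>2 / (2 * \<tau>\<^sup>2) - g * s\<^sup>2) \<le> gauss_kernel \<tau> (y i - y j)" if j: "j \<in> J" for j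
  proof -
    have jn: "j < n" and jz: "norm (x j - z) \<le> \<eta> * (1 + norm z)" using j unfolding J_def by auto
    have jz': "norm (x j - z) \<le> \<eta> * (2 * K * s)"
      using jz z1 \<eta> by (auto elim!: order_trans intro!: mult_left_mono)
    have "\<eta> * (2 * K * s) \<le> 1 * (2 * K * s)" using \<eta> Ks by (intro mult_right_mono) auto
    then have xj: "norm (x j) \<le> 3 * K * s"
      using norm_triangle_ineq[of "x j - z" z] jz' z by simp
    have "y i - y j = B (x i - z) + (B (z - x j) + ((y i - B (x i)) - (y j - B (x j))))"
      using linear_diff[OF assms(1)] by (simp add: algebra_simps)
    then have "norm (y i - y j) = norm (B (x i - z) + (B (z - x j) + ((y i - B (x i)) - (y j - B (x j)))))"
      by (rule arg_cong)
    then have "norm (y i - y j) \<le> b + (norm (B (z - x j)) + (norm (y i - B (x i)) + norm (y j - B (x j))))"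
      unfolding b_def
      using norm_triangle_ineq[of "B (x i - z)" "B (z - x j) + ((y i - B (x i)) - (y j - B (x j)))"]
        norm_triangle_ineq[of "B (z - x j)" "(y i - B (x i)) - (y j - B (x j))"]
        norm_triangle_ineq4[of "y i - B (x i)" "y j - B (x j)"] by linarith
    also have "norm (B (z - x j)) \<le> K * (\<eta> * (2 * K * s))"
    proof -
      have "norm (B (z - x j)) \<le> K * norm (x j - z)" using K(3)[of "z - x j"] by (simp add: norm_minus_commute)
      also have "\<dots> \<le> K * (\<eta> * (2 * K * s))" using jz' K(1) by (intro mult_left_mono) auto
      finally show ?thesis .
    qed
    also have "norm (y i - B (x i)) \<le> \<eta> * (2 * K * s)"
    proof -
      have "s \<le> K * s" using K(1) s1 by (simp add: mult_le_cancel_right1)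
      then have "1 + s \<le> 2 * K * s" using s1 by linarith
      then show ?thesis using y[OF i] \<eta> unfolding s_def by (auto elim!: order_trans intro!: mult_left_mono)
    qed
    also have "norm (y j - B (x j)) \<le> \<eta> * (4 * K * s)"
    proof -
      have "1 + norm (x j) \<le> 4 * K * s" using xj Ks by linarith
      then show ?thesis using y[OF jn] \<eta> by (auto elim!: order_trans intro!: mult_left_mono)
    qed
    \<comment> \<open>Three errors are collected in \<open>c\<close>: the radius of the cluster
      after applying \<open>B\<close>, and the tolerances at \<open>x i\<close> and at
      \<open>x j\<close>.\<close>
    also have "b + (K * (\<eta> * (2 * K * s)) + (\<eta> * (2 * K * s) + \<eta> * (4 * K * s)))
        = b + (2 * K\<^sup>2 + 6 * K) * (\<eta> * s)"
      by (simp add: algebra_simps power2_eq_square)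
    also have "\<dots> \<le> b + (10 * K\<^sup>2) * (\<eta> * s)"
    proof (intro add_left_mono mult_right_mono)
      show "2 * K\<^sup>2 + 6 * K \<le> 10 * K\<^sup>2" using K2 zero_le_power2[of K] by linarith
    qed (use \<eta> s1 in auto)
    also have "\<dots> = b + c * s" unfolding c by simp
    finally have "(norm (y i - y j))\<^sup>2 \<le> (b + c * s)\<^sup>2" by (intro power_mono) auto
    also have "\<dots> = b\<^sup>2 + 2 * b * (c * s) + c\<^sup>2 * s\<^sup>2" by (simp add: power2_eq_square algebra_simps)
    also have "\<dots> \<le> b\<^sup>2 + 2 * (2 * K\<^sup>2 * s) * (c * s) + c\<^sup>2 * s\<^sup>2"
    proof -
      have "b \<le> K * norm (x i - z)" unfolding b_def by (rule K)
      also have "norm (x i - z) \<le> s + K * s" using z norm_triangle_ineq4[of "x i" z] unfolding s_def by simp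
      also have "s + K * s \<le> 2 * K * s" using K(1) s1 by (simp add: mult_le_cancel_right1)
      finally have "b \<le> 2 * K\<^sup>2 * s" using K(1) by (simp add: power2_eq_square)
      then show ?thesis using c_nonneg s1 by (intro add_right_mono add_left_mono mult_right_mono) (auto simp: ac_simps)
    qed
    also have "\<dots> = b\<^sup>2 + (4 * K\<^sup>2 * c + c\<^sup>2) * s\<^sup>2" by (simp add: power2_eq_square algebra_simps)
    finally have "(norm (y i - y j))\<^sup>2 / (2 * \<tau>\<^sup>2) \<le> (b\<^sup>2 + (4 * K\<^sup>2 * c + c\<^sup>2) * s\<^sup>2) / (2 * \<tau>\<^sup>2)"
      by (intro divide_right_mono) auto
    also have "\<dots> = b\<^sup>2 / (2 * \<tau>\<^sup>2) + g * s\<^sup>2"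
      unfolding g_def using tau by (simp add: field_simps)
    finally show ?thesis unfolding gauss_kernel_norm exp_le_cancel_iff by linarith
  qed
  have "- min_energy B A (x i) / 2 - \<kappa> * s\<^sup>2
     \<le> (- q z / 2 - \<eta> * (1 + (norm z)\<^sup>2)) + (- b\<^sup>2 / (2 * \<tau>\<^sup>2) - g * s\<^sup>2)"
  proof -
    have "\<eta> * (1 + (norm z)\<^sup>2) \<le> \<eta> * (2 * K\<^sup>2 * s\<^sup>2)"
    proof (intro mult_left_mono)
      have "(norm z)\<^sup>2 \<le> (K * s)\<^sup>2" using z by (intro power_mono) auto
      moreover have "1\<^sup>2 \<le> (K * s)\<^sup>2" using Ks by (intro power_mono) auto
      ultimately show "1 + (norm z)\<^sup>2 \<le> 2 * K\<^sup>2 * s\<^sup>2" by (simp add: power_mult_distrib)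
    qed (use \<eta> in auto)
    moreover have "(g + 2 * \<eta> * K\<^sup>2) * s\<^sup>2 \<le> \<kappa> * s\<^sup>2"
      using \<kappa> unfolding g_def by (intro mult_right_mono) auto
    then have "g * s\<^sup>2 + \<eta> * (2 * K\<^sup>2 * s\<^sup>2) \<le> \<kappa> * s\<^sup>2" by (simp add: algebra_simps)
    moreover have "- min_energy B A (x i) / 2 = - q z / 2 + - b\<^sup>2 / (2 * \<tau>\<^sup>2)"
      unfolding min_energy_def z_def b_def by (simp add: add_divide_distrib)
    ultimately show ?thesis by linarith
  qed
  then have "c0 * real n * exp (- min_energy B A (x i) / 2 - \<kappa> * s\<^sup>2)
     \<le> c0 * real n * (exp (- q z / 2 - \<eta> * (1 + (norm z)\<^sup>2)) * exp (- b\<^sup>2 / (2 * \<tau>\<^sup>2) - g * s\<^sup>2))"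
    unfolding mult_exp_exp using c0 by (intro mult_left_mono) auto
  also have "\<dots> \<le> real (card J) * exp (- b\<^sup>2 / (2 * \<tau>\<^sup>2) - g * s\<^sup>2)"
  proof -
    have "c0 * real n * exp (- q z / 2 - \<eta> * (1 + (norm z)\<^sup>2)) \<le> real (card J)"
      using cnt unfolding J_def z_def .
    then show ?thesis unfolding mult.assoc[symmetric, of "c0 * real n"] by (rule mult_right_mono) simp
  qed
  also have "\<dots> = (\<Sum>j\<in>J. exp (- b\<^sup>2 / (2 * \<tau>\<^sup>2) - g * s\<^sup>2))" by simp
  also have "\<dots> \<le> (\<Sum>j\<in>J. gauss_kernel \<tau> (y i - y j))" by (intro sum_mono w)
  also have "\<dots> \<le> (\<Sum>j<n. gauss_kernel \<tau> (y i - y j))"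
    by (rule sum_mono2) (auto simp: J_def)
  finally show ?thesis unfolding s_def .
qed

text \<open>Points within \<open>\<rho> = e * s / 2\<close> of \<open>A (x i)\<close> contribute at
  most \<open>\<rho>\<close> to the mean. For the others, \<open>tail_upper\<close> is divided by
  \<open>tail_lower\<close>: the minimal energy cancels, and what remains is a negative multiple of
  \<open>s\<^sup>2\<close> in the exponent, which beats any constant once
  \<open>s \<ge> r\<close>.\<close>

lemma tail_step:
  assumes cm: "conditional_mean B A" and lam: "0 \<le> l" "l < 1" "\<And>u. min_energy B A u \<le> l * q u"
    and e: "e > 0"
  shows "\<exists>r\<ge>1. \<exists>\<eta>>0. \<forall>\<^sub>F n in sequentially. \<forall>i<n. \<forall>y. norm (x i) \<ge> r \<longrightarrow>
    (\<forall>j<n. norm (y j - B (x j)) \<le> \<eta> * (1 + norm (x j))) \<longrightarrow>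
    kmean \<tau> n y i (\<lambda>j. norm (x j - A (x i))) \<le> e * norm (x i)"
proof -
  have lin: "linear B" "linear A" using cm unfolding conditional_mean_def by auto
  obtain K where K: "K \<ge> 1" and KA: "\<And>u. norm (A u) \<le> K * norm u" and KB: "\<And>u. norm (B u) \<le> K * norm u"
    using linear_common_norm_bound[OF lin(2,1)] by blast
  \<comment> \<open>With \<open>\<rho> = e * s / 2\<close> the gain
    \<open>a0 * \<rho>\<^sup>2 / 8\<close> equals \<open>2 * g * s\<^sup>2\<close>. The three
    losses, from \<open>\<delta>\<close>, from \<open>\<kappa>\<close> and from the lower bound for
    \<open>D\<close>, are each at most \<open>g / 4 * s\<^sup>2\<close>, so a factor
    \<open>exp (- (g * s\<^sup>2))\<close> is left.\<close>
  define g where "g = a0 * e\<^sup>2 / 64"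
  have g: "g > 0" unfolding g_def using a0 e by simp
  define \<delta> where "\<delta> = min (1/2) (g / (2 * (b0 + 1)))"
  have \<delta>: "0 < \<delta>" "\<delta> \<le> 1/2"
    using g b0_nonneg unfolding \<delta>_def by (simp_all only: min.cobounded1) simp
  have \<delta>b: "\<delta> / 2 * b0 \<le> g / 4"
  proof -
    have "\<delta> * b0 \<le> g / (2 * (b0 + 1)) * (b0 + 1)"
      unfolding \<delta>_def using b0_nonneg g by (intro mult_mono) auto
    also have "\<dots> = g / 2" using b0_nonneg by (simp add: field_simps)
    finally show ?thesis by simp
  qed
  define \<kappa> where "\<kappa> = min (g / 4) (a0 * \<delta> / 4)"
  have \<kappa>: "\<kappa> > 0" "\<kappa> \<le> g / 4" "\<kappa> \<le> a0 * \<delta> / 4" unfolding \<kappa>_def using g a0 \<delta> by auto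
  have "\<forall>\<^sub>F \<eta> in at_right 0. 15 * \<eta>\<^sup>2 / (2 * \<delta> * \<tau>\<^sup>2) < \<kappa>"
  proof (rule order_tendstoD(2))
    show "((\<lambda>\<eta>. 15 * \<eta>\<^sup>2 / (2 * \<delta> * \<tau>\<^sup>2)) \<longlongrightarrow> 15 * 0\<^sup>2 / (2 * \<delta> * \<tau>\<^sup>2)) (at_right 0)"
      using \<delta> tau by (intro tendsto_intros) auto
  qed (use \<kappa> in simp)
  moreover have "\<forall>\<^sub>F \<eta> in at_right 0.
      (4 * K\<^sup>2 * (10 * K\<^sup>2 * \<eta>) + (10 * K\<^sup>2 * \<eta>)\<^sup>2) / (2 * \<tau>\<^sup>2) + 2 * \<eta> * K\<^sup>2 < g / 4"
  proof (rule order_tendstoD(2))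
    show "((\<lambda>\<eta>. (4 * K\<^sup>2 * (10 * K\<^sup>2 * \<eta>) + (10 * K\<^sup>2 * \<eta>)\<^sup>2) / (2 * \<tau>\<^sup>2) + 2 * \<eta> * K\<^sup>2) \<longlongrightarrow>
       (4 * K\<^sup>2 * (10 * K\<^sup>2 * 0) + (10 * K\<^sup>2 * 0)\<^sup>2) / (2 * \<tau>\<^sup>2) + 2 * 0 * K\<^sup>2) (at_right 0)"
      using tau by (intro tendsto_intros) auto
  qed (use g in simp)
  moreover have "\<forall>\<^sub>F \<eta> in at_right 0. \<eta> < (1 - l) / 2"
    using lam by (intro eventually_at_right_less[THEN eventually_mono] order_tendstoD(2)[OF tendsto_ident_at]) auto
  moreover have "\<forall>\<^sub>F \<eta> in at_right (0::real). \<eta> > 0" by (rule eventually_at_right_less)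
  ultimately have "\<forall>\<^sub>F \<eta> in at_right 0. 15 * \<eta>\<^sup>2 / (2 * \<delta> * \<tau>\<^sup>2) < \<kappa> \<and>
      (4 * K\<^sup>2 * (10 * K\<^sup>2 * \<eta>) + (10 * K\<^sup>2 * \<eta>)\<^sup>2) / (2 * \<tau>\<^sup>2) + 2 * \<eta> * K\<^sup>2 < g / 4 \<and>
      \<eta> < (1 - l) / 2 \<and> \<eta> > 0"
    by eventually_elim auto
  then obtain \<eta> where \<eta>: "15 * \<eta>\<^sup>2 / (2 * \<delta> * \<tau>\<^sup>2) < \<kappa>"
      "(4 * K\<^sup>2 * (10 * K\<^sup>2 * \<eta>) + (10 * K\<^sup>2 * \<eta>)\<^sup>2) / (2 * \<tau>\<^sup>2) + 2 * \<eta> * K\<^sup>2 < g / 4"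
      "\<eta> < (1 - l) / 2" "\<eta> > 0"
    using eventually_happens'[OF trivial_limit_at_right_real] by blast
  have \<eta>1: "\<eta> \<le> 1" using \<eta>(3) lam(1) by (simp add: field_simps)
  obtain C where C: "\<And>n. (\<Sum>j<n. exp ((1 - \<delta>/2) / 2 * q (x j))) \<le> C * real n"
    using moment[of "\<delta>/2"] \<delta> by auto
  obtain c0 where c0: "c0 > 0" and dense0: "\<forall>\<^sub>F n in sequentially. \<forall>z. q z \<le> (1 - \<eta>) * (2 * ln (real n)) \<longrightarrow>
      c0 * real n * exp (- q z / 2 - \<eta> * (1 + (norm z)\<^sup>2))
        \<le> real (card {j. j < n \<and> norm (x j - z) \<le> \<eta> * (1 + norm z)})"
    using dense[OF \<eta>(4)] by blast
  define C' where "C' = (\<bar>C\<bar> + 1) * (1 + 8 / a0) / c0"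
  have C': "C' > 0" unfolding C'_def using a0 c0 by (intro divide_pos_pos mult_pos_pos) (auto intro: add_pos_pos add_nonneg_pos)
  \<comment> \<open>Chosen so that \<open>s \<ge> r\<close> gives
    \<open>C' / (g * s\<^sup>2) \<le> \<rho>\<close>, which suffices because
    \<open>exp (- (g * s\<^sup>2)) \<le> 1 / (g * s\<^sup>2)\<close>.\<close>
  define r where "r = 1 + 2 * C' / (g * e)"
  have r: "r \<ge> 1" unfolding r_def using C' g e by simp
  \<comment> \<open>\<open>c\<close> lies halfway between \<open>l\<close> and 1:
    \<open>l \<le> c * c\<close>, where one factor \<open>c\<close> is used up by
    \<open>max_q_bound\<close> and the other is at most \<open>1 - \<eta>\<close>. This puts
    \<open>A (x i)\<close> into the range of \<open>dense\<close>.\<close>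
  define c where "c = (1 + l) / 2"
  have c: "c < 1" "c \<ge> 0" unfolding c_def using lam by auto
  have "\<forall>\<^sub>F n in sequentially. \<forall>i<n. \<forall>y. norm (x i) \<ge> r \<longrightarrow>
    (\<forall>j<n. norm (y j - B (x j)) \<le> \<eta> * (1 + norm (x j))) \<longrightarrow>
    kmean \<tau> n y i (\<lambda>j. norm (x j - A (x i))) \<le> e * norm (x i)"
    using max_q_bound[OF c(1)] dense0
  proof eventually_elim
    case (elim n)
    show ?case
    proof (intro allI impI)
      fix i y assume i: "i < n" and xi: "norm (x i) \<ge> r"
        and y: "\<forall>j<n. norm (y j - B (x j)) \<le> \<eta> * (1 + norm (x j))"
      define s where "s = norm (x i)"
      define m where "m = min_energy B A (x i)"
      define z where "z = A (x i)"
      define D where "D = (\<Sum>j<n. gauss_kernel \<tau> (y i - y j))"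
      define \<rho> where "\<rho> = e * s / 2"
      have n: "n > 0" using i by simp
      have s1: "s \<ge> 1" using xi r unfolding s_def by simp
      have \<rho>: "\<rho> \<ge> 0" unfolding \<rho>_def using e s1 by simp
      have qz: "q z \<le> m"
        unfolding m_def min_energy_def z_def by simp
      have m_le: "m \<le> l * q (x i)" unfolding m_def by (rule lam)
      have "l \<le> c * c" unfolding c_def using zero_le_square[of "1 - l"] by (simp add: field_simps)
      then have "l * q (x i) \<le> c * c * q (x i)" using q_nonneg by (intro mult_right_mono) auto
      also have "\<dots> = c * (c * q (x i))" by simp
      also have "\<dots> \<le> (1 - \<eta>) * (2 * ln (real n))"
      proof (rule mult_mono)
        show "c \<le> 1 - \<eta>" unfolding c_def using \<eta>(3) by (simp add: field_simps)
        show "c * q (x i) \<le> 2 * ln (real n)" using elim(1) i by blast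
        show "0 \<le> 1 - \<eta>" using \<eta>1 by simp
        show "0 \<le> c * q (x i)" using c q_nonneg by (intro mult_nonneg_nonneg)
      qed
      finally have qz': "q z \<le> (1 - \<eta>) * (2 * ln (real n))" using qz m_le by linarith
      have D: "c0 * real n * exp (- m / 2 - g / 4 * s\<^sup>2) \<le> D"
        unfolding m_def s_def D_def
      proof (rule tail_lower[OF lin(1) K KA KB \<eta>(4) \<eta>1 _ i])
        show "norm (y j - B (x j)) \<le> \<eta> * (1 + norm (x j))" if "j < n" for j using y that by blast
        show "1 \<le> norm (x i)" using s1 unfolding s_def .
        show "c0 * real n * exp (- q (A (x i)) / 2 - \<eta> * (1 + (norm (A (x i)))\<^sup>2))
          \<le> real (card {j. j < n \<and> norm (x j - A (x i)) \<le> \<eta> * (1 + norm (A (x i)))})"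
          using elim(2) qz' unfolding z_def by blast
      qed (use \<eta>(2) c0 in auto)
      define U where "U = (1 + 8 / a0) * exp (\<delta> / 2 * (b0 * s\<^sup>2) - m / 2 - a0 * \<rho>\<^sup>2 / 8 + \<kappa> * s\<^sup>2)"
      have U0: "U \<ge> 0" unfolding U_def using a0 by simp
      have m_le_b0: "m \<le> b0 * s\<^sup>2"
      proof -
        have "l * q (x i) \<le> 1 * q (x i)" using lam q_nonneg by (intro mult_right_mono) auto
        then show ?thesis using m_le q_upper[of "x i"] unfolding s_def by linarith
      qed
      have "(\<Sum>j<n. gauss_kernel \<tau> (y i - y j) * norm (x j - z))
         \<le> (\<Sum>j<n. gauss_kernel \<tau> (y i - y j) * \<rho> + U * exp ((1 - \<delta>/2) / 2 * q (x j)))"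
      proof (intro sum_mono)
        fix j assume "j \<in> {..<n}"
        then have j: "j < n" by simp
        show "gauss_kernel \<tau> (y i - y j) * norm (x j - z)
          \<le> gauss_kernel \<tau> (y i - y j) * \<rho> + U * exp ((1 - \<delta>/2) / 2 * q (x j))"
        proof (cases "norm (x j - z) \<le> \<rho>")
          case True
          then have "gauss_kernel \<tau> (y i - y j) * norm (x j - z) \<le> gauss_kernel \<tau> (y i - y j) * \<rho>"
            by (intro mult_left_mono) auto
          moreover have "0 \<le> U * exp ((1 - \<delta>/2) / 2 * q (x j))" using U0 by simp
          ultimately show ?thesis by linarith
        next
          case False
          have "gauss_kernel \<tau> (y i - y j) * norm (x j - A (x i)) \<le>
            (1 + 8 / a0) * exp (\<delta> / 2 * (b0 * s\<^sup>2) - (min_energy B A (x i)) / 2 - a0 * \<rho>\<^sup>2 / 8 + \<kappa> * (norm (x i))\<^sup>2)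
             * exp ((1 - \<delta>/2) / 2 * q (x j))"
          proof (rule tail_upper[OF cm \<delta> \<eta>(4) _ \<kappa>(3)])
            show "15 * \<eta>\<^sup>2 / (2 * \<delta> * \<tau>\<^sup>2) \<le> \<kappa>" using \<eta>(1) by simp
            show "norm (y i - B (x i)) \<le> \<eta> * (1 + norm (x i))" using y i by blast
            show "norm (y j - B (x j)) \<le> \<eta> * (1 + norm (x j))" using y j by blast
            show "1 \<le> norm (x i)" using s1 unfolding s_def .
            show "norm (x j - A (x i)) > \<rho>" using False unfolding z_def by simp
            show "min_energy B A (x i) \<le> b0 * s\<^sup>2" using m_le_b0 unfolding m_def .
          qed (rule \<rho>)
          then have "gauss_kernel \<tau> (y i - y j) * norm (x j - z) \<le> U * exp ((1 - \<delta>/2) / 2 * q (x j))"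
            unfolding U_def m_def s_def z_def .
          moreover have "0 \<le> gauss_kernel \<tau> (y i - y j) * \<rho>" using \<rho> by simp
          ultimately show ?thesis by linarith
        qed
      qed
      also have "\<dots> = \<rho> * D + U * (\<Sum>j<n. exp ((1 - \<delta>/2) / 2 * q (x j)))"
        unfolding D_def by (simp only: sum.distrib sum_distrib_left sum_distrib_right mult.commute)
      also have "\<dots> \<le> \<rho> * D + U * ((\<bar>C\<bar> + 1) * real n)"
      proof -
        have "C * real n \<le> (\<bar>C\<bar> + 1) * real n" by (intro mult_right_mono) auto
        then have "(\<Sum>j<n. exp ((1 - \<delta>/2) / 2 * q (x j))) \<le> (\<bar>C\<bar> + 1) * real n" using C[of n] by linarith
        then show ?thesis using U0 by (intro add_left_mono mult_left_mono)
      qed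
      also have "U * ((\<bar>C\<bar> + 1) * real n) \<le> \<rho> * D"
      proof -
        have "a0 * \<rho>\<^sup>2 / 8 = 2 * g * s\<^sup>2" unfolding \<rho>_def g_def by (simp add: power_mult_distrib power_divide)
        moreover have "\<delta> / 2 * (b0 * s\<^sup>2) \<le> g / 4 * s\<^sup>2"
          using mult_right_mono[OF \<delta>b, of "s\<^sup>2"] by (simp add: mult.assoc)
        moreover have "\<kappa> * s\<^sup>2 \<le> g / 4 * s\<^sup>2" using \<kappa> by (intro mult_right_mono) auto
        moreover have "0 \<le> g * s\<^sup>2" using g by simp
        ultimately have "\<delta> / 2 * (b0 * s\<^sup>2) - m / 2 - a0 * \<rho>\<^sup>2 / 8 + \<kappa> * s\<^sup>2 \<le> (- m / 2 - g / 4 * s\<^sup>2) + (- (g * s\<^sup>2))"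
          by linarith
        then have "U \<le> (1 + 8 / a0) * (exp (- m / 2 - g / 4 * s\<^sup>2) * exp (- (g * s\<^sup>2)))"
          unfolding U_def mult_exp_exp using a0 by (intro mult_left_mono) auto
        then have "U * ((\<bar>C\<bar> + 1) * real n) \<le> (1 + 8 / a0) * (exp (- m / 2 - g / 4 * s\<^sup>2) * exp (- (g * s\<^sup>2))) * ((\<bar>C\<bar> + 1) * real n)"
          by (rule mult_right_mono) simp
        also have "\<dots> = C' * exp (- (g * s\<^sup>2)) * (c0 * real n * exp (- m / 2 - g / 4 * s\<^sup>2))"
          unfolding C'_def using c0 by simp
        also have "\<dots> \<le> C' * exp (- (g * s\<^sup>2)) * D"
          using C' by (intro mult_left_mono D) simp
        also have "\<dots> \<le> \<rho> * D"
        proof (rule mult_right_mono)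
          have "g * s\<^sup>2 \<le> exp (g * s\<^sup>2)" using exp_ge_add_one_self[of "g * s\<^sup>2"] by linarith
          moreover have gs: "g * s\<^sup>2 > 0" using g s1 by simp
          ultimately have "exp (- (g * s\<^sup>2)) \<le> 1 / (g * s\<^sup>2)"
            unfolding exp_minus inverse_eq_divide by (intro divide_left_mono) (auto intro: mult_pos_pos)
          then have "C' * exp (- (g * s\<^sup>2)) \<le> C' * (1 / (g * s\<^sup>2))" using C' by (intro mult_left_mono) auto
          also have "\<dots> \<le> \<rho>"
          proof -
            have "2 * C' / (g * e) \<le> s" using xi unfolding r_def s_def by linarith
            then have "2 * C' \<le> s * (g * e)" using g e by (simp add: divide_le_eq)
            also have "\<dots> \<le> s ^ 3 * (g * e)"
              using s1 g e power_increasing[of 1 3 s] by (intro mult_right_mono) auto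
            finally have "C' \<le> \<rho> * (g * s\<^sup>2)" unfolding \<rho>_def by (simp add: power2_eq_square power3_eq_cube ac_simps)
            then show ?thesis using gs by (simp add: divide_le_eq)
          qed
          finally show "C' * exp (- (g * s\<^sup>2)) \<le> \<rho>" .
          show "0 \<le> D" unfolding D_def by (intro sum_nonneg) simp
        qed
        finally show ?thesis .
      qed
      finally have "(\<Sum>j<n. gauss_kernel \<tau> (y i - y j) * norm (x j - z)) \<le> (e * s) * D"
        unfolding \<rho>_def by (simp add: ac_simps)
      then show "kmean \<tau> n y i (\<lambda>j. norm (x j - A (x i))) \<le> e * norm (x i)"
        unfolding kmean_le_iff[OF n] D_def s_def z_def .
    qed
  qed
  then show ?thesis using r \<eta>(4) by blast
qed

section \<open>One step for points in a bounded region\<close>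

text \<open>The summands are Lipschitz in \<open>u\<close> on bounded sets, with a constant growing
  like \<open>(1 + norm (x j)) ^ 3\<close>, whose average is bounded by \<open>cubic_moment\<close>.
  Pointwise convergence on a finite net taken from the dense set \<open>E\<close> therefore gives
  uniformity.\<close>

lemma centered_sums_uniform:
  assumes lin: "linear B" "linear A" and r: "r \<ge> 0" and \<zeta>: "\<zeta> > 0"
    and E: "closure E = UNIV"
    and conv: "\<And>u. u \<in> E \<Longrightarrow>
      (\<lambda>n. (\<Sum>j<n. gauss_kernel \<tau> (B (u - x j)) *\<^sub>R (x j - A u)) /\<^sub>R real n) \<longlonglongrightarrow> 0"
  shows "\<forall>\<^sub>F n in sequentially. \<forall>u. norm u \<le> r \<longrightarrow>
    norm (\<Sum>j<n. gauss_kernel \<tau> (B (u - x j)) *\<^sub>R (x j - A u)) \<le> \<zeta> * real n"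
proof -
  obtain K where K: "K \<ge> 1" and KA: "\<And>u. norm (A u) \<le> K * norm u" and KB: "\<And>u. norm (B u) \<le> K * norm u"
    using linear_common_norm_bound[OF lin(2,1)] by blast
  \<comment> \<open>The net points come from \<open>E\<close> and may lie outside the ball of radius
    \<open>r\<close>, but by at most \<open>d \<le> 1\<close>.\<close>
  define R where "R = r + 1"
  have R: "R \<ge> 1" unfolding R_def using r by simp
  define G where "G u v = gauss_kernel \<tau> (B (u - v)) *\<^sub>R (v - A u)" for u v
  define L where "L = K ^ 3 * R\<^sup>2 / \<tau>\<^sup>2 + K"
  have L: "L > 0" unfolding L_def using K R by (intro add_nonneg_pos) auto
  have lip: "norm (G u v - G u' v) \<le> norm (u - u') * (L * (1 + norm v) ^ 3)"
    if u: "norm u \<le> R" "norm u' \<le> R" for u u' v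
  proof -
    define t where "t = norm v"
    have t: "t \<ge> 0" unfolding t_def by simp
    have Rt: "R + t \<le> R * (1 + t)" using mult_right_mono[OF R t] by (simp add: algebra_simps)
    have B1: "norm (B (w - v)) \<le> K * (R * (1 + t))" if "norm w \<le> R" for w
    proof -
      have "norm (B (w - v)) \<le> K * norm (w - v)" by (rule KB)
      also have "norm (w - v) \<le> R * (1 + t)"
        using norm_triangle_ineq4[of w v] that Rt unfolding t_def by linarith
      finally show ?thesis using K by simp
    qed
    have A1: "norm (v - A u) \<le> K * (R * (1 + t))"
    proof -
      have "norm (v - A u) \<le> t + K * norm u" using norm_triangle_ineq4[of v "A u"] KA[of u] unfolding t_def by linarith
      also have "\<dots> \<le> K * t + K * R"
        using u K mult_right_mono[OF K t] by (intro add_mono mult_left_mono) auto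
      also have "\<dots> = K * (R + t)" by (simp add: algebra_simps)
      also have "\<dots> \<le> K * (R * (1 + t))" using Rt K by (intro mult_left_mono) auto
      finally show ?thesis .
    qed
    have g1: "\<bar>gauss_kernel \<tau> (B (u - v)) - gauss_kernel \<tau> (B (u' - v))\<bar> \<le> norm (u - u') * (K\<^sup>2 * R * (1 + t) / \<tau>\<^sup>2)"
    proof -
      have "B (u - v) - B (u' - v) = B (u - u')" by (simp add: linear_diff[OF lin(1)])
      then have "norm (B (u - v) - B (u' - v)) = norm (B (u - u'))" by (rule arg_cong)
      also have "\<dots> \<le> K * norm (u - u')" by (rule KB)
      finally have "norm (B (u - v) - B (u' - v)) * (norm (B (u - v)) + norm (B (u' - v)))
          \<le> (K * norm (u - u')) * (K * (R * (1 + t)) + K * (R * (1 + t)))"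
        using K u by (intro mult_mono add_mono B1) auto
      then have "norm (B (u - v) - B (u' - v)) * (norm (B (u - v)) + norm (B (u' - v))) / (2 * \<tau>\<^sup>2)
          \<le> (K * norm (u - u')) * (K * (R * (1 + t)) + K * (R * (1 + t))) / (2 * \<tau>\<^sup>2)"
        by (rule divide_right_mono) simp
      also have "\<dots> = norm (u - u') * (K\<^sup>2 * R * (1 + t) / \<tau>\<^sup>2)" by (simp add: power2_eq_square)
      finally show ?thesis using gauss_kernel_lipschitz[of \<tau> "B (u - v)" "B (u' - v)"] by linarith
    qed
    have "G u v - G u' v = (gauss_kernel \<tau> (B (u - v)) - gauss_kernel \<tau> (B (u' - v))) *\<^sub>R (v - A u)
        + gauss_kernel \<tau> (B (u' - v)) *\<^sub>R (A u' - A u)"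
      unfolding G_def by (simp add: algebra_simps)
    then have "norm (G u v - G u' v) \<le> \<bar>gauss_kernel \<tau> (B (u - v)) - gauss_kernel \<tau> (B (u' - v))\<bar> * norm (v - A u)
        + gauss_kernel \<tau> (B (u' - v)) * norm (A u' - A u)"
      by (metis norm_triangle_ineq norm_scaleR abs_of_nonneg gauss_kernel_nonneg)
    also have "\<dots> \<le> norm (u - u') * (K\<^sup>2 * R * (1 + t) / \<tau>\<^sup>2) * (K * (R * (1 + t))) + 1 * (K * norm (u - u'))"
    proof (intro add_mono mult_mono g1 A1 gauss_kernel_le_1)
      have "A u' - A u = A (u' - u)" using linear_diff[OF lin(2)] by simp
      then show "norm (A u' - A u) \<le> K * norm (u - u')" using KA[of "u' - u"] by (simp add: norm_minus_commute)
    qed (use K R t in auto)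
    also have "\<dots> = norm (u - u') * (K ^ 3 * R\<^sup>2 / \<tau>\<^sup>2 * (1 + t)\<^sup>2 + K * 1)"
      by (simp add: power2_eq_square power3_eq_cube algebra_simps)
    also have "\<dots> \<le> norm (u - u') * (K ^ 3 * R\<^sup>2 / \<tau>\<^sup>2 * (1 + t) ^ 3 + K * (1 + t) ^ 3)"
      using K t by (intro mult_left_mono add_mono power_increasing one_le_power) auto
    also have "\<dots> = norm (u - u') * (L * (1 + t) ^ 3)" unfolding L_def by (simp add: algebra_simps)
    finally show ?thesis unfolding t_def .
  qed
  obtain C where C: "C > 0" "\<And>n. (\<Sum>j<n. (1 + norm (x j)) ^ 3) \<le> C * real n" using cubic_moment by blast
  define d where "d = min 1 (\<zeta> / (2 * L * C))"
  have d: "d > 0" "d \<le> 1" unfolding d_def using \<zeta> L C by auto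
  have dL: "d * (L * C) \<le> \<zeta> / 2"
  proof -
    have "d * (L * C) \<le> \<zeta> / (2 * L * C) * (L * C)" unfolding d_def using L C by (intro mult_right_mono) auto
    also have "\<dots> = \<zeta> / 2" using L C by simp
    finally show ?thesis .
  qed
  have "cball 0 r \<subseteq> (\<Union>u\<in>E. ball u d)"
  proof
    fix v :: "real^'p"
    have "v \<in> closure E" using E by simp
    then obtain u where "u \<in> E" "dist u v < d" using d closure_approachable by blast
    then show "v \<in> (\<Union>u\<in>E. ball u d)" by auto
  qed
  then obtain F where F: "F \<subseteq> E" "finite F" "cball 0 r \<subseteq> (\<Union>u\<in>F. ball u d)"
    using compactE_image[OF compact_cball[of 0 r], of E "\<lambda>u. ball u d"] by auto
  have "\<forall>\<^sub>F n in sequentially. \<forall>u\<in>F. norm ((\<Sum>j<n. G u (x j)) /\<^sub>R real n) < \<zeta> / 2"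
  proof (rule eventually_ball_finite[OF F(2)], rule ballI)
    fix u assume "u \<in> F"
    then have "(\<lambda>n. (\<Sum>j<n. G u (x j)) /\<^sub>R real n) \<longlonglongrightarrow> 0" unfolding G_def using F(1) conv by blast
    from tendstoD[OF this, of "\<zeta> / 2"] \<zeta> show "\<forall>\<^sub>F n in sequentially. norm ((\<Sum>j<n. G u (x j)) /\<^sub>R real n) < \<zeta> / 2"
      by (simp add: dist_norm)
  qed
  then show ?thesis using eventually_gt_at_top[of 0]
  proof eventually_elim
    case (elim n)
    show ?case
    proof (intro allI impI)
      fix u :: "real^'p" assume u: "norm u \<le> r"
      then have "u \<in> cball 0 r" by simp
      then obtain u' where u': "u' \<in> F" "dist u' u < d" using F(3) by auto
      have nu: "norm (u - u') \<le> d" using u'(2) by (simp add: dist_norm norm_minus_commute)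
      have "norm u' \<le> norm u + norm (u - u')" using norm_triangle_ineq4[of u "u - u'"] by simp
      then have u'R: "norm u' \<le> R" using nu u d unfolding R_def by linarith
      have uR: "norm u \<le> R" using u unfolding R_def by linarith
      have "(\<Sum>j<n. G u (x j)) = (\<Sum>j<n. G u' (x j)) + (\<Sum>j<n. G u (x j) - G u' (x j))"
        by (simp add: sum_subtractf)
      then have "norm (\<Sum>j<n. G u (x j)) \<le> norm (\<Sum>j<n. G u' (x j)) + norm (\<Sum>j<n. G u (x j) - G u' (x j))"
        by (simp only: norm_triangle_ineq)
      also have "norm (\<Sum>j<n. G u' (x j)) \<le> \<zeta> / 2 * real n"
        using elim u'(1) by (force simp: divide_less_eq divide_inverse_commute[symmetric] field_simps)
      also have "norm (\<Sum>j<n. G u (x j) - G u' (x j)) \<le> \<zeta> / 2 * real n"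
      proof -
        have "norm (\<Sum>j<n. G u (x j) - G u' (x j)) \<le> (\<Sum>j<n. d * (L * (1 + norm (x j)) ^ 3))"
          using L nu
          by (intro sum_norm_le order_trans[OF lip[OF uR u'R]] mult_right_mono mult_nonneg_nonneg zero_le_power) auto
        also have "\<dots> = d * L * (\<Sum>j<n. (1 + norm (x j)) ^ 3)" by (simp add: sum_distrib_left mult.assoc)
        also have "\<dots> \<le> d * L * (C * real n)" using d L by (intro mult_left_mono C) auto
        also have "\<dots> = d * (L * C) * real n" by simp
        also have "\<dots> \<le> \<zeta> / 2 * real n" using dL by (intro mult_right_mono) auto
        finally show ?thesis .
      qed
      finally show "norm (\<Sum>j<n. gauss_kernel \<tau> (B (u - x j)) *\<^sub>R (x j - A u)) \<le> \<zeta> * real n"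
        unfolding G_def by simp
    qed
  qed
qed

text \<open>\<open>Q\<close> precedes \<open>e\<close> because \<open>tracks_step\<close> needs it
  to choose its tolerance. Jensen's inequality gives \<open>n * exp (- L) \<le> D\<close> with
  \<open>L\<close> depending only on \<open>r\<close> and the sample, as
  \<open>\<eta> \<le> 1\<close>. The numerator is compared with the centred sum for the exact images
  \<open>B (x j)\<close>, at a cost proportional to \<open>\<eta>\<close>.\<close>

lemma bulk_step:
  assumes lin: "linear B" "linear A" and r: "r \<ge> 0"
    and E: "closure E = UNIV"
    and conv: "\<And>u. u \<in> E \<Longrightarrow>
      (\<lambda>n. (\<Sum>j<n. gauss_kernel \<tau> (B (u - x j)) *\<^sub>R (x j - A u)) /\<^sub>R real n) \<longlonglongrightarrow> 0"
  shows "\<exists>Q>0. \<forall>e>0. \<exists>\<eta>>0. \<forall>\<^sub>F n in sequentially. \<forall>i<n. \<forall>y. norm (x i) \<le> r \<longrightarrow>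
    (\<forall>j<n. norm (y j - B (x j)) \<le> \<eta> * (1 + norm (x j))) \<longrightarrow>
    norm (kmean \<tau> n y i (\<lambda>j. x j - A (x i))) \<le> e \<and> kmean \<tau> n y i (\<lambda>j. norm (x j)) \<le> Q"
proof -
  obtain K where K: "K \<ge> 1" and KA: "\<And>u. norm (A u) \<le> K * norm u" and KB: "\<And>u. norm (B u) \<le> K * norm u"
    using linear_common_norm_bound[OF lin(2,1)] by blast
  obtain C where C: "C > 0" "\<And>n. (\<Sum>j<n. (1 + norm (x j)) ^ 3) \<le> C * real n" using cubic_moment by blast
  define R where "R = 2 + r"
  have R: "R \<ge> 1" unfolding R_def using r by simp
  define K3 where "K3 = 3 * K\<^sup>2 * R ^ 3 / (2 * \<tau>\<^sup>2)"
  define K4 where "K4 = 2 * K\<^sup>2 * R\<^sup>2 / \<tau>\<^sup>2"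
  define L where "L = K4 * C"
  have K3: "K3 > 0" unfolding K3_def using K R tau by (intro divide_pos_pos mult_pos_pos zero_less_power) auto
  have K4: "K4 \<ge> 0" unfolding K4_def by simp
  define Q where "Q = C * exp L"
  have Q: "Q > 0" unfolding Q_def using C by simp
  have "\<exists>\<eta>>0. \<forall>\<^sub>F n in sequentially. \<forall>i<n. \<forall>y. norm (x i) \<le> r \<longrightarrow>
    (\<forall>j<n. norm (y j - B (x j)) \<le> \<eta> * (1 + norm (x j))) \<longrightarrow>
    norm (kmean \<tau> n y i (\<lambda>j. x j - A (x i))) \<le> e \<and> kmean \<tau> n y i (\<lambda>j. norm (x j)) \<le> Q" if e: "e > 0" for e
  proof -
    \<comment> \<open>Two errors of size \<open>\<zeta> * n\<close>, from the centred sum and from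
      the changed weights, are weighed against the lower bound \<open>n * exp (- L)\<close> of the
      denominator.\<close>
    define \<zeta> where "\<zeta> = e * exp (- L) / 2"
    have \<zeta>: "\<zeta> > 0" unfolding \<zeta>_def using e by simp
    define \<eta> where "\<eta> = min 1 (\<zeta> / (K3 * C))"
    have \<eta>: "\<eta> > 0" "\<eta> \<le> 1" unfolding \<eta>_def using \<zeta> K3 C by auto
    have \<eta>K: "\<eta> * K3 * C \<le> \<zeta>"
    proof -
      have "\<eta> * (K3 * C) \<le> \<zeta> / (K3 * C) * (K3 * C)" unfolding \<eta>_def using K3 C by (intro mult_right_mono) auto
      also have "\<dots> = \<zeta>" using K3 C by simp
      finally show ?thesis by (simp add: mult.assoc)
    qed
    have "\<forall>\<^sub>F n in sequentially. \<forall>u. norm u \<le> r \<longrightarrow>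
      norm (\<Sum>j<n. gauss_kernel \<tau> (B (u - x j)) *\<^sub>R (x j - A u)) \<le> \<zeta> * real n"
      by (rule centered_sums_uniform[OF lin r \<zeta> E]) (rule conv)
    then have "\<forall>\<^sub>F n in sequentially. \<forall>i<n. \<forall>y. norm (x i) \<le> r \<longrightarrow>
      (\<forall>j<n. norm (y j - B (x j)) \<le> \<eta> * (1 + norm (x j))) \<longrightarrow>
      norm (kmean \<tau> n y i (\<lambda>j. x j - A (x i))) \<le> e \<and> kmean \<tau> n y i (\<lambda>j. norm (x j)) \<le> Q"
    proof eventually_elim
      case (elim n)
      show ?case
      proof (intro allI impI)
        fix i y assume i: "i < n" and xi: "norm (x i) \<le> r"
          and y: "\<forall>j<n. norm (y j - B (x j)) \<le> \<eta> * (1 + norm (x j))"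
        have n: "n > 0" using i by simp
        define w where "w j = gauss_kernel \<tau> (y i - y j)" for j
        define w0 where "w0 j = gauss_kernel \<tau> (B (x i - x j))" for j
        define D where "D = (\<Sum>j<n. w j)"
        have dist_vu: "norm ((y i - y j) - B (x i - x j)) \<le> \<eta> * (R * (1 + norm (x j)))" if j: "j < n" for j
        proof -
          have "(y i - y j) - B (x i - x j) = (y i - B (x i)) - (y j - B (x j))"
            by (simp add: linear_diff[OF lin(1)])
          then have "norm ((y i - y j) - B (x i - x j)) = norm ((y i - B (x i)) - (y j - B (x j)))" by (rule arg_cong)
          also have "\<dots> \<le> norm (y i - B (x i)) + norm (y j - B (x j))" by (rule norm_triangle_ineq4)
          also have "\<dots> \<le> \<eta> * (1 + norm (x i)) + \<eta> * (1 + norm (x j))" using y i j by (intro add_mono) auto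
          also have "\<dots> = \<eta> * ((1 + norm (x i)) + (1 + norm (x j)))" by (simp only: distrib_left)
          also have "\<dots> \<le> \<eta> * (R * (1 + norm (x j)))"
          proof (rule mult_left_mono)
            have "0 \<le> (1 + r) * norm (x j)" using r by simp
            then show "(1 + norm (x i)) + (1 + norm (x j)) \<le> R * (1 + norm (x j))"
              using xi unfolding R_def by (simp add: algebra_simps)
          qed (use \<eta> in simp)
          finally show ?thesis .
        qed
        have xR: "r + norm (x j) \<le> R * (1 + norm (x j))" for j
        proof -
          have "0 \<le> (1 + r) * norm (x j)" using r by simp
          then show ?thesis using r unfolding R_def by (simp add: algebra_simps)
        qed
        have nu: "norm (B (x i - x j)) \<le> K * (R * (1 + norm (x j)))" for j
        proof -
          have "norm (B (x i - x j)) \<le> K * norm (x i - x j)" by (rule KB)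
          also have "norm (x i - x j) \<le> R * (1 + norm (x j))"
            using norm_triangle_ineq4[of "x i" "x j"] xi xR[of j] by linarith
          finally show ?thesis using K by simp
        qed
        have nv: "norm (y i - y j) \<le> 2 * (K * (R * (1 + norm (x j))))" if j: "j < n" for j
        proof -
          have "norm (y i - y j) \<le> norm (B (x i - x j)) + norm ((y i - y j) - B (x i - x j))"
            using norm_triangle_sub[of "y i - y j" "B (x i - x j)"] .
          also have "\<dots> \<le> K * (R * (1 + norm (x j))) + \<eta> * (R * (1 + norm (x j)))"
            by (intro add_mono nu dist_vu j)
          also have "\<eta> * (R * (1 + norm (x j))) \<le> K * (R * (1 + norm (x j)))"
            using \<eta> K R by (intro mult_right_mono) auto
          finally show ?thesis by simp
        qed
        have nz: "norm (x j - A (x i)) \<le> K * (R * (1 + norm (x j)))" for j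
        proof -
          have "norm (x j - A (x i)) \<le> norm (x j) + K * norm (x i)"
            using norm_triangle_ineq4[of "x j" "A (x i)"] KA[of "x i"] by linarith
          also have "\<dots> \<le> K * norm (x j) + K * r"
            using xi K mult_right_mono[OF K, of "norm (x j)"] by (intro add_mono mult_left_mono) auto
          also have "\<dots> = K * (r + norm (x j))" by (simp add: algebra_simps)
          also have "\<dots> \<le> K * (R * (1 + norm (x j)))" using xR K by (intro mult_left_mono) auto
          finally show ?thesis .
        qed
        have diff: "\<bar>w j - w0 j\<bar> * norm (x j - A (x i)) \<le> \<eta> * K3 * (1 + norm (x j)) ^ 3" if j: "j < n" for j
        proof -
          define t where "t = 1 + norm (x j)"
          have t: "t \<ge> 1" unfolding t_def by simp
          have "\<bar>w j - w0 j\<bar> \<le> norm ((y i - y j) - B (x i - x j)) * (norm (y i - y j) + norm (B (x i - x j))) / (2 * \<tau>\<^sup>2)"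
            unfolding w_def w0_def by (rule gauss_kernel_lipschitz)
          also have "\<dots> \<le> (\<eta> * (R * t)) * (2 * (K * (R * t)) + K * (R * t)) / (2 * \<tau>\<^sup>2)"
            unfolding t_def using \<eta> R by (intro divide_right_mono mult_mono add_mono dist_vu nu nv j) auto
          finally have "\<bar>w j - w0 j\<bar> * norm (x j - A (x i))
            \<le> (\<eta> * (R * t)) * (2 * (K * (R * t)) + K * (R * t)) / (2 * \<tau>\<^sup>2) * (K * (R * t))"
            unfolding t_def using \<eta> R K by (intro mult_mono nz) auto
          also have "\<dots> = \<eta> * K3 * t ^ 3" unfolding K3_def by (simp add: power2_eq_square power3_eq_cube)
          finally show ?thesis unfolding t_def .
        qed
        have "norm (\<Sum>j<n. w j *\<^sub>R (x j - A (x i))) \<le> norm (\<Sum>j<n. w0 j *\<^sub>R (x j - A (x i)))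
            + norm (\<Sum>j<n. (w j - w0 j) *\<^sub>R (x j - A (x i)))"
        proof -
          have "(\<Sum>j<n. w j *\<^sub>R (x j - A (x i))) = (\<Sum>j<n. w0 j *\<^sub>R (x j - A (x i)))
            + (\<Sum>j<n. (w j - w0 j) *\<^sub>R (x j - A (x i)))"
            unfolding sum.distrib[symmetric] by (intro sum.cong refl) (simp add: scaleR_left_diff_distrib)
          then show ?thesis by (simp only: norm_triangle_ineq)
        qed
        also have "norm (\<Sum>j<n. w0 j *\<^sub>R (x j - A (x i))) \<le> \<zeta> * real n"
          unfolding w0_def using elim xi by blast
        also have "norm (\<Sum>j<n. (w j - w0 j) *\<^sub>R (x j - A (x i))) \<le> (\<Sum>j<n. \<eta> * K3 * (1 + norm (x j)) ^ 3)"
          using diff by (intro sum_norm_le) simp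
        also have "\<dots> = \<eta> * K3 * (\<Sum>j<n. (1 + norm (x j)) ^ 3)" by (simp only: sum_distrib_left)
        also have "\<dots> \<le> \<eta> * K3 * (C * real n)" using \<eta> K3 by (intro mult_left_mono C) auto
        also have "\<dots> = \<eta> * K3 * C * real n" by simp
        also have "\<dots> \<le> \<zeta> * real n" using \<eta>K by (intro mult_right_mono) auto
        also have "\<zeta> * real n + \<zeta> * real n = e * (real n * exp (- L))" unfolding \<zeta>_def by simp
        finally have num: "norm (\<Sum>j<n. w j *\<^sub>R (x j - A (x i))) \<le> e * (real n * exp (- L))" by simp
        have "(\<Sum>j<n. (norm (y i - y j))\<^sup>2 / (2 * \<tau>\<^sup>2)) \<le> (\<Sum>j<n. K4 * (1 + norm (x j)) ^ 3)"
        proof (intro sum_mono)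
          fix j assume "j \<in> {..<n}"
          then have j: "j < n" by simp
          define t where "t = 1 + norm (x j)"
          have t: "t \<ge> 1" unfolding t_def by simp
          have "(norm (y i - y j))\<^sup>2 / (2 * \<tau>\<^sup>2) \<le> (2 * (K * (R * t)))\<^sup>2 / (2 * \<tau>\<^sup>2)"
            unfolding t_def by (intro divide_right_mono power_mono nv j) auto
          also have "\<dots> = K4 * t\<^sup>2" unfolding K4_def by (simp add: power_mult_distrib)
          also have "\<dots> \<le> K4 * t ^ 3" using t K4 by (intro mult_left_mono power_increasing) auto
          finally show "(norm (y i - y j))\<^sup>2 / (2 * \<tau>\<^sup>2) \<le> K4 * (1 + norm (x j)) ^ 3" unfolding t_def .
        qed
        also have "\<dots> = K4 * (\<Sum>j<n. (1 + norm (x j)) ^ 3)" by (simp only: sum_distrib_left)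
        also have "\<dots> \<le> K4 * (C * real n)" using K4 by (intro mult_left_mono C) auto
        also have "\<dots> = L * real n" unfolding L_def by simp
        finally have D: "real n * exp (- L) \<le> D"
          unfolding D_def w_def gauss_kernel_norm minus_divide_left[symmetric] by (rule jensen_exp_neg)
        have D0: "D > 0" unfolding D_def w_def by (rule kernel_sum_pos[OF n])
        have "norm (kmean \<tau> n y i (\<lambda>j. x j - A (x i))) \<le> e"
        proof -
          have "e * (real n * exp (- L)) \<le> e * D" using e by (intro mult_left_mono D) auto
          with num have "norm (\<Sum>j<n. w j *\<^sub>R (x j - A (x i))) \<le> e * D" by linarith
          then show ?thesis unfolding norm_kmean_eq w_def[symmetric] D_def[symmetric]
            using D0 by (simp add: divide_le_eq)
        qed
        moreover have "kmean \<tau> n y i (\<lambda>j. norm (x j)) \<le> Q"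
          unfolding kmean_le_iff[OF n] w_def[symmetric] D_def[symmetric]
        proof -
          have "(\<Sum>j<n. w j * norm (x j)) \<le> (\<Sum>j<n. (1 + norm (x j)) ^ 3)"
          proof (intro sum_mono)
            fix j
            have "w j * norm (x j) \<le> 1 * norm (x j)" unfolding w_def by (intro mult_right_mono gauss_kernel_le_1) auto
            also have "\<dots> \<le> (1 + norm (x j)) ^ 1" by simp
            also have "\<dots> \<le> (1 + norm (x j)) ^ 3" by (rule power_increasing) auto
            finally show "w j * norm (x j) \<le> (1 + norm (x j)) ^ 3" .
          qed
          also have "\<dots> \<le> C * real n" by (rule C)
          also have "\<dots> = Q * (real n * exp (- L))" unfolding Q_def by (simp add: exp_minus)
          also have "\<dots> \<le> Q * D" using Q by (intro mult_left_mono D) auto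
          finally show "(\<Sum>j<n. w j * norm (x j)) \<le> Q * D" .
        qed
        ultimately show "norm (kmean \<tau> n y i (\<lambda>j. x j - A (x i))) \<le> e \<and> kmean \<tau> n y i (\<lambda>j. norm (x j)) \<le> Q" ..
      qed
    qed
    then show ?thesis using \<eta> by blast
  qed
  then show ?thesis using Q by blast
qed

section \<open>Induction over the steps and exchange of the limits\<close>

text \<open>The new error is the average of the old errors plus \<open>B\<close> applied to the
  average of \<open>x j - A (x i)\<close>. The first part stays relative to \<open>x i\<close>
  because the weighted mean of \<open>norm (x j)\<close> is of order \<open>1 + norm (x i)\<close>;
  the second is the business of \<open>tail_step\<close> and \<open>bulk_step\<close>, which meet at
  radius \<open>r\<close>.\<close>

lemma tracks_step:
  assumes cm: "conditional_mean B A" and lam: "0 \<le> l" "l < 1" "\<And>u. min_energy B A u \<le> l * q u"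
    and E: "closure E = UNIV"
    and conv: "\<And>u. u \<in> E \<Longrightarrow>
      (\<lambda>n. (\<Sum>j<n. gauss_kernel \<tau> (B (u - x j)) *\<^sub>R (x j - A u)) /\<^sub>R real n) \<longlonglongrightarrow> 0"
    and y: "tracks B y"
  shows "tracks (B \<circ> A) (\<lambda>n i. kmean \<tau> n (y n) i (y n))"
  unfolding tracks_def
proof (intro allI impI)
  fix e :: real assume e: "e > 0"
  have lin: "linear B" "linear A" using cm unfolding conditional_mean_def by auto
  obtain K where K: "K \<ge> 1" "\<And>u. norm (B u) \<le> K * norm u" using linear_norm_bound[OF lin(1)] by blast
  obtain K' where K': "K' \<ge> 1" "\<And>u. norm (A u) \<le> K' * norm u" using linear_norm_bound[OF lin(2)] by blast
  define e1 where "e1 = e / (2 * K)"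
  have e1: "e1 > 0" "K * e1 = e / 2" unfolding e1_def using e K by auto
  obtain r \<eta>1 where r: "r \<ge> 1" and \<eta>1: "\<eta>1 > 0" and tail: "\<forall>\<^sub>F n in sequentially. \<forall>i<n. \<forall>y. norm (x i) \<ge> r \<longrightarrow>
    (\<forall>j<n. norm (y j - B (x j)) \<le> \<eta>1 * (1 + norm (x j))) \<longrightarrow>
    kmean \<tau> n y i (\<lambda>j. norm (x j - A (x i))) \<le> e1 * norm (x i)"
    using tail_step[OF cm lam e1(1)] by blast
  have r0: "r \<ge> 0" using r by simp
  have "\<exists>Q>0. \<forall>e>0. \<exists>\<eta>>0. \<forall>\<^sub>F n in sequentially. \<forall>i<n. \<forall>y. norm (x i) \<le> r \<longrightarrow>
    (\<forall>j<n. norm (y j - B (x j)) \<le> \<eta> * (1 + norm (x j))) \<longrightarrow>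
    norm (kmean \<tau> n y i (\<lambda>j. x j - A (x i))) \<le> e \<and> kmean \<tau> n y i (\<lambda>j. norm (x j)) \<le> Q"
    by (rule bulk_step[OF lin r0 E]) (rule conv)
  then obtain Q \<eta>2 where Q: "Q > 0" and \<eta>2: "\<eta>2 > 0" and bulk: "\<forall>\<^sub>F n in sequentially. \<forall>i<n. \<forall>y. norm (x i) \<le> r \<longrightarrow>
    (\<forall>j<n. norm (y j - B (x j)) \<le> \<eta>2 * (1 + norm (x j))) \<longrightarrow>
    norm (kmean \<tau> n y i (\<lambda>j. x j - A (x i))) \<le> e1 \<and> kmean \<tau> n y i (\<lambda>j. norm (x j)) \<le> Q"
    using e1(1) by blast
  \<comment> \<open>The third entry makes the averaged old error at most \<open>e / 2\<close>, as
    \<open>1 + e1 + K' + Q\<close> bounds the relative weighted mean of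
    \<open>1 + norm (x j)\<close>.\<close>
  define \<eta> where "\<eta> = Min {\<eta>1, \<eta>2, e / (2 * (1 + e1 + K' + Q))}"
  have pos: "1 + e1 + K' + Q > 0" using e1 K' Q by simp
  have "e / (2 * (1 + e1 + K' + Q)) > 0" using e pos by (intro divide_pos_pos) auto
  then have \<eta>: "\<eta> > 0" "\<eta> \<le> \<eta>1" "\<eta> \<le> \<eta>2" "\<eta> \<le> e / (2 * (1 + e1 + K' + Q))"
    unfolding \<eta>_def using \<eta>1 \<eta>2 by auto
  have \<eta>e: "\<eta> * (1 + e1 + K' + Q) \<le> e / 2"
    using \<eta>(4) pos by (simp add: field_simps)
  have "\<forall>\<^sub>F n in sequentially. \<forall>i<n. norm (y n i - B (x i)) \<le> \<eta> * (1 + norm (x i))"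
    using y \<eta>(1) unfolding tracks_def by blast
  with tail bulk show "\<forall>\<^sub>F n in sequentially. \<forall>i<n.
    norm (kmean \<tau> n (y n) i (y n) - (B \<circ> A) (x i)) \<le> e * (1 + norm (x i))"
  proof eventually_elim
    case (elim n)
    show ?case
    proof (intro allI impI)
      fix i assume i: "i < n"
      have n: "n > 0" using i by simp
      define s where "s = norm (x i)"
      have s: "s \<ge> 0" unfolding s_def by simp
      have yb: "\<forall>j<n. norm (y n j - B (x j)) \<le> \<eta>' * (1 + norm (x j))" if "\<eta> \<le> \<eta>'" for \<eta>'
      proof (intro allI impI)
        fix j assume "j < n"
        then have "norm (y n j - B (x j)) \<le> \<eta> * (1 + norm (x j))" using elim(3) by blast
        also have "\<dots> \<le> \<eta>' * (1 + norm (x j))" using that by (intro mult_right_mono) auto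
        finally show "norm (y n j - B (x j)) \<le> \<eta>' * (1 + norm (x j))" .
      qed
      have main: "norm (kmean \<tau> n (y n) i (\<lambda>j. x j - A (x i))) \<le> e1 * (1 + s) \<and>
          kmean \<tau> n (y n) i (\<lambda>j. norm (x j)) \<le> (e1 + K' + Q) * (1 + s)"
      proof (cases "s \<ge> r")
        case True
        then have t: "kmean \<tau> n (y n) i (\<lambda>j. norm (x j - A (x i))) \<le> e1 * s"
          using elim(1) i yb[OF \<eta>(2)] unfolding s_def by blast
        have "kmean \<tau> n (y n) i (\<lambda>j. norm (x j)) \<le> kmean \<tau> n (y n) i (\<lambda>j. norm (x j - A (x i)) + norm (A (x i)))"
        proof (rule kmean_mono)
          show "norm (x j) \<le> norm (x j - A (x i)) + norm (A (x i))" for j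
            using norm_triangle_ineq[of "x j - A (x i)" "A (x i)"] by simp
        qed
        also have "\<dots> = kmean \<tau> n (y n) i (\<lambda>j. norm (x j - A (x i))) + norm (A (x i))"
          by (simp only: kmean_add kmean_const[OF n])
        also have "\<dots> \<le> e1 * s + K' * s" using t K'(2)[of "x i"] unfolding s_def by linarith
        also have "\<dots> \<le> (e1 + K' + Q) * (1 + s)"
          using e1 K' Q s by (simp add: algebra_simps add_nonneg_nonneg)
        finally have "kmean \<tau> n (y n) i (\<lambda>j. norm (x j)) \<le> (e1 + K' + Q) * (1 + s)" .
        moreover have "e1 * s \<le> e1 * (1 + s)" using e1 by simp
        ultimately show ?thesis using t norm_kmean_le[of \<tau> n "y n" i "\<lambda>j. x j - A (x i)"] by linarith
      next
        case False
        then have "norm (kmean \<tau> n (y n) i (\<lambda>j. x j - A (x i))) \<le> e1 \<and> kmean \<tau> n (y n) i (\<lambda>j. norm (x j)) \<le> Q"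
          using elim(2) i yb[OF \<eta>(3)] unfolding s_def by fastforce
        moreover have "e1 \<le> e1 * (1 + s)" using e1 s by simp
        moreover have "Q \<le> (e1 + K' + Q) * (1 + s)" using e1 K' Q s by (simp add: algebra_simps add_nonneg_nonneg)
        ultimately show ?thesis by linarith
      qed
      \<comment> \<open>Linearity lets \<open>B\<close> be pulled out of the average, and constants
        are reproduced by it.\<close>
      have "kmean \<tau> n (y n) i (y n) - (B \<circ> A) (x i)
          = kmean \<tau> n (y n) i (\<lambda>j. y n j - B (x j)) + B (kmean \<tau> n (y n) i (\<lambda>j. x j - A (x i)))"
        unfolding kmean_linear[OF lin(1)] linear_diff[OF lin(1)] kmean_diff kmean_const[OF n] by simp
      then have "norm (kmean \<tau> n (y n) i (y n) - (B \<circ> A) (x i))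
         \<le> norm (kmean \<tau> n (y n) i (\<lambda>j. y n j - B (x j))) + norm (B (kmean \<tau> n (y n) i (\<lambda>j. x j - A (x i))))"
        by (simp only: norm_triangle_ineq)
      also have "norm (B (kmean \<tau> n (y n) i (\<lambda>j. x j - A (x i)))) \<le> K * (e1 * (1 + s))"
        using main K(1) by (intro order_trans[OF K(2)] mult_left_mono) auto
      also have "K * (e1 * (1 + s)) = e / 2 * (1 + s)" using e1(2) by (simp only: mult.assoc[symmetric])
      also have "norm (kmean \<tau> n (y n) i (\<lambda>j. y n j - B (x j))) \<le> e / 2 * (1 + s)"
      proof -
        have "norm (kmean \<tau> n (y n) i (\<lambda>j. y n j - B (x j))) \<le> kmean \<tau> n (y n) i (\<lambda>j. norm (y n j - B (x j)))"
          by (rule norm_kmean_le)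
        also have "\<dots> \<le> kmean \<tau> n (y n) i (\<lambda>j. \<eta> * (1 + norm (x j)))"
          using elim(3) by (intro kmean_mono) blast
        also have "\<dots> = \<eta> * (1 + kmean \<tau> n (y n) i (\<lambda>j. norm (x j)))"
          by (simp only: kmean_cmult kmean_add kmean_const[OF n])
        also have "\<dots> \<le> \<eta> * ((1 + e1 + K' + Q) * (1 + s))"
        proof (rule mult_left_mono)
          have "1 + kmean \<tau> n (y n) i (\<lambda>j. norm (x j)) \<le> (1 + s) + (e1 + K' + Q) * (1 + s)" using main s by linarith
          then show "1 + kmean \<tau> n (y n) i (\<lambda>j. norm (x j)) \<le> (1 + e1 + K' + Q) * (1 + s)" by (simp add: algebra_simps)
        qed (use \<eta> in simp)
        also have "\<dots> \<le> e / 2 * (1 + s)"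
          using mult_right_mono[OF \<eta>e, of "1 + s"] s by (simp add: mult.assoc)
        finally show ?thesis .
      qed
      finally show "norm (kmean \<tau> n (y n) i (y n) - (B \<circ> A) (x i)) \<le> e * (1 + norm (x i))"
        unfolding s_def by (simp add: algebra_simps)
    qed
  qed
qed

text \<open>First a fixed \<open>T\<close> makes \<open>B T\<close> small, then \<open>n\<close> is
  taken large enough for tracking at step \<open>T\<close>, and only then does the number of further
  steps go to infinity with \<open>n\<close> fixed; \<open>bms_stays_near_0\<close> is uniform in
  that number.\<close>

lemma bms_limit_tendsto_0:
  fixes B A :: "nat \<Rightarrow> real^'p \<Rightarrow> real^'p"
  assumes B0: "B 0 = id" and BSuc: "\<And>t. B (Suc t) = B t \<circ> A t"
    and cm: "\<And>t. conditional_mean (B t) (A t)"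
    and lam: "0 \<le> l" "l < 1" "\<And>t u. min_energy (B t) (A t) u \<le> l * q u"
    and small: "\<And>\<epsilon>. \<epsilon> > 0 \<Longrightarrow> \<exists>T. \<forall>u. norm (B T u) \<le> \<epsilon> * norm u"
    and E: "closure E = UNIV"
    and conv: "\<And>t u. u \<in> E \<Longrightarrow>
      (\<lambda>n. (\<Sum>j<n. gauss_kernel \<tau> (B t (u - x j)) *\<^sub>R (x j - A t u)) /\<^sub>R real n) \<longlonglongrightarrow> 0"
  shows "(\<lambda>n. lim (\<lambda>t. bms \<tau> n x t i)) \<longlonglongrightarrow> 0"
proof (rule tendstoI)
  fix e :: real assume e: "e > 0"
  obtain K \<epsilon>0 where K: "K > 0" and \<epsilon>0: "\<epsilon>0 > 0" and near: "\<forall>\<epsilon> n (y :: nat \<Rightarrow> real^'p) k i. 0 < \<epsilon> \<longrightarrow> \<epsilon> \<le> \<epsilon>0 \<longrightarrow>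
     (\<forall>i<n. norm (y i) \<le> \<epsilon> * (1 + norm (x i))) \<longrightarrow> i < n \<longrightarrow>
     norm (bms \<tau> n y k i) \<le> K * \<epsilon> + \<epsilon> / 2 ^ k * norm (x i)"
    using bms_stays_near_0 by blast
  define \<epsilon> where "\<epsilon> = min \<epsilon>0 (e / (2 * K))"
  have \<epsilon>: "\<epsilon> > 0" "\<epsilon> \<le> \<epsilon>0" unfolding \<epsilon>_def using e K \<epsilon>0 by auto
  have K\<epsilon>: "K * \<epsilon> < e"
  proof -
    have "K * \<epsilon> \<le> K * (e / (2 * K))" unfolding \<epsilon>_def using K by (intro mult_left_mono) auto
    also have "\<dots> < e" using K e by simp
    finally show ?thesis .
  qed
  have tracks: "tracks (B t) (\<lambda>n i. bms \<tau> n x t i)" for t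
  proof (induction t)
    case 0
    show ?case unfolding tracks_def B0 by (intro allI impI always_eventually) simp
  next
    case (Suc t)
    show ?case unfolding BSuc bms_Suc_kmean
      by (rule tracks_step[OF cm lam E _ Suc]) (rule conv)
  qed
  \<comment> \<open>One half of \<open>\<epsilon>\<close> is for the size of \<open>B T\<close>, the
    other for the tracking error.\<close>
  obtain T where T: "\<And>u. norm (B T u) \<le> \<epsilon> / 2 * norm u" using small[of "\<epsilon> / 2"] \<epsilon> by auto
  have "\<forall>\<^sub>F n in sequentially. \<forall>i<n. norm (bms \<tau> n x T i - B T (x i)) \<le> \<epsilon> / 2 * (1 + norm (x i))"
    using tracks[of T] \<epsilon>(1) unfolding tracks_def by (meson half_gt_zero)
  then show "\<forall>\<^sub>F n in sequentially. dist (lim (\<lambda>t. bms \<tau> n x t i)) 0 < e"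
    using eventually_gt_at_top[of i]
  proof eventually_elim
    case (elim n)
    have n: "n > 0" using elim by simp
    have yT: "\<forall>i<n. norm (bms \<tau> n x T i) \<le> \<epsilon> * (1 + norm (x i))"
    proof (intro allI impI)
      fix i assume "i < n"
      then have "norm (bms \<tau> n x T i - B T (x i)) \<le> \<epsilon> / 2 * (1 + norm (x i))" using elim by blast
      then have "norm (bms \<tau> n x T i) \<le> \<epsilon> / 2 * (1 + norm (x i)) + \<epsilon> / 2 * norm (x i)"
        using norm_triangle_sub[of "bms \<tau> n x T i" "B T (x i)"] T[of "x i"] by linarith
      also have "\<dots> \<le> \<epsilon> * (1 + norm (x i))" using \<epsilon> by (simp add: algebra_simps add_divide_distrib)
      finally show "norm (bms \<tau> n x T i) \<le> \<epsilon> * (1 + norm (x i))" .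
    qed
    obtain c where c: "\<And>i. i < n \<Longrightarrow> (\<lambda>t. bms \<tau> n x t i) \<longlonglongrightarrow> c" using bms_convergent[OF n] by blast
    have c': "(\<lambda>t. bms \<tau> n x t i) \<longlonglongrightarrow> c" using c elim by blast
    \<comment> \<open>For fixed \<open>n\<close> the term
      \<open>\<epsilon> / 2 ^ k * norm (x i)\<close> disappears in the limit, which leaves
      \<open>norm c \<le> K * \<epsilon>\<close>.\<close>
    then have "(\<lambda>k. norm (bms \<tau> n x (T + k) i)) \<longlonglongrightarrow> norm c"
      using LIMSEQ_ignore_initial_segment[OF c', of T] by (intro tendsto_norm) (simp add: add.commute)
    moreover have "(\<lambda>k. K * \<epsilon> + \<epsilon> / 2 ^ k * norm (x i)) \<longlonglongrightarrow> K * \<epsilon> + 0 * norm (x i)"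
      by (intro tendsto_intros LIMSEQ_divide_realpow_zero) auto
    moreover have "norm (bms \<tau> n x (T + k) i) \<le> K * \<epsilon> + \<epsilon> / 2 ^ k * norm (x i)" for k
      unfolding bms_add using near \<epsilon> yT elim(2) by blast
    ultimately have "norm c \<le> K * \<epsilon> + 0 * norm (x i)"
      by (intro LIMSEQ_le) auto
    then have "norm c < e" using K\<epsilon> by simp
    then show ?case using limI[OF c'] by simp
  qed
qed

end

section \<open>Gaussian samples\<close>

lemma borel_measurable_linear:
  fixes F :: "'b::euclidean_space \<Rightarrow> 'c::real_normed_vector"
  assumes "linear F"
  shows "F \<in> borel_measurable borel"
  using linear_continuous_on[OF linear_conv_bounded_linear[THEN iffD1, OF assms], of UNIV]
  by (intro borel_measurable_continuous_onI) auto

lemma borel_measurable_gauss_kernel [measurable]: "gauss_kernel \<tau> \<in> borel_measurable borel"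
  unfolding gauss_kernel_def by measurable

text \<open>The normalising constant is a parameter \<open>k\<close>; total mass one comes from
  \<open>N\<close> being the law of each \<open>X i\<close>, which spares the evaluation of the
  Gaussian integral.\<close>

locale gaussian_sample = gaussian_form S \<tau> a0 b0 + iid_sample M X N
  for S :: "real^'p \<Rightarrow> real^'p" and \<tau> a0 b0 :: real and M :: "'a measure" and X :: "nat \<Rightarrow> 'a \<Rightarrow> real^'p"
    and N :: "(real^'p) measure" +
  fixes k :: real
  assumes k: "k > 0" and N_eq: "N = density lborel (\<lambda>u. ennreal (k * exp (- q u / 2)))"
begin

lemma measurable_q [measurable]: "q \<in> borel_measurable borel"
proof -
  have [measurable]: "S \<in> borel_measurable borel" by (rule borel_measurable_linear[OF linear_S])
  show ?thesis by measurable
qed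

lemma nn_integral_N:
  assumes [measurable]: "g \<in> borel_measurable borel"
  shows "(\<integral>\<^sup>+u. g u \<partial>N) = (\<integral>\<^sup>+u. ennreal (k * exp (- q u / 2)) * g u \<partial>lborel)"
  unfolding N_eq by (rule nn_integral_density) measurable

text \<open>Against the density the integrand becomes
  \<open>k * exp (- (\<delta> * q u) / 2)\<close>, a rescaled copy of the density itself. The
  substitution by \<open>c = 1 / sqrt \<delta>\<close> reduces the integral to the total mass of
  \<open>N\<close> times a Jacobian.\<close>

lemma integrable_exp_q:
  assumes \<delta>: "0 < \<delta>"
  shows "integrable N (\<lambda>u. exp ((1 - \<delta>) / 2 * q u))"
proof (rule integrableI_nonneg)
  interpret N: prob_space N by (rule prob_space_N)
  define c where "c = 1 / sqrt \<delta>"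
  have c: "c > 0" "c\<^sup>2 * \<delta> = 1" unfolding c_def using \<delta> by (auto simp: power_divide)
  define F where "F u = ennreal (k * exp (- (\<delta> * q u) / 2))" for u
  have [measurable]: "F \<in> borel_measurable borel" unfolding F_def by measurable
  have "(\<integral>\<^sup>+u. ennreal (exp ((1 - \<delta>) / 2 * q u)) \<partial>N)
      = (\<integral>\<^sup>+u. ennreal (k * exp (- q u / 2)) * ennreal (exp ((1 - \<delta>) / 2 * q u)) \<partial>lborel)"
    by (rule nn_integral_N) measurable
  also have "\<dots> = (\<integral>\<^sup>+u. F u \<partial>lborel)"
  proof (intro nn_integral_cong)
    fix u
    have "k * exp (- q u / 2) * exp ((1 - \<delta>) / 2 * q u) = k * exp (- q u / 2 + (1 - \<delta>) / 2 * q u)"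
      by (simp add: mult_exp_exp)
    also have "- q u / 2 + (1 - \<delta>) / 2 * q u = - (\<delta> * q u) / 2" by (simp add: field_simps)
    finally show "ennreal (k * exp (- q u / 2)) * ennreal (exp ((1 - \<delta>) / 2 * q u)) = F u"
      unfolding F_def using k by (subst ennreal_mult'[symmetric]) simp_all
  qed
  also have "\<dots> = (\<integral>\<^sup>+u. F u \<partial>density (distr lborel borel (\<lambda>u. 0 + c *\<^sub>R u)) (\<lambda>_. ennreal (\<bar>c\<bar> ^ DIM(real^'p))))"
    using c by (subst lborel_affine[of c 0]) auto
  also have "\<dots> = (\<integral>\<^sup>+u. ennreal (\<bar>c\<bar> ^ DIM(real^'p)) * F u \<partial>distr lborel borel (\<lambda>u. 0 + c *\<^sub>R u))"
    by (rule nn_integral_density) measurable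
  also have "\<dots> = (\<integral>\<^sup>+u. ennreal (\<bar>c\<bar> ^ DIM(real^'p)) * F (c *\<^sub>R u) \<partial>lborel)"
    by (subst nn_integral_distr) auto
  also have "\<dots> = ennreal (\<bar>c\<bar> ^ DIM(real^'p)) * (\<integral>\<^sup>+u. F (c *\<^sub>R u) \<partial>lborel)"
    by (rule nn_integral_cmult) measurable
  also have "(\<integral>\<^sup>+u. F (c *\<^sub>R u) \<partial>lborel) = (\<integral>\<^sup>+u. ennreal (k * exp (- q u / 2)) * 1 \<partial>lborel)"
  proof (intro nn_integral_cong)
    fix u :: "real^'p"
    have "\<delta> * q (c *\<^sub>R u) = (c\<^sup>2 * \<delta>) * q u" by (simp add: linear_cmul[OF linear_S] power2_eq_square)
    then show "F (c *\<^sub>R u) = ennreal (k * exp (- q u / 2)) * 1" unfolding F_def c(2) by simp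
  qed
  also have "\<dots> = (\<integral>\<^sup>+u. 1 \<partial>N)" by (rule nn_integral_N[symmetric]) measurable
  also have "\<dots> = 1" using N.emeasure_space_1 by simp
  finally show "(\<integral>\<^sup>+u. ennreal (exp ((1 - \<delta>) / 2 * q u)) \<partial>N) < \<infinity>" by (simp add: ennreal_mult_less_top)
qed auto

text \<open>\<open>AE_sum_le_linear\<close> applies with \<open>\<gamma> = \<delta>\<close>, since
  \<open>(1 - \<delta>) * (1 + \<delta>) = 1 - \<delta>\<^sup>2\<close> is still below 1. The sums
  decrease in \<open>\<delta>\<close>, so a sequence tending to 0 suffices for all
  \<open>\<delta>\<close> outside one null set.\<close>

lemma AE_moment:
  "AE \<omega> in M. \<forall>\<delta>. 0 < \<delta> \<longrightarrow> \<delta> < 1 \<longrightarrow> (\<exists>C. \<forall>n. (\<Sum>j<n. exp ((1 - \<delta>) / 2 * q (X j \<omega>))) \<le> C * real n)"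
proof -
  have "AE \<omega> in M. \<exists>C. \<forall>n. (\<Sum>j<n. exp ((1 - \<delta>) / 2 * q (X j \<omega>))) \<le> C * real n"
    if \<delta>: "0 < \<delta>" "\<delta> < 1" for \<delta>
  proof (rule AE_sum_le_linear[where \<gamma>=\<delta>])
    have "(\<lambda>u. exp ((1 - \<delta>) / 2 * q u) powr (1 + \<delta>)) = (\<lambda>u. exp ((1 - \<delta>\<^sup>2) / 2 * q u))"
      by (rule ext) (simp add: powr_def power2_eq_square algebra_simps add_divide_distrib diff_divide_distrib)
    then show "integrable N (\<lambda>u. exp ((1 - \<delta>) / 2 * q u) powr (1 + \<delta>))"
      using integrable_exp_q[of "\<delta>\<^sup>2"] \<delta> by simp
    show "integrable N (\<lambda>u. exp ((1 - \<delta>) / 2 * q u))" by (rule integrable_exp_q) fact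
  qed (use \<delta> in auto)
  \<comment> \<open>The shift \<open>m + 2\<close> keeps the values \<open>1 / (m + 2)\<close>
    strictly below 1.\<close>
  then have "AE \<omega> in M. \<exists>C. \<forall>n. (\<Sum>j<n. exp ((1 - 1 / (real m + 2)) / 2 * q (X j \<omega>))) \<le> C * real n" for m :: nat
    by simp
  then have "AE \<omega> in M. \<forall>m::nat. \<exists>C. \<forall>n. (\<Sum>j<n. exp ((1 - 1 / (real m + 2)) / 2 * q (X j \<omega>))) \<le> C * real n"
    by (subst AE_all_countable) auto
  then show ?thesis
  proof eventually_elim
    case (elim \<omega>)
    show ?case
    proof (intro allI impI)
      fix \<delta> :: real assume \<delta>: "0 < \<delta>" "\<delta> < 1"
      obtain m :: nat where m: "1 / \<delta> < real m" using reals_Archimedean2 by blast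
      then have "1 / (real m + 2) \<le> \<delta>" using \<delta> by (simp add: field_simps)
      then have le: "(\<Sum>j<n. exp ((1 - \<delta>) / 2 * q (X j \<omega>))) \<le> (\<Sum>j<n. exp ((1 - 1 / (real m + 2)) / 2 * q (X j \<omega>)))" for n
        using q_nonneg by (intro sum_mono) (auto intro!: mult_right_mono)
      obtain C where "\<And>n. (\<Sum>j<n. exp ((1 - 1 / (real m + 2)) / 2 * q (X j \<omega>))) \<le> C * real n" using elim by blast
      then show "\<exists>C. \<forall>n. (\<Sum>j<n. exp ((1 - \<delta>) / 2 * q (X j \<omega>))) \<le> C * real n"
        using le order_trans by blast
    qed
  qed
qed

text \<open>After completing the square, kernel times density is an even function of
  \<open>v - A u\<close>, and it multiplies an odd one. The reflection \<open>v\<close> to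
  \<open>2 A u - v\<close> preserves Lebesgue measure and turns the integral into its
  negative.\<close>

lemma expectation_centered:
  assumes cm: "conditional_mean B A"
  shows "(\<integral>v. gauss_kernel \<tau> (B (u - v)) * (v - A u) $ i \<partial>N) = 0"
proof -
  have linB: "linear B" using cm unfolding conditional_mean_def by blast
  have [measurable]: "B \<in> borel_measurable borel" by (rule borel_measurable_linear[OF linB])
  have [measurable]: "(\<lambda>v. (v - A u) $ i) \<in> borel_measurable borel"
    by (intro borel_measurable_continuous_onI continuous_intros)
  define \<Phi> where "\<Phi> v = k * exp (- q v / 2) * (gauss_kernel \<tau> (B (u - v)) * (v - A u) $ i)" for v
  have [measurable]: "\<Phi> \<in> borel_measurable borel" unfolding \<Phi>_def by measurable
  have \<Phi>: "\<Phi> v = k * exp (- min_energy B A u / 2) * (exp (- (q (v - A u) + (norm (B (v - A u)))\<^sup>2 / \<tau>\<^sup>2) / 2) * (v - A u) $ i)" for v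
  proof -
    have "q v + (norm (B (u - v)))\<^sup>2 / \<tau>\<^sup>2 = min_energy B A u + (q (v - A u) + (norm (B (v - A u)))\<^sup>2 / \<tau>\<^sup>2)"
      using cm[unfolded conditional_mean_def, THEN conjunct2, THEN conjunct2, rule_format, of v u]
      unfolding min_energy_def by linarith
    then have e: "- q v / 2 + - (norm (B (u - v)))\<^sup>2 / (2 * \<tau>\<^sup>2)
       = - min_energy B A u / 2 + - (q (v - A u) + (norm (B (v - A u)))\<^sup>2 / \<tau>\<^sup>2) / 2"
      by (simp only: minus_divide_left[symmetric] minus_add_distrib[symmetric] divide_divide_eq_left[symmetric]
          mult.commute[of 2] add_divide_distrib[symmetric])
    have "\<Phi> v = k * (exp (- q v / 2) * exp (- (norm (B (u - v)))\<^sup>2 / (2 * \<tau>\<^sup>2))) * (v - A u) $ i"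
      unfolding \<Phi>_def gauss_kernel_norm by simp
    then show ?thesis unfolding mult_exp_exp e by (simp only: exp_add mult.assoc)
  qed
  have odd: "\<Phi> (2 *\<^sub>R A u + (- 1) *\<^sub>R v) = - \<Phi> v" for v
  proof -
    define \<phi> where "\<phi> d = k * exp (- min_energy B A u / 2) * (exp (- (q d + (norm (B d))\<^sup>2 / \<tau>\<^sup>2) / 2) * d $ i)" for d
    have "2 *\<^sub>R A u + (- 1) *\<^sub>R v - A u = - (v - A u)" by (simp add: scaleR_2)
    then have "\<Phi> (2 *\<^sub>R A u + (- 1) *\<^sub>R v) = \<phi> (- (v - A u))" unfolding \<Phi> \<phi>_def by simp
    also have "\<phi> (- (v - A u)) = - \<phi> (v - A u)"
    proof -
      have "\<phi> (- d) = - \<phi> d" for d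
        unfolding \<phi>_def by (simp add: linear_neg[OF linB] linear_neg[OF linear_S])
      then show ?thesis .
    qed
    also have "\<phi> (v - A u) = \<Phi> v" unfolding \<Phi> \<phi>_def ..
    finally show ?thesis .
  qed
  have "(\<integral>v. gauss_kernel \<tau> (B (u - v)) * (v - A u) $ i \<partial>N) = (\<integral>v. \<Phi> v \<partial>lborel)"
    unfolding N_eq \<Phi>_def using k by (subst integral_density) auto
  also have "\<dots> = (\<integral>v. \<Phi> v \<partial>density (distr lborel borel (\<lambda>v. 2 *\<^sub>R A u + (- 1) *\<^sub>R v)) (\<lambda>_. ennreal (\<bar>- 1\<bar> ^ DIM(real^'p))))"
    by (subst lborel_affine[of "- 1" "2 *\<^sub>R A u"]) auto
  also have "\<dots> = (\<integral>v. \<Phi> (2 *\<^sub>R A u + (- 1) *\<^sub>R v) \<partial>lborel)"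
    by (subst integral_density) (auto simp: integral_distr)
  also have "\<dots> = - (\<integral>v. \<Phi> v \<partial>lborel)" unfolding odd by simp
  finally show ?thesis
    using \<open>(\<integral>v. gauss_kernel \<tau> (B (u - v)) * (v - A u) $ i \<partial>N) = (\<integral>v. \<Phi> v \<partial>lborel)\<close> by simp
qed

text \<open>The summands are unbounded, but at most \<open>K * sqrt (G v)\<close> for
  \<open>G = exp (q / 4)\<close>, hence of smaller order than \<open>G\<close>, whose sums are
  linearly bounded by \<open>AE_moment\<close>. So \<open>AE_slln_dominated\<close> applies to each
  coordinate.\<close>

lemma AE_centered_sums:
  assumes cm: "conditional_mean B A"
  shows "AE \<omega> in M. (\<lambda>n. (\<Sum>j<n. gauss_kernel \<tau> (B (u - X j \<omega>)) *\<^sub>R (X j \<omega> - A u)) /\<^sub>R real n) \<longlonglongrightarrow> 0"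
proof -
  have linB: "linear B" using cm unfolding conditional_mean_def by blast
  have [measurable]: "B \<in> borel_measurable borel" by (rule borel_measurable_linear[OF linB])
  have [measurable]: "(\<lambda>v. (v - A u) $ i) \<in> borel_measurable borel" for i
    by (intro borel_measurable_continuous_onI continuous_intros)
  define g where "g i v = gauss_kernel \<tau> (B (u - v)) * (v - A u) $ i" for i v
  have [measurable]: "g i \<in> borel_measurable borel" for i unfolding g_def by measurable
  define G where "G v = exp ((1 - 1/2) / 2 * q v)" for v
  have [measurable]: "G \<in> borel_measurable borel" unfolding G_def by measurable
  define K where "K = 1 + 1 / (a0 / 8) + norm (A u)"
  have K: "K > 0" unfolding K_def using a0 by (intro add_pos_nonneg) auto
  have gG: "\<bar>g i v\<bar> \<le> K * sqrt (G v)" for i v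
  proof -
    have "\<bar>g i v\<bar> \<le> 1 * norm (v - A u)"
      unfolding g_def abs_mult by (intro mult_mono component_le_norm_cart) (auto simp: gauss_kernel_le_1)
    also have "\<dots> \<le> norm v + norm (A u)" using norm_triangle_ineq4 by simp
    also have "\<dots> \<le> (1 + 1 / (a0 / 8)) * exp (a0 / 8 * (norm v)\<^sup>2) + norm (A u) * exp (a0 / 8 * (norm v)\<^sup>2)"
      using a0 by (intro add_mono exp_square_dominates_linear) (auto simp: mult_le_cancel_left1)
    also have "\<dots> = K * exp (a0 / 8 * (norm v)\<^sup>2)" unfolding K_def by (simp add: algebra_simps)
    also have "\<dots> \<le> K * exp (q v / 8)" using K q_lower[of v] by (intro mult_left_mono) auto
    also have "exp (q v / 8) = sqrt (G v)"
    proof (rule real_sqrt_unique[symmetric])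
      show "(exp (q v / 8))\<^sup>2 = G v" unfolding G_def by (simp add: exp_of_nat_mult[symmetric])
    qed simp
    finally show ?thesis .
  qed
  have "AE \<omega> in M. (\<lambda>n. (\<Sum>j<n. g i (X j \<omega>)) / real n) \<longlonglongrightarrow> (\<integral>v. g i v \<partial>N)" for i
  proof (rule AE_slln_dominated[where G=G])
    show "integrable N G" unfolding G_def by (rule integrable_exp_q) simp
    show "\<exists>K. \<forall>v. G v \<le> R \<longrightarrow> \<bar>g i v\<bar> \<le> K" for R
    proof (intro exI[of _ "K * sqrt R"] allI impI)
      fix v assume "G v \<le> R"
      then show "\<bar>g i v\<bar> \<le> K * sqrt R" using K by (intro order_trans[OF gG] mult_left_mono) auto
    qed
    show "\<exists>R>0. \<forall>v. G v > R \<longrightarrow> \<bar>g i v\<bar> \<le> e * G v" if e: "e > 0" for e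
    proof (intro exI[of _ "(K / e)\<^sup>2"] conjI allI impI)
      fix v assume "G v > (K / e)\<^sup>2"
      then have "K / e \<le> sqrt (G v)" by (intro real_le_rsqrt) simp
      then have "K \<le> e * sqrt (G v)" using e by (simp add: field_simps)
      then have "K * sqrt (G v) \<le> e * sqrt (G v) * sqrt (G v)" by (intro mult_right_mono) (auto simp: G_def)
      also have "\<dots> = e * G v" by (simp add: G_def)
      finally show "\<bar>g i v\<bar> \<le> e * G v" using gG[of i v] by linarith
    qed (use K e in simp)
    show "AE \<omega> in M. \<exists>C. \<forall>n. (\<Sum>j<n. G (X j \<omega>)) \<le> C * real n"
      using AE_moment unfolding G_def
    proof eventually_elim
      case (elim \<omega>)
      show ?case by (rule elim[rule_format]) simp_all
    qed
  qed (auto simp: G_def)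
  then have "AE \<omega> in M. \<forall>i. (\<lambda>n. (\<Sum>j<n. g i (X j \<omega>)) / real n) \<longlonglongrightarrow> 0"
    unfolding g_def expectation_centered[OF cm] by (subst AE_all_countable) auto
  then show ?thesis
  proof eventually_elim
    case (elim \<omega>)
    show ?case
    proof (rule vec_tendstoI)
      fix i
      have "(\<lambda>n. (\<Sum>j<n. g i (X j \<omega>)) / real n) \<longlonglongrightarrow> 0" using elim by blast
      then show "(\<lambda>n. ((\<Sum>j<n. gauss_kernel \<tau> (B (u - X j \<omega>)) *\<^sub>R (X j \<omega> - A u)) /\<^sub>R real n) $ i) \<longlonglongrightarrow> 0 $ i"
        unfolding g_def by (simp add: sum_component divide_inverse_commute)
    qed
  qed
qed


section \<open>Lower bound for the number of sample points near a given place\<close>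

lemma measure_N_ge:
  assumes A [measurable]: "A \<in> sets borel" and fin: "emeasure lborel A < \<infinity>"
    and w: "\<And>u. u \<in> A \<Longrightarrow> q u / 2 \<le> w"
  shows "k * exp (- w) * measure lborel A \<le> measure N A"
proof -
  interpret N: prob_space N by (rule prob_space_N)
  have "ennreal (k * exp (- w)) * emeasure lborel A = (\<integral>\<^sup>+u. ennreal (k * exp (- w)) * indicator A u \<partial>lborel)"
    by (subst nn_integral_cmult_indicator) auto
  also have "\<dots> \<le> (\<integral>\<^sup>+u. ennreal (k * exp (- q u / 2)) * indicator A u \<partial>lborel)"
    using k w by (intro nn_integral_mono) (auto simp: indicator_def intro!: ennreal_leI)
  also have "\<dots> = (\<integral>\<^sup>+u. indicator A u \<partial>N)" by (rule nn_integral_N[symmetric]) measurable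
  also have "\<dots> = emeasure N A" by (rule nn_integral_indicator) simp
  finally have "ennreal (k * exp (- w)) * ennreal (measure lborel A) \<le> ennreal (measure N A)"
    using fin by (simp add: emeasure_eq_ennreal_measure less_top[symmetric] N.emeasure_eq_measure)
  then show ?thesis using k by (simp add: ennreal_mult'[symmetric])
qed

text \<open>It suffices to control the balls \<^term>\<open>ball (real s *\<^sub>R v) (\<theta> * real s)\<close> with $s \le n$ and $v$ in a
  finite net of the unit ball, because the tolerance is proportional to \<^term>\<open>1 + norm z\<close>.\<close>
lemma AE_dense_fixed:
  assumes \<epsilon>: "0 < \<epsilon>" "\<epsilon> \<le> 1"
  shows "AE \<omega> in M. \<exists>c>0. \<forall>\<^sub>F n in sequentially. \<forall>z. q z \<le> (1 - \<epsilon>) * (2 * ln (real n)) \<longrightarrow>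
      c * real n * exp (- q z / 2 - \<epsilon> * (1 + (norm z)\<^sup>2))
        \<le> real (card {j. j < n \<and> norm (X j \<omega> - z) \<le> \<epsilon> * (1 + norm z)})"
proof -
  obtain b where b: "b \<ge> 1" "\<And>u. norm (S u) \<le> b * norm u" using linear_norm_bound[OF linear_S] by blast
  \<comment> \<open>In the relevant range \<open>(norm z)\<^sup>2 \<le> 2 * ln n / a0\<close>, so
    the second bound keeps \<open>\<epsilon>' * (norm z)\<^sup>2\<close> below
    \<open>\<epsilon> / 4 * ln n\<close>.\<close>
  define \<epsilon>' where "\<epsilon>' = min (\<epsilon> / 4) (\<epsilon> * a0 / 8)"
  have \<epsilon>': "\<epsilon>' > 0" "\<epsilon>' \<le> \<epsilon> / 4" "\<epsilon>' \<le> \<epsilon> * a0 / 8" unfolding \<epsilon>'_def using \<epsilon> a0 by auto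
  \<comment> \<open>\<open>\<epsilon> / 4\<close> puts the chosen net ball inside the tolerance
    around \<open>z\<close>; \<open>\<epsilon>' / (24 * b)\<close> limits the variation of
    \<open>q\<close> on it.\<close>
  define \<theta> where "\<theta> = Min {1, \<epsilon> / 4, \<epsilon>' / (24 * b)}"
  have \<theta>: "\<theta> > 0" "\<theta> \<le> 1" "\<theta> \<le> \<epsilon> / 4" "\<theta> \<le> \<epsilon>' / (24 * b)" unfolding \<theta>_def using \<epsilon> \<epsilon>' b by auto
  have \<theta>b: "24 * b * \<theta> \<le> \<epsilon>'" using \<theta>(4) b by (simp add: field_simps)
  obtain F where F: "finite F" "cball (0::real^'p) 1 \<subseteq> (\<Union>v\<in>F. ball v \<theta>)"
  proof -
    have "cball (0::real^'p) 1 \<subseteq> (\<Union>v\<in>UNIV. ball v \<theta>)"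
    proof
      show "v \<in> (\<Union>v\<in>UNIV. ball v \<theta>)" for v :: "real^'p" using \<theta>(1) by (intro UN_I[of v]) auto
    qed
    then show ?thesis
      using compactE_image[OF compact_cball[of "0::real^'p" 1], of UNIV "\<lambda>v. ball v \<theta>"] that by auto
  qed
  define A where "A v s = ball (real s *\<^sub>R v) (\<theta> * real s)" for v :: "real^'p" and s :: nat
  define \<beta> where "\<beta> = unit_ball_vol (real DIM(real^'p)) * \<theta> ^ DIM(real^'p)"
  have \<beta>: "\<beta> > 0" unfolding \<beta>_def using \<theta> by (intro mult_pos_pos unit_ball_vol_pos) auto
  have vol: "\<beta> \<le> measure lborel (A v s)" if "s \<ge> 1" for v s
  proof -
    have "\<theta> ^ DIM(real^'p) \<le> (\<theta> * real s) ^ DIM(real^'p)" using \<theta> that by (intro power_mono) auto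
    then show ?thesis unfolding A_def \<beta>_def using \<theta>
      by (subst content_ball) (auto intro!: mult_left_mono less_imp_le[OF unit_ball_vol_pos])
  qed
  have "AE \<omega> in M. \<forall>v\<in>F. \<forall>\<^sub>F n in sequentially. \<forall>s\<le>n. real n * measure N (A v s) \<ge> real n powr (\<epsilon> / 2) \<longrightarrow>
           real n * measure N (A v s) / 2 < real (card {j. j < n \<and> X j \<omega> \<in> A v s})"
    by (rule AE_finite_allI[OF F(1)], rule AE_card_lower_bound) (use \<epsilon> in \<open>simp_all add: A_def\<close>)
  then show ?thesis
  proof eventually_elim
    case (elim \<omega>)
    then have "\<forall>\<^sub>F n in sequentially. \<forall>v\<in>F. \<forall>s\<le>n. real n * measure N (A v s) \<ge> real n powr (\<epsilon> / 2) \<longrightarrow>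
           real n * measure N (A v s) / 2 < real (card {j. j < n \<and> X j \<omega> \<in> A v s})"
      using F(1) by (intro eventually_ball_finite) auto
    \<comment> \<open>The expected count of a relevant ball is at least this right-hand side:
      \<open>q z / 2\<close> costs \<open>(1 - \<epsilon>) * ln n\<close> and
      \<open>\<epsilon>'\<close> another \<open>\<epsilon> / 4 * ln n\<close>, which leaves the
      power \<open>3 / 4 * \<epsilon>\<close>. It exceeds the threshold
      \<open>\<epsilon> / 2\<close> of \<open>AE_card_lower_bound\<close>.\<close>
    moreover have "\<forall>\<^sub>F n in sequentially. real n powr (\<epsilon> / 2) \<le> k * \<beta> * exp (- \<epsilon>') * real n powr (3 / 4 * \<epsilon>)"
    proof -
      define h where "h = k * \<beta> * exp (- \<epsilon>')"
      have "h > 0" unfolding h_def using k \<beta> by simp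
      then have "\<forall>\<^sub>F n in sequentially. real n powr (\<epsilon> / 2) \<le> h * real n powr (3 / 4 * \<epsilon>)"
        using \<epsilon>(1) by real_asymp
      then show ?thesis unfolding h_def .
    qed
    moreover have "\<forall>\<^sub>F n in sequentially. 3 + 2 * ln (real n) / a0 \<le> real n"
      using a0 by real_asymp
    moreover have "\<forall>\<^sub>F n in sequentially. n \<ge> (1::nat)" by (rule eventually_ge_at_top)
    ultimately have "\<forall>\<^sub>F n in sequentially. \<forall>z. q z \<le> (1 - \<epsilon>) * (2 * ln (real n)) \<longrightarrow>
      (k * \<beta> / 2) * real n * exp (- q z / 2 - \<epsilon> * (1 + (norm z)\<^sup>2))
        \<le> real (card {j. j < n \<and> norm (X j \<omega> - z) \<le> \<epsilon> * (1 + norm z)})"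
    proof eventually_elim
      case (elim n)
      show ?case
      proof (intro allI impI)
        fix z assume z: "q z \<le> (1 - \<epsilon>) * (2 * ln (real n))"
        define t where "t = norm z"
        have t: "t \<ge> 0" unfolding t_def by simp
        have ln0: "ln (real n) \<ge> 0" using elim(4) by simp
        have zn: "t\<^sup>2 \<le> 2 * ln (real n) / a0"
        proof -
          have "(1 - \<epsilon>) * (2 * ln (real n)) \<le> 1 * (2 * ln (real n))" using \<epsilon> ln0 by (intro mult_right_mono) auto
          then have "a0 * t\<^sup>2 \<le> 2 * ln (real n)" using z q_lower[of z] unfolding t_def by linarith
          then show ?thesis using a0 by (simp add: le_divide_eq mult.commute)
        qed
        have tsq: "t \<le> 1 + t\<^sup>2"
          using exp_square_dominates_linear[of 1 t] zero_le_square[of "t - 1"] t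
          by (simp add: power2_eq_square algebra_simps)
        \<comment> \<open>The added 1 keeps \<open>s\<close> positive for \<open>z = 0\<close>, and
          \<open>s \<ge> norm z\<close> moves \<open>z\<close> into the unit ball after division by
          \<open>s\<close>.\<close>
        define s where "s = nat \<lceil>t\<rceil> + 1"
        have s: "s \<ge> 1" "t \<le> real s" "real s \<le> t + 2" unfolding s_def using t by linarith+
        have sn: "s \<le> n"
        proof -
          have "real s \<le> real n" using s(3) tsq zn elim(3) by linarith
          then show ?thesis by simp
        qed
        have "(1 / real s) *\<^sub>R z \<in> cball 0 1" using s unfolding t_def by simp
        then have "(1 / real s) *\<^sub>R z \<in> (\<Union>v\<in>F. ball v \<theta>)" using F(2) by blast
        then obtain v where v: "v \<in> F" "dist v ((1 / real s) *\<^sub>R z) < \<theta>" unfolding UN_iff mem_ball by blast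
        have "norm (real s *\<^sub>R v - z) \<le> \<theta> * real s"
        proof -
          have "real s *\<^sub>R v - z = real s *\<^sub>R (v - (1 / real s) *\<^sub>R z)" using s by (simp add: scaleR_diff_right)
          then have "norm (real s *\<^sub>R v - z) = real s * dist v ((1 / real s) *\<^sub>R z)" by (simp add: dist_norm)
          also have "\<dots> \<le> real s * \<theta>" using v(2) by (intro mult_left_mono) auto
          finally show ?thesis by (simp add: mult.commute)
        qed
        then have near: "norm (u - z) \<le> 4 * \<theta> * (1 + t)" if "u \<in> A v s" for u
        proof -
          have "norm (u - real s *\<^sub>R v) \<le> \<theta> * real s"
            using that unfolding A_def by (simp add: dist_norm norm_minus_commute)
          then have "norm (u - z) \<le> \<theta> * (2 * real s)"
            using norm_triangle_ineq[of "u - real s *\<^sub>R v" "real s *\<^sub>R v - z"] \<open>norm (real s *\<^sub>R v - z) \<le> \<theta> * real s\<close>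
            by simp
          also have "\<dots> \<le> \<theta> * (4 * (1 + t))" using s(3) t \<theta> by (intro mult_left_mono) auto
          finally show ?thesis by (simp add: algebra_simps)
        qed
        have qA: "q u / 2 \<le> q z / 2 + \<epsilon>' * (1 + t\<^sup>2)" if "u \<in> A v s" for u
        proof -
          define d where "d = u - z"
          have d: "norm d \<le> 4 * \<theta> * (1 + t)" unfolding d_def by (rule near[OF that])
          have zSd: "z \<bullet> S d \<le> t * (b * norm d)"
            using norm_cauchy_schwarz[of z "S d"] b(2)[of d] unfolding t_def
            by (meson mult_left_mono norm_ge_zero order_trans)
          have qd: "q d \<le> norm d * (b * norm d)"
            using norm_cauchy_schwarz[of d "S d"] b(2)[of d] by (meson mult_left_mono norm_ge_zero order_trans)
          have u: "u = z + d" unfolding d_def by simp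
          have "q u = q z + 2 * (z \<bullet> S d) + q d"
            unfolding u by (simp add: linear_add[OF linear_S] inner_add_left inner_add_right sym_S[of d z])
          also have "\<dots> \<le> q z + 2 * (t * (b * norm d)) + norm d * (b * norm d)" using zSd qd by linarith
          also have "\<dots> \<le> q z + 2 * ((1 + t) * (b * (4 * \<theta> * (1 + t)))) + (4 * (1 + t)) * (b * (4 * \<theta> * (1 + t)))"
          proof (intro add_mono mult_mono order_refl d)
            have "4 * \<theta> * (1 + t) \<le> 4 * 1 * (1 + t)" using \<theta> t by (intro mult_right_mono) auto
            then show "norm d \<le> 4 * (1 + t)" using d by linarith
          qed (use t b \<theta> in auto)
          also have "\<dots> = q z + 24 * b * \<theta> * (1 + t)\<^sup>2" by (simp add: power2_eq_square algebra_simps)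
          also have "\<dots> \<le> q z + \<epsilon>' * (2 * (1 + t\<^sup>2))"
          proof (intro add_left_mono mult_mono \<theta>b)
            show "(1 + t)\<^sup>2 \<le> 2 * (1 + t\<^sup>2)" using zero_le_square[of "t - 1"] by (simp add: power2_eq_square algebra_simps)
          qed (use \<epsilon>' in auto)
          finally show ?thesis by (simp add: algebra_simps)
        qed
        have prob: "k * \<beta> * exp (- q z / 2 - \<epsilon>' * (1 + t\<^sup>2)) \<le> measure N (A v s)"
        proof -
          have "k * \<beta> * exp (- q z / 2 - \<epsilon>' * (1 + t\<^sup>2)) = k * exp (- (q z / 2 + \<epsilon>' * (1 + t\<^sup>2))) * \<beta>" by simp
          also have "\<dots> \<le> k * exp (- (q z / 2 + \<epsilon>' * (1 + t\<^sup>2))) * measure lborel (A v s)"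
            using k by (intro mult_left_mono vol s) auto
          also have "\<dots> \<le> measure N (A v s)"
          proof (rule measure_N_ge[OF _ _ qA])
            show "emeasure lborel (A v s) < \<infinity>" unfolding A_def by (rule emeasure_lborel_ball_finite)
          qed (simp add: A_def)
          finally show ?thesis .
        qed
        have "real n powr (\<epsilon> / 2) \<le> real n * measure N (A v s)"
        proof -
          have "q z / 2 \<le> (1 - \<epsilon>) * ln (real n)" using z by simp
          moreover have "\<epsilon>' * t\<^sup>2 \<le> \<epsilon> / 4 * ln (real n)"
          proof -
            have "\<epsilon>' * t\<^sup>2 \<le> (\<epsilon> * a0 / 8) * (2 * ln (real n) / a0)" using \<epsilon>' \<epsilon> a0 zn by (intro mult_mono) auto
            also have "\<dots> = \<epsilon> / 4 * ln (real n)" using a0 by simp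
            finally show ?thesis .
          qed
          ultimately have "- \<epsilon>' + 3 / 4 * \<epsilon> * ln (real n) \<le> ln (real n) + (- q z / 2 - \<epsilon>' * (1 + t\<^sup>2))"
            by (simp add: algebra_simps)
          then have "exp (- \<epsilon>' + 3 / 4 * \<epsilon> * ln (real n)) \<le> exp (ln (real n) + (- q z / 2 - \<epsilon>' * (1 + t\<^sup>2)))" by simp
          then have "exp (- \<epsilon>') * real n powr (3 / 4 * \<epsilon>) \<le> real n * exp (- q z / 2 - \<epsilon>' * (1 + t\<^sup>2))"
            using elim(4) unfolding exp_add by (simp add: powr_def)
          then have "(k * \<beta>) * (exp (- \<epsilon>') * real n powr (3 / 4 * \<epsilon>)) \<le> (k * \<beta>) * (real n * exp (- q z / 2 - \<epsilon>' * (1 + t\<^sup>2)))"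
            using k \<beta> by (intro mult_left_mono) auto
          also have "\<dots> = real n * (k * \<beta> * exp (- q z / 2 - \<epsilon>' * (1 + t\<^sup>2)))" by simp
          also have "\<dots> \<le> real n * measure N (A v s)" by (intro mult_left_mono prob) simp
          finally show ?thesis using elim(2) by (simp add: mult.assoc)
        qed
        then have cnt: "real n * measure N (A v s) / 2 < real (card {j. j < n \<and> X j \<omega> \<in> A v s})"
          using elim(1) v(1) sn by blast
        have "exp (- q z / 2 - \<epsilon> * (1 + t\<^sup>2)) \<le> exp (- q z / 2 - \<epsilon>' * (1 + t\<^sup>2))"
        proof -
          have "\<epsilon>' * (1 + t\<^sup>2) \<le> \<epsilon> * (1 + t\<^sup>2)" using \<epsilon>' \<epsilon> by (intro mult_right_mono) auto
          then show ?thesis by simp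
        qed
        then have "(k * \<beta> / 2) * real n * exp (- q z / 2 - \<epsilon> * (1 + t\<^sup>2))
            \<le> (k * \<beta> / 2) * real n * exp (- q z / 2 - \<epsilon>' * (1 + t\<^sup>2))"
          using k \<beta> by (intro mult_left_mono) auto
        also have "\<dots> = real n * (k * \<beta> * exp (- q z / 2 - \<epsilon>' * (1 + t\<^sup>2))) / 2" by simp
        also have "\<dots> \<le> real n * measure N (A v s) / 2" by (intro divide_right_mono mult_left_mono prob) auto
        also have "\<dots> \<le> real (card {j. j < n \<and> X j \<omega> \<in> A v s})" using cnt by simp
        also have "\<dots> \<le> real (card {j. j < n \<and> norm (X j \<omega> - z) \<le> \<epsilon> * (1 + t)})"
        proof -
          have "4 * \<theta> * (1 + t) \<le> \<epsilon> * (1 + t)" using \<theta> t by (intro mult_right_mono) auto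
          then have "{j. j < n \<and> X j \<omega> \<in> A v s} \<subseteq> {j. j < n \<and> norm (X j \<omega> - z) \<le> \<epsilon> * (1 + t)}"
            using near by (auto intro: order_trans)
          then show ?thesis by (intro of_nat_mono card_mono) auto
        qed
        finally show "(k * \<beta> / 2) * real n * exp (- q z / 2 - \<epsilon> * (1 + (norm z)\<^sup>2))
          \<le> real (card {j. j < n \<and> norm (X j \<omega> - z) \<le> \<epsilon> * (1 + norm z)})" unfolding t_def .
      qed
    qed
    then show ?case using k \<beta> by (intro exI[of _ "k * \<beta> / 2"]) auto
  qed
qed

text \<open>The assertion for a smaller \<open>\<epsilon>\<close> implies the one for a larger: more
  \<open>z\<close> are covered, the lower bound is larger and the ball smaller. So the values
  \<open>1 / (m + 1)\<close> suffice, with one null set.\<close>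

lemma AE_dense:
  "AE \<omega> in M. \<forall>\<epsilon>>0. \<exists>c>0. \<forall>\<^sub>F n in sequentially. \<forall>z. q z \<le> (1 - \<epsilon>) * (2 * ln (real n)) \<longrightarrow>
      c * real n * exp (- q z / 2 - \<epsilon> * (1 + (norm z)\<^sup>2))
        \<le> real (card {j. j < n \<and> norm (X j \<omega> - z) \<le> \<epsilon> * (1 + norm z)})"
proof -
  have "AE \<omega> in M. \<forall>m::nat. \<exists>c>0. \<forall>\<^sub>F n in sequentially. \<forall>z. q z \<le> (1 - 1 / real (Suc m)) * (2 * ln (real n)) \<longrightarrow>
      c * real n * exp (- q z / 2 - 1 / real (Suc m) * (1 + (norm z)\<^sup>2))
        \<le> real (card {j. j < n \<and> norm (X j \<omega> - z) \<le> 1 / real (Suc m) * (1 + norm z)})"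
    unfolding AE_all_countable by (intro allI AE_dense_fixed) auto
  then show ?thesis
  proof eventually_elim
    case (elim \<omega>)
    show ?case
    proof (intro allI impI)
      fix \<epsilon> :: real assume "\<epsilon> > 0"
      then obtain m where "inverse (real (Suc m)) < \<epsilon>" using reals_Archimedean by blast
      define e where "e = 1 / real (Suc m)"
      have e: "e > 0" "e \<le> \<epsilon>" using \<open>inverse (real (Suc m)) < \<epsilon>\<close> unfolding e_def inverse_eq_divide by auto
      obtain c where c: "c > 0" "\<forall>\<^sub>F n in sequentially. \<forall>z. q z \<le> (1 - e) * (2 * ln (real n)) \<longrightarrow>
          c * real n * exp (- q z / 2 - e * (1 + (norm z)\<^sup>2))
            \<le> real (card {j. j < n \<and> norm (X j \<omega> - z) \<le> e * (1 + norm z)})"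
        using elim[rule_format, of m] unfolding e_def by blast
      from c(2) have "\<forall>\<^sub>F n in sequentially. \<forall>z. q z \<le> (1 - \<epsilon>) * (2 * ln (real n)) \<longrightarrow>
          c * real n * exp (- q z / 2 - \<epsilon> * (1 + (norm z)\<^sup>2))
            \<le> real (card {j. j < n \<and> norm (X j \<omega> - z) \<le> \<epsilon> * (1 + norm z)})"
        using eventually_ge_at_top[of 1]
      proof eventually_elim
        case (elim n)
        show ?case
        proof (intro allI impI)
          fix z assume z: "q z \<le> (1 - \<epsilon>) * (2 * ln (real n))"
          have "(1 - \<epsilon>) * (2 * ln (real n)) \<le> (1 - e) * (2 * ln (real n))"
            using e elim(2) by (intro mult_right_mono) auto
          then have "q z \<le> (1 - e) * (2 * ln (real n))" using z by linarith
          then have 1: "c * real n * exp (- q z / 2 - e * (1 + (norm z)\<^sup>2))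
            \<le> real (card {j. j < n \<and> norm (X j \<omega> - z) \<le> e * (1 + norm z)})" using elim(1) by blast
          have "e * (1 + (norm z)\<^sup>2) \<le> \<epsilon> * (1 + (norm z)\<^sup>2)" using e by (intro mult_right_mono) auto
          then have "c * real n * exp (- q z / 2 - \<epsilon> * (1 + (norm z)\<^sup>2)) \<le> c * real n * exp (- q z / 2 - e * (1 + (norm z)\<^sup>2))"
            using c(1) by (intro mult_left_mono) auto
          also note 1
          also have "real (card {j. j < n \<and> norm (X j \<omega> - z) \<le> e * (1 + norm z)})
             \<le> real (card {j. j < n \<and> norm (X j \<omega> - z) \<le> \<epsilon> * (1 + norm z)})"
          proof -
            have "e * (1 + norm z) \<le> \<epsilon> * (1 + norm z)" using e by (intro mult_right_mono) auto
            then show ?thesis by (intro of_nat_mono card_mono) auto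
          qed
          finally show "c * real n * exp (- q z / 2 - \<epsilon> * (1 + (norm z)\<^sup>2))
            \<le> real (card {j. j < n \<and> norm (X j \<omega> - z) \<le> \<epsilon> * (1 + norm z)})" .
        qed
      qed
      then show "\<exists>c>0. \<forall>\<^sub>F n in sequentially. \<forall>z. q z \<le> (1 - \<epsilon>) * (2 * ln (real n)) \<longrightarrow>
          c * real n * exp (- q z / 2 - \<epsilon> * (1 + (norm z)\<^sup>2))
            \<le> real (card {j. j < n \<and> norm (X j \<omega> - z) \<le> \<epsilon> * (1 + norm z)})" using c(1) by blast
    qed
  qed
qed

text \<open>Randomness enters only through three almost sure events. A countable dense
  \<open>E\<close> keeps the third one a countable intersection over steps and centres.\<close>

lemma AE_bms_limit_tendsto_0:
  "AE \<omega> in M. \<forall>i. (\<lambda>n. lim (\<lambda>t. bms \<tau> n (\<lambda>j. X j \<omega>) t i)) \<longlonglongrightarrow> 0"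
proof -
  obtain B A l where B0: "B 0 = id" and BSuc: "\<And>t. B (Suc t) = B t \<circ> A t"
    and cm: "\<And>t. conditional_mean (B t) (A t)"
    and lam: "0 \<le> l" "l < 1" "\<And>t u. min_energy (B t) (A t) u \<le> l * q u"
    and small: "\<And>\<epsilon>. \<epsilon> > 0 \<Longrightarrow> \<exists>T::nat. \<forall>u. norm (B T u) \<le> \<epsilon> * norm u"
    using ex_population_dynamics by blast
  obtain E :: "(real^'p) set" where E: "countable E" "\<And>U. open U \<Longrightarrow> U \<noteq> {} \<Longrightarrow> \<exists>u\<in>E. u \<in> U"
    using countable_dense_exists by blast
  have clE: "closure E = UNIV"
  proof -
    have "v \<in> closure E" for v
      unfolding closure_approachable
    proof (intro allI impI)
      fix e :: real assume "e > 0"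
      then show "\<exists>u\<in>E. dist u v < e" using E(2)[of "ball v e"] by (auto simp: dist_commute)
    qed
    then show ?thesis by blast
  qed
  have "AE \<omega> in M. \<forall>t. \<forall>u\<in>E.
      (\<lambda>n. (\<Sum>j<n. gauss_kernel \<tau> (B t (u - X j \<omega>)) *\<^sub>R (X j \<omega> - A t u)) /\<^sub>R real n) \<longlonglongrightarrow> 0"
    unfolding AE_all_countable AE_ball_countable[OF E(1)] by (intro allI ballI AE_centered_sums cm)
  with AE_moment AE_dense show ?thesis
  proof eventually_elim
    case (elim \<omega>)
    \<comment> \<open>From here the outcome is fixed and the argument is deterministic.\<close>
    interpret blurring_sample S \<tau> a0 b0 "\<lambda>j. X j \<omega>"
      by unfold_locales (use elim(1,2) in blast)+
    show ?case
      by (rule allI, rule bms_limit_tendsto_0[OF B0 BSuc cm lam small clE]) (assumption | rule elim(3)[rule_format])+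
  qed
qed

end

text \<open>The form attains its extremes on the compact unit sphere, and it is homogeneous of
  degree 2.\<close>

lemma pos_def_form_bounds:
  fixes S :: "'b::euclidean_space \<Rightarrow> 'b"
  assumes "linear S" and pos: "\<And>u. u \<noteq> 0 \<Longrightarrow> u \<bullet> S u > 0"
  shows "\<exists>a>0. \<exists>b. \<forall>u. a * (norm u)\<^sup>2 \<le> u \<bullet> S u \<and> u \<bullet> S u \<le> b * (norm u)\<^sup>2"
proof -
  have cont: "continuous_on (sphere 0 1) (\<lambda>u. u \<bullet> S u)"
    using linear_continuous_on[OF linear_conv_bounded_linear[THEN iffD1, OF assms(1)]]
    by (intro continuous_intros) auto
  have ne: "sphere (0::'b) 1 \<noteq> {}" by simp
  obtain v where v: "v \<in> sphere 0 1" "\<And>u. u \<in> sphere 0 1 \<Longrightarrow> v \<bullet> S v \<le> u \<bullet> S u"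
    using continuous_attains_inf[OF compact_sphere ne cont] by blast
  obtain w where w: "\<And>u. u \<in> sphere 0 1 \<Longrightarrow> u \<bullet> S u \<le> w \<bullet> S w"
    using continuous_attains_sup[OF compact_sphere ne cont] by blast
  have "(v \<bullet> S v) * (norm u)\<^sup>2 \<le> u \<bullet> S u \<and> u \<bullet> S u \<le> (w \<bullet> S w) * (norm u)\<^sup>2" for u
  proof (cases "u = 0")
    case False
    define e where "e = (1 / norm u) *\<^sub>R u"
    have e: "e \<in> sphere 0 1" "u = norm u *\<^sub>R e" unfolding e_def using False by auto
    have "u \<bullet> S u = (norm u)\<^sup>2 * (e \<bullet> S e)"
      by (subst (1 2) e(2)) (simp add: linear_cmul[OF assms(1)] power2_eq_square)
    then show ?thesis using v(2)[OF e(1)] w[OF e(1)]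
      by (auto simp: mult.commute[of "(norm u)\<^sup>2"] intro!: mult_right_mono)
  qed (simp add: linear_0[OF assms(1)])
  moreover have "v \<bullet> S v > 0" using v(1) by (intro pos) auto
  ultimately show ?thesis by blast
qed

text \<open>By the first conjunct the total function \<open>lim\<close> in the second denotes a
  genuine limit as soon as \<open>n > i\<close>; the finitely many smaller \<open>n\<close> do not
  affect the outer limit.\<close>

theorem theorem2:
  fixes M :: "'a measure" and X :: "nat \<Rightarrow> 'a \<Rightarrow> real^'p"
    and \<Sigma> :: "real^'p^'p" and \<tau> :: real
  assumes "prob_space M"
    and "prob_space.indep_vars M (\<lambda>_. borel) X UNIV"
    and "\<And>i. distr M borel (X i) = mvn \<Sigma>"
    and "pos_def_matrix \<Sigma>"
    and "\<tau> > 0"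
  shows "(\<forall>\<omega>\<in>space M. \<forall>n>0. \<exists>c. \<forall>i<n.
            (\<lambda>t. bms \<tau> n (\<lambda>j. X j \<omega>) t i) \<longlonglongrightarrow> c)
       \<and> (AE \<omega> in M. \<forall>i. (\<lambda>n. lim (\<lambda>t. bms \<tau> n (\<lambda>j. X j \<omega>) t i)) \<longlonglongrightarrow> 0)"
proof
  show "\<forall>\<omega>\<in>space M. \<forall>n>0. \<exists>c. \<forall>i<n. (\<lambda>t. bms \<tau> n (\<lambda>j. X j \<omega>) t i) \<longlonglongrightarrow> c"
    using bms_convergent by blast
  have sym: "transpose \<Sigma> = \<Sigma>" and pos: "\<And>v. v \<noteq> 0 \<Longrightarrow> v \<bullet> (\<Sigma> *v v) > 0"
    using assms(4) unfolding pos_def_matrix_def by auto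
  define S where "S u = matrix_inv \<Sigma> *v u" for u
  have "invertible \<Sigma>"
    unfolding invertible_left_inverse matrix_left_invertible_ker using pos by force
  then have "\<Sigma> ** matrix_inv \<Sigma> = mat 1"
    unfolding invertible_def matrix_inv_def by (rule someI2_ex) (erule conjunct1)
  then have inv: "\<Sigma> *v S u = u" for u
    unfolding S_def by (simp add: matrix_vector_mul_assoc)
  have linS: "linear S" unfolding S_def[abs_def] by (rule matrix_vector_mul_linear)
  have symS: "u \<bullet> S v = v \<bullet> S u" for u v
  proof -
    have "u \<bullet> S v = (\<Sigma> *v S u) \<bullet> S v" by (simp add: inv)
    also have "\<dots> = S u \<bullet> (\<Sigma> *v S v)" 
      unfolding dot_lmul_matrix[symmetric] transpose_matrix_vector[symmetric] sym ..
    finally show ?thesis by (simp add: inv inner_commute)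
  qed
  have posS: "u \<bullet> S u > 0" if "u \<noteq> 0" for u
  proof -
    have "S u \<noteq> 0" using inv[of u] that by auto
    from pos[OF this] show ?thesis by (simp add: inv inner_commute)
  qed
  obtain a b where ab: "a > 0" "\<And>u. a * (norm u)\<^sup>2 \<le> u \<bullet> S u" "\<And>u. u \<bullet> S u \<le> b * (norm u)\<^sup>2"
    using pos_def_form_bounds[OF linS posS] by blast
  interpret prob_space M by fact
  define k where "k = 1 / sqrt ((2 * pi) ^ CARD('p) * det \<Sigma>)"
  have density: "mvn \<Sigma> = density lborel (\<lambda>u. ennreal (k * exp (- (u \<bullet> S u) / 2)))"
    unfolding mvn_def mvn_density_def k_def S_def by simp
  have "random_variable borel (X 0)" using assms(2) unfolding indep_vars_def by auto
  from prob_space_distr[OF this] have "prob_space (mvn \<Sigma>)" unfolding assms(3) .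
  \<comment> \<open>Positivity is obtained without computing the determinant: for
    \<open>k \<le> 0\<close> the density would be 0 in \<open>ennreal\<close>, contradicting that
    \<open>mvn \<Sigma>\<close> is the law of \<open>X 0\<close>.\<close>
  have k: "k > 0"
  proof (rule ccontr)
    assume "\<not> k > 0"
    then have "ennreal (k * exp (- (u \<bullet> S u) / 2)) = 0" for u
      by (intro ennreal_neg mult_nonpos_nonneg) auto
    then have "emeasure (mvn \<Sigma>) (space (mvn \<Sigma>)) = 0" unfolding density by (simp add: emeasure_density)
    then show False using prob_space.emeasure_space_1[OF \<open>prob_space (mvn \<Sigma>)\<close>] by simp
  qed
  interpret gaussian_sample S \<tau> a b M X "mvn \<Sigma>" k
    by unfold_locales (fact assms ab k symS density linear_add[OF linS] linear_cmul[OF linS])+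
  show "AE \<omega> in M. \<forall>i. (\<lambda>n. lim (\<lambda>t. bms \<tau> n (\<lambda>j. X j \<omega>) t i)) \<longlonglongrightarrow> 0"
    by (rule AE_bms_limit_tendsto_0)
qed

end
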